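(* In the lattice $\mathbf{L}$ of interpretability types of varieties, the filter consisting of the interpretability types of all Taylor varieties is prime.
   Context: A clone on a set $A$ is a set of finitary operations on $A$ containing all projections and closed under composition. The clone of a variety $\mathcal{V}$ is the clone of term operations of the free algebra of $\mathcal{V}$ on countably many free generators. A clone homomorphism is a map between clones that sends each projection to the corresponding projection and commutes with composition. A variety $\mathcal{V}$ interprets in a variety $\mathcal{W}$ if there is a clone homomorphism from the clone of $\mathcal{V}$ to the clone of $\mathcal{W}$. Interpretability is a quasiorder on the class of varieties; the blocks of the associated equivalence are called interpretability types, and the quotient is the (class-sized) lattice $\mathbf{L}$ of interpretability types (Garcia–Taylor), ordered by interpretability. The join in $\mathbf{L}$ is induced by the following: if $\mathcal{V}_1,\mathcal{V}_2$ are varieties of disjoint signatures defined by sets of identities $\Sigma_1,\Sigma_2$, then $\mathcal{V}_1\vee\mathcal{V}_2$ is the variety (in the union of the signatures) defined by $\Sigma_1\cup\Sigma_2$. A filter of a lattice is an upwardly closed sublattice. A filter $F$ is prime if $F$ is a proper subset of the lattice and for any two elements $a,b\notin F$ we have $a\vee b\notin F$. An operation $f$ on $A$ is idempotent if $f(a,\dots,a)=a$ for all $a\in A$; a variety is idempotent if all operations in its clone are idempotent. A strong Maltsev condition is a finite set $M$ of identities; a variety $\mathcal{V}$ admits $M$ if the variety defined by $M$ interprets in $\mathcal{V}$; $M$ is idempotent if the variety defined by $M$ is idempotent. Let $\mathcal{SET}$ be the variety of algebras with no basic operations. $M$ is trivial if $\mathcal{SET}$ admits $M$. A Taylor variety is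 a variety that admits some non-trivial idempotent strong Maltsev condition. *)

theory Defs
  imports "HOL-Algebra.Lattice" "HOL-Library.FuncSet"
begin

section \<open>Clones of finitary operations\<close>

definition tuples :: "'a set \<Rightarrow> nat \<Rightarrow> 'a list set" where
  "tuples A n = {xs \<in> lists A. length xs = n}"

definition operations :: "'a set \<Rightarrow> nat \<Rightarrow> ('a list \<Rightarrow> 'a) set" where
  "operations A n = tuples A n \<rightarrow>\<^sub>E A"

definition projection :: "'a set \<Rightarrow> nat \<Rightarrow> nat \<Rightarrow> 'a list \<Rightarrow> 'a" where
  "projection A n i = restrict (\<lambda>xs. xs ! i) (tuples A n)"

definition compose_ops ::
  "'a set \<Rightarrow> nat \<Rightarrow> ('a list \<Rightarrow> 'a) \<Rightarrow> ('a list \<Rightarrow> 'a) list \<Rightarrow> 'a list \<Rightarrow> 'a" where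
  "compose_ops A n f gs = restrict (\<lambda>xs. f (map (\<lambda>g. g xs) gs)) (tuples A n)"

text \<open>A clone is given as the family \<open>C n\<close> of its \<open>n\<close>-ary members.
  Nullary operations are allowed.\<close>

definition is_clone :: "'a set \<Rightarrow> (nat \<Rightarrow> ('a list \<Rightarrow> 'a) set) \<Rightarrow> bool" where
  "is_clone A C \<longleftrightarrow>
     (\<forall>n. C n \<subseteq> operations A n) \<and>
     (\<forall>n i. i < n \<longrightarrow> projection A n i \<in> C n) \<and>
     (\<forall>m n. \<forall>f \<in> C m. \<forall>gs \<in> tuples (C n) m. compose_ops A n f gs \<in> C n)"

definition clone_hom ::
  "'a set \<Rightarrow> (nat \<Rightarrow> ('a list \<Rightarrow> 'a) set) \<Rightarrow> 'b set \<Rightarrow> (nat \<Rightarrow> ('b list \<Rightarrow> 'b) set) \<Rightarrow>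
   (nat \<Rightarrow> ('a list \<Rightarrow> 'a) \<Rightarrow> ('b list \<Rightarrow> 'b)) \<Rightarrow> bool" where
  "clone_hom A C B D h \<longleftrightarrow>
     (\<forall>n. \<forall>f \<in> C n. h n f \<in> D n) \<and>
     (\<forall>n i. i < n \<longrightarrow> h n (projection A n i) = projection B n i) \<and>
     (\<forall>m n. \<forall>f \<in> C m. \<forall>gs \<in> tuples (C n) m.
        h n (compose_ops A n f gs) = compose_ops B n (h m f) (map (h n) gs))"

definition idempotent_op :: "'a set \<Rightarrow> nat \<Rightarrow> ('a list \<Rightarrow> 'a) \<Rightarrow> bool" where
  "idempotent_op A n f \<longleftrightarrow> (\<forall>a \<in> A. f (replicate n a) = a)"

section \<open>Terms, algebras, varieties\<close>

datatype 'f trm = Var nat | App 'f "'f trm list"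

text \<open>An operation symbol is a name together with its arity; the arity is read off a term from
  the number of arguments.\<close>

primrec symbols_of :: "'f trm \<Rightarrow> ('f \<times> nat) set" where
  "symbols_of (Var x) = {}"
| "symbols_of (App f ts) = insert (f, length ts) (\<Union>(set (map symbols_of ts)))"

primrec vars_of :: "'f trm \<Rightarrow> nat set" where
  "vars_of (Var x) = {x}"
| "vars_of (App f ts) = \<Union>(set (map vars_of ts))"

text \<open>\<open>eval I \<rho> t\<close> is the value of \<open>t\<close> under the assignment \<open>\<rho>\<close>; with \<open>I = App\<close> it is
  the result of substituting \<open>\<rho>\<close> in \<open>t\<close>.\<close>

primrec eval :: "('f \<Rightarrow> 'a list \<Rightarrow> 'a) \<Rightarrow> (nat \<Rightarrow> 'a) \<Rightarrow> 'f trm \<Rightarrow> 'a" where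
  "eval I \<rho> (Var x) = \<rho> x"
| "eval I \<rho> (App f ts) = I f (map (eval I \<rho>) ts)"

text \<open>A variety is given by a signature and a set of identities over it.\<close>

record 'f variety =
  signature :: "('f \<times> nat) set"
  identities :: "('f trm \<times> 'f trm) set"

definition terms_over :: "('f \<times> nat) set \<Rightarrow> 'f trm set" where
  "terms_over S = {t. symbols_of t \<subseteq> S}"

definition varieties :: "'f variety set" where
  "varieties = {V. identities V \<subseteq> terms_over (signature V) \<times> terms_over (signature V)}"

definition in_variety :: "'f variety \<Rightarrow> 'a set \<Rightarrow> ('f \<Rightarrow> 'a list \<Rightarrow> 'a) \<Rightarrow> bool" where
  "in_variety V A I \<longleftrightarrow>
     (\<forall>(f, n) \<in> signature V. \<forall>xs \<in> tuples A n. I f xs \<in> A) \<and>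
     (\<forall>(s, t) \<in> identities V. \<forall>\<rho> \<in> UNIV \<rightarrow> A. eval I \<rho> s = eval I \<rho> t)"

section \<open>The free algebra on countably many generators and the clone of a variety\<close>

text \<open>The congruence of the term algebra generated by all substitution instances of the
  identities.\<close>

inductive_set free_cong :: "'f variety \<Rightarrow> ('f trm \<times> 'f trm) set" for V where
  refl: "t \<in> terms_over (signature V) \<Longrightarrow> (t, t) \<in> free_cong V"
| sym: "(s, t) \<in> free_cong V \<Longrightarrow> (t, s) \<in> free_cong V"
| trans: "(s, t) \<in> free_cong V \<Longrightarrow> (t, u) \<in> free_cong V \<Longrightarrow> (s, u) \<in> free_cong V"
| cong: "(f, length ss) \<in> signature V \<Longrightarrow> list_all2 (\<lambda>s t. (s, t) \<in> free_cong V) ss ts \<Longrightarrow>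
    (App f ss, App f ts) \<in> free_cong V"
| inst: "(s, t) \<in> identities V \<Longrightarrow> \<sigma> \<in> UNIV \<rightarrow> terms_over (signature V) \<Longrightarrow>
    (eval App \<sigma> s, eval App \<sigma> t) \<in> free_cong V"

definition free_carrier :: "'f variety \<Rightarrow> 'f trm set set" where
  "free_carrier V = terms_over (signature V) // free_cong V"

definition free_interp :: "'f variety \<Rightarrow> 'f \<Rightarrow> 'f trm set list \<Rightarrow> 'f trm set" where
  "free_interp V f Xs = free_cong V `` {App f (map (\<lambda>X. SOME t. t \<in> X) Xs)}"

definition variety_clone :: "'f variety \<Rightarrow> nat \<Rightarrow> ('f trm set list \<Rightarrow> 'f trm set) set" where
  "variety_clone V n =
     {restrict (\<lambda>xs. eval (free_interp V) (\<lambda>i. xs ! i) t) (tuples (free_carrier V) n) |t.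
        t \<in> terms_over (signature V) \<and> vars_of t \<subseteq> {..<n}}"

section \<open>Interpretability and Taylor varieties\<close>

definition interprets :: "'f variety \<Rightarrow> 'g variety \<Rightarrow> bool" where
  "interprets V W \<longleftrightarrow>
     (\<exists>h. clone_hom (free_carrier V) (variety_clone V) (free_carrier W) (variety_clone W) h)"

definition idempotent_variety :: "'f variety \<Rightarrow> bool" where
  "idempotent_variety V \<longleftrightarrow>
     (\<forall>n. \<forall>f \<in> variety_clone V n. idempotent_op (free_carrier V) n f)"

text \<open>The variety defined by a set of identities; its signature consists of the symbols
  occurring in them.\<close>

definition variety_of :: "('f trm \<times> 'f trm) set \<Rightarrow> 'f variety" where
  "variety_of M =
     \<lparr>signature = (\<Union>(s, t) \<in> M. symbols_of s \<union> symbols_of t), identities = M\<rparr>"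

definition SET :: "nat variety" where
  "SET = \<lparr>signature = {}, identities = {}\<rparr>"

text \<open>Finitely many symbols can always be named by natural numbers, so strong Maltsev conditions
  are taken over the type \<open>nat\<close> of names.\<close>

type_synonym identity_set = "(nat trm \<times> nat trm) set"

definition strong_maltsev_condition :: "identity_set \<Rightarrow> bool" where
  "strong_maltsev_condition M \<longleftrightarrow> finite M"

definition admits :: "'f variety \<Rightarrow> identity_set \<Rightarrow> bool" where
  "admits V M \<longleftrightarrow> interprets (variety_of M) V"

definition idempotent_condition :: "identity_set \<Rightarrow> bool" where
  "idempotent_condition M \<longleftrightarrow> idempotent_variety (variety_of M)"

definition trivial_condition :: "identity_set \<Rightarrow> bool" where
  "trivial_condition M \<longleftrightarrow> admits SET M"

definition taylor_variety :: "'f variety \<Rightarrow> bool" where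
  "taylor_variety V \<longleftrightarrow>
     (\<exists>M. strong_maltsev_condition M \<and> idempotent_condition M \<and> \<not> trivial_condition M \<and>
          admits V M)"

section \<open>The lattice of interpretability types\<close>

definition equi_interpretable :: "('f variety \<times> 'f variety) set" where
  "equi_interpretable =
     {(V, W). V \<in> varieties \<and> W \<in> varieties \<and> interprets V W \<and> interprets W V}"

definition interpretability_type :: "'f variety \<Rightarrow> 'f variety set" where
  "interpretability_type V = equi_interpretable `` {V}"

text \<open>Interpretability types of the varieties whose symbols have names in \<open>'f\<close>. For infinite
  \<open>'f\<close> this is a sublattice of the class-sized lattice of all interpretability types, because
  \<open>'f\<close> then has room for disjoint copies of two signatures and for names of all pairs of terms;
  any two varieties (indeed any set of varieties) can be named in a common infinite \<open>'f\<close>.\<close>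

definition interp_lattice :: "'f variety set gorder" where
  "interp_lattice =
     \<lparr>carrier = varieties // equi_interpretable, eq = (=),
      le = (\<lambda>X Y. \<exists>V \<in> X. \<exists>W \<in> Y. interprets V W)\<rparr>"

definition taylor_types :: "'f variety set set" where
  "taylor_types = {interpretability_type V |V. V \<in> varieties \<and> taylor_variety V}"

definition lattice_filter :: "('a, 'b) gorder_scheme \<Rightarrow> 'a set \<Rightarrow> bool" where
  "lattice_filter L F \<longleftrightarrow>
     lattice L \<and> F \<subseteq> carrier L \<and> F \<noteq> {} \<and>
     (\<forall>a \<in> F. \<forall>b \<in> F. a \<squnion>\<^bsub>L\<^esub> b \<in> F \<and> a \<sqinter>\<^bsub>L\<^esub> b \<in> F) \<and>
     (\<forall>a \<in> F. \<forall>b \<in> carrier L. a \<sqsubseteq>\<^bsub>L\<^esub> b \<longrightarrow> b \<in> F)"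

definition prime_filter :: "('a, 'b) gorder_scheme \<Rightarrow> 'a set \<Rightarrow> bool" where
  "prime_filter L F \<longleftrightarrow>
     lattice_filter L F \<and> F \<subset> carrier L \<and>
     (\<forall>a \<in> carrier L. \<forall>b \<in> carrier L. a \<notin> F \<longrightarrow> b \<notin> F \<longrightarrow> a \<squnion>\<^bsub>L\<^esub> b \<notin> F)"

section \<open>Adequacy of the free algebra\<close>

lemma subst_closed:
  assumes "t \<in> terms_over S" "\<sigma> \<in> UNIV \<rightarrow> terms_over S"
  shows "eval App \<sigma> t \<in> terms_over S"
  using assms(1)
proof (induction t)
  case (App f ts)
  then have "\<forall>u \<in> set ts. u \<in> terms_over S" by (auto simp: terms_over_def)
  with App.IH have "\<forall>u \<in> set ts. eval App \<sigma> u \<in> terms_over S" by blast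
  with App.prems show ?case by (auto simp: terms_over_def)
qed (use assms(2) in auto)

lemma free_cong_terms:
  assumes V: "V \<in> varieties" and st: "(s, t) \<in> free_cong V"
  shows "s \<in> terms_over (signature V) \<and> t \<in> terms_over (signature V)"
  using st
proof (induction rule: free_cong.induct)
  case (cong f ss ts)
  have "\<forall>u \<in> set ss \<union> set ts. u \<in> terms_over (signature V)"
    using cong(2) by (auto simp: list_all2_conv_all_nth in_set_conv_nth)
  moreover have "length ts = length ss" using cong(2) by (auto dest: list_all2_lengthD)
  ultimately show ?case using cong(1) by (auto simp: terms_over_def)
next
  case (inst s t \<sigma>)
  then have "s \<in> terms_over (signature V)" "t \<in> terms_over (signature V)"
    using V by (auto simp: varieties_def)
  then show ?case using subst_closed inst(2) by blast
qed auto

lemma equiv_free_cong: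
  assumes "V \<in> varieties"
  shows "equiv (terms_over (signature V)) (free_cong V)"
proof (intro equivI refl_onI symI transI)
  show "free_cong V \<subseteq> terms_over (signature V) \<times> terms_over (signature V)"
    using free_cong_terms[OF assms] by auto
qed (blast intro: free_cong.refl free_cong.sym free_cong.trans)+

lemma free_interp_classes:
  assumes V: "V \<in> varieties" and f: "(f, length ts) \<in> signature V"
    and ts: "set ts \<subseteq> terms_over (signature V)"
  shows "free_interp V f (map (\<lambda>t. free_cong V `` {t}) ts) = free_cong V `` {App f ts}"
proof -
  let ?c = "\<lambda>t. SOME u. u \<in> free_cong V `` {t}"
  have "(t, ?c t) \<in> free_cong V" if "t \<in> set ts" for t
    using someI[of "\<lambda>u. u \<in> free_cong V `` {t}" t] that ts free_cong.refl by fastforce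
  then have "(App f ts, App f (map ?c ts)) \<in> free_cong V"
    by (intro free_cong.cong f) (auto simp: list_all2_conv_all_nth)
  then show ?thesis
    using equiv_class_eq[OF equiv_free_cong[OF V]] by (simp add: free_interp_def comp_def)
qed

lemma eval_free:
  assumes V: "V \<in> varieties" and t: "t \<in> terms_over (signature V)"
    and \<sigma>: "\<sigma> \<in> UNIV \<rightarrow> terms_over (signature V)"
  shows "eval (free_interp V) (\<lambda>x. free_cong V `` {\<sigma> x}) t = free_cong V `` {eval App \<sigma> t}"
  using t
proof (induction t)
  case (App f ts)
  have ts: "u \<in> terms_over (signature V)" if "u \<in> set ts" for u
    using App.prems that by (auto simp: terms_over_def)
  have f: "(f, length (map (eval App \<sigma>) ts)) \<in> signature V"
    using App.prems by (auto simp: terms_over_def)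
  have "map (eval (free_interp V) (\<lambda>x. free_cong V `` {\<sigma> x})) ts =
      map (\<lambda>t. free_cong V `` {t}) (map (eval App \<sigma>) ts)"
    using App.IH ts by simp
  moreover have "set (map (eval App \<sigma>) ts) \<subseteq> terms_over (signature V)"
    using ts subst_closed[OF _ \<sigma>] by auto
  ultimately show ?case
    using free_interp_classes[OF V f] by (simp del: map_map)
qed auto

text \<open>The quotient algebra belongs to the variety.\<close>

lemma free_algebra_in_variety:
  assumes V: "V \<in> varieties"
  shows "in_variety V (free_carrier V) (free_interp V)"
proof -
  have rep: "\<exists>ts. set ts \<subseteq> terms_over (signature V) \<and> Xs = map (\<lambda>t. free_cong V `` {t}) ts"
    if "set Xs \<subseteq> free_carrier V" for Xs
    using that
  proof (induction Xs)
    case (Cons X Xs)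
    then obtain ts t where "set ts \<subseteq> terms_over (signature V)"
      "Xs = map (\<lambda>t. free_cong V `` {t}) ts" "t \<in> terms_over (signature V)"
      "X = free_cong V `` {t}"
      by (auto simp: free_carrier_def elim!: quotientE)
    then show ?case by (intro exI[of _ "t # ts"]) auto
  qed auto
  have "free_interp V f xs \<in> free_carrier V"
    if fn: "(f, n) \<in> signature V" and xs: "xs \<in> tuples (free_carrier V) n" for f n xs
  proof -
    obtain ts where ts: "set ts \<subseteq> terms_over (signature V)"
      "xs = map (\<lambda>t. free_cong V `` {t}) ts"
      using rep[of xs] xs by (auto simp: tuples_def)
    then have f: "(f, length ts) \<in> signature V" using fn xs by (auto simp: tuples_def)
    then have "App f ts \<in> terms_over (signature V)" using ts by (auto simp: terms_over_def)
    then show ?thesis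
      using free_interp_classes[OF V f] ts by (auto simp: free_carrier_def intro: quotientI)
  qed
  moreover have "eval (free_interp V) \<rho> s = eval (free_interp V) \<rho> t"
    if st: "(s, t) \<in> identities V" and \<rho>: "\<rho> \<in> UNIV \<rightarrow> free_carrier V" for s t \<rho>
  proof -
    have "\<forall>x. \<exists>u. u \<in> terms_over (signature V) \<and> \<rho> x = free_cong V `` {u}"
      using \<rho> by (fastforce simp: free_carrier_def elim!: quotientE)
    then obtain \<sigma> where \<sigma>: "\<And>x. \<sigma> x \<in> terms_over (signature V)"
      "\<And>x. \<rho> x = free_cong V `` {\<sigma> x}"
      by metis
    then have \<rho>_eq: "\<rho> = (\<lambda>x. free_cong V `` {\<sigma> x})" by auto
    have "free_cong V `` {eval App \<sigma> s} = free_cong V `` {eval App \<sigma> t}"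
      using st \<sigma>(1) by (intro equiv_class_eq[OF equiv_free_cong[OF V]] free_cong.inst) auto
    then show ?thesis
      using eval_free[OF V, of s \<sigma>] eval_free[OF V, of t \<sigma>] st V \<sigma>(1)
      by (auto simp: \<rho>_eq varieties_def)
  qed
  ultimately show ?thesis by (auto simp: in_variety_def)
qed

lemma eval_closed:
  assumes "in_variety V A I" "t \<in> terms_over (signature V)" "\<rho> \<in> UNIV \<rightarrow> A"
  shows "eval I \<rho> t \<in> A"
  using assms(2)
proof (induction t)
  case (App f ts)
  then have "\<forall>u \<in> set ts. eval I \<rho> u \<in> A" by (fastforce simp: terms_over_def)
  then have "map (eval I \<rho>) ts \<in> tuples A (length ts)" by (auto simp: tuples_def)
  moreover have "(f, length ts) \<in> signature V" using App.prems by (auto simp: terms_over_def)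
  ultimately show ?case using assms(1) by (fastforce simp: in_variety_def)
qed (use assms(3) in auto)

lemma eval_subst: "eval I \<rho> (eval App \<sigma> t) = eval I (\<lambda>x. eval I \<rho> (\<sigma> x)) t"
  by (induction t) (auto simp: comp_def intro!: arg_cong[of _ _ "I _"])

lemma eval_cong_vars: "(\<And>x. x \<in> vars_of t \<Longrightarrow> \<rho> x = \<rho>' x) \<Longrightarrow> eval I \<rho> t = eval I \<rho>' t"
proof (induction t)
  case (App f ts)
  then have "eval I \<rho> u = eval I \<rho>' u" if "u \<in> set ts" for u using that by fastforce
  then show ?case by (simp cong: map_cong)
qed auto

lemma free_cong_sound:
  assumes "in_variety V A I" "(s, t) \<in> free_cong V" "\<rho> \<in> UNIV \<rightarrow> A"
  shows "eval I \<rho> s = eval I \<rho> t"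
  using assms(2)
proof (induction rule: free_cong.induct)
  case (cong f ss ts)
  then have "map (eval I \<rho>) ss = map (eval I \<rho>) ts"
    by (auto simp: list_all2_conv_all_nth intro: nth_equalityI)
  then show ?case by simp
next
  case (inst s t \<sigma>)
  have "(\<lambda>x. eval I \<rho> (\<sigma> x)) \<in> UNIV \<rightarrow> A"
    using inst eval_closed[OF assms(1) _ assms(3)] by auto
  then show ?case using assms(1) inst by (fastforce simp: in_variety_def eval_subst)
qed auto

text \<open>Two terms are identified exactly if the identity they form holds throughout the variety;
  by \<open>free_cong_sound\<close> every assignment into an algebra of the variety extends to the
  quotient algebra, which is therefore free on the classes of the variables.\<close>

lemma free_cong_iff:
  assumes V: "V \<in> varieties"
    and s: "s \<in> terms_over (signature V)" and t: "t \<in> terms_over (signature V)"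
  shows "(s, t) \<in> free_cong V \<longleftrightarrow>
    (\<forall>A (I :: 'f \<Rightarrow> 'f trm set list \<Rightarrow> 'f trm set). in_variety V A I \<longrightarrow>
       (\<forall>\<rho> \<in> UNIV \<rightarrow> A. eval I \<rho> s = eval I \<rho> t))"
proof
  assume *: "\<forall>A (I :: 'f \<Rightarrow> 'f trm set list \<Rightarrow> 'f trm set). in_variety V A I \<longrightarrow>
       (\<forall>\<rho> \<in> UNIV \<rightarrow> A. eval I \<rho> s = eval I \<rho> t)"
  have id: "eval App Var u = u" for u :: "'f trm"
    by (induction u) (auto intro: map_idI)
  have var: "Var \<in> UNIV \<rightarrow> terms_over (signature V)" by (auto simp: terms_over_def)
  have "(\<lambda>x. free_cong V `` {Var x}) \<in> UNIV \<rightarrow> free_carrier V"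
    using var by (auto simp: free_carrier_def intro!: quotientI)
  then have "free_cong V `` {s} = free_cong V `` {t}"
    using * free_algebra_in_variety[OF V] eval_free[OF V s var] eval_free[OF V t var]
    by (auto simp: id)
  then show "(s, t) \<in> free_cong V"
    using eq_equiv_class[OF _ equiv_free_cong[OF V] t] by blast
qed (use free_cong_sound in blast)

text \<open>The term operations of the free algebra form a clone.\<close>

lemma is_clone_variety_clone:
  assumes V: "V \<in> varieties"
  shows "is_clone (free_carrier V) (variety_clone V)"
proof -
  let ?A = "free_carrier V" and ?I = "free_interp V"
  have ne: "\<exists>a. a \<in> ?A"
    by (rule exI[of _ "free_cong V `` {Var 0}"])
      (auto simp: free_carrier_def terms_over_def intro!: quotientI)
  have closed: "eval ?I (\<lambda>i. xs ! i) t \<in> ?A"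
    if t: "t \<in> terms_over (signature V)" "vars_of t \<subseteq> {..<n}" and xs: "xs \<in> tuples ?A n"
    for t xs n
  proof -
    obtain a where a: "a \<in> ?A" using ne by blast
    have "eval ?I (\<lambda>i. xs ! i) t = eval ?I (\<lambda>i. if i < n then xs ! i else a) t"
      by (rule eval_cong_vars) (use t in auto)
    then show ?thesis
      using eval_closed[OF free_algebra_in_variety[OF V] t(1),
          of "\<lambda>i. if i < n then xs ! i else a"] xs a
      by (auto simp: tuples_def)
  qed
  have "variety_clone V n \<subseteq> operations ?A n" for n
    using closed by (auto simp: variety_clone_def operations_def)
  moreover have "projection ?A n i \<in> variety_clone V n" if "i < n" for n i
    using that unfolding variety_clone_def projection_def
    by (intro CollectI exI[of _ "Var i"]) (auto simp: terms_over_def)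
  moreover have "compose_ops ?A n f gs \<in> variety_clone V n"
    if f: "f \<in> variety_clone V m" and gs: "gs \<in> tuples (variety_clone V n) m" for m n f gs
  proof -
    obtain t where t: "t \<in> terms_over (signature V)" "vars_of t \<subseteq> {..<m}"
      and f_eq: "f = restrict (\<lambda>xs. eval ?I (\<lambda>i. xs ! i) t) (tuples ?A m)"
      using f by (auto simp: variety_clone_def)
    have "\<forall>i<m. \<exists>u. u \<in> terms_over (signature V) \<and> vars_of u \<subseteq> {..<n} \<and>
        gs ! i = restrict (\<lambda>xs. eval ?I (\<lambda>i. xs ! i) u) (tuples ?A n)"
      using gs by (fastforce simp: variety_clone_def tuples_def dest: nth_mem)
    then obtain u where u: "\<And>i. i < m \<Longrightarrow> u i \<in> terms_over (signature V)"
      "\<And>i. i < m \<Longrightarrow> vars_of (u i) \<subseteq> {..<n}"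
      "\<And>i. i < m \<Longrightarrow> gs ! i = restrict (\<lambda>xs. eval ?I (\<lambda>i. xs ! i) (u i)) (tuples ?A n)"
      by metis
    let ?t = "eval App u t"
    have t': "?t \<in> terms_over (signature V) \<and> vars_of ?t \<subseteq> {..<n}"
      using t
    proof (induction t)
      case (App g ts)
      have ts: "w \<in> terms_over (signature V)" "vars_of w \<subseteq> {..<m}" if "w \<in> set ts" for w
        using App.prems that by (auto simp: terms_over_def)
      have IH: "eval App u w \<in> terms_over (signature V)" "vars_of (eval App u w) \<subseteq> {..<n}"
        if "w \<in> set ts" for w
        using App.IH[OF that ts[OF that]] by auto
      have "(g, length ts) \<in> signature V" using App.prems by (simp add: terms_over_def)
      moreover have "(\<Union>w \<in> set ts. vars_of (eval App u w)) \<subseteq> {..<n}" using IH(2) by blast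
      moreover have "(\<Union>w \<in> set ts. symbols_of (eval App u w)) \<subseteq> signature V"
        using IH(1) unfolding terms_over_def by blast
      ultimately show ?case by (simp add: terms_over_def)
    qed (use u in auto)
    have "f (map (\<lambda>g. g xs) gs) = eval ?I (\<lambda>i. xs ! i) ?t" if xs: "xs \<in> tuples ?A n" for xs
    proof -
      have "g xs \<in> ?A" if "g \<in> set gs" for g
        using that gs xs closed[OF _ _ xs] by (auto simp: tuples_def variety_clone_def)
      then have "map (\<lambda>g. g xs) gs \<in> tuples ?A m" using gs by (auto simp: tuples_def)
      then have "f (map (\<lambda>g. g xs) gs) = eval ?I (\<lambda>i. map (\<lambda>g. g xs) gs ! i) t"
        by (simp add: f_eq)
      also have "\<dots> = eval ?I (\<lambda>i. eval ?I (\<lambda>i. xs ! i) (u i)) t"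
      proof (rule eval_cong_vars)
        fix i assume "i \<in> vars_of t"
        then have "i < m" "length gs = m" using t gs by (auto simp: tuples_def)
        then show "map (\<lambda>g. g xs) gs ! i = eval ?I (\<lambda>i. xs ! i) (u i)" using u xs by simp
      qed
      finally show ?thesis by (simp add: eval_subst)
    qed
    then have "compose_ops ?A n f gs = restrict (\<lambda>xs. eval ?I (\<lambda>i. xs ! i) ?t) (tuples ?A n)"
      unfolding compose_ops_def by (rule restrict_ext)
    then show ?thesis using t' by (auto simp: variety_clone_def)
  qed
  ultimately show ?thesis by (auto simp: is_clone_def)
qed

end

theory Submission
  imports Defs "HOL-Analysis.Function_Topology"
begin

text \<open>A variety fails to be Taylor exactly if the idempotent terms of its clone can be mapped to
  projections. The difficulty of the theorem is that an idempotent term of a join \<open>V \<or> W\<close> may be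
  composed of terms of \<open>V\<close> and \<open>W\<close> none of which is idempotent, so that the two maps to
  projections say nothing about it directly. The way out is a single structure on which both
  varieties act: then the join acts on it as well, and it remains to see that no Taylor variety does.

  The structure (\<open>bundle_space\<close> with \<open>bundle_rel\<close>) is a disjoint union of ternary relational
  structures, the fibres. They are indexed by a set of base points, and every ternary structure with
  domain contained in the set of names occurs as a fibre over equally many base points, as many as
  there are sets of names. An action has to respect the partition into fibres and the ternary
  relation. It does not have to fix the base points, so that the basic operations, which need not be
  idempotent, can move the fibres around.

  No Taylor variety acts (\<open>acts_on_bundle_not_taylor\<close>). An idempotent operation maps each fibre to
  itself. One of the fibres is the two-element set with the relation ``exactly one of three'', whose
  only polymorphisms are the projections: the sets whose indicator tuple is mapped to the
  distinguished element form an ultrafilter on the finite set of argument positions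
  (\<open>one_of_three_family\<close>). Reading off these positions satisfies every idempotent condition that
  the variety admits.

  Every other variety acts (\<open>acts_on_bundle_exists\<close>). By compactness, a variety \<open>V\<close> that is not
  Taylor has a selector, that is, a coherent choice of one variable in each idempotent term
  (\<open>non_taylor_selector\<close>). Take as generators the points of the bundle and let each of them lie
  over its base point. The free algebra over the points maps onto the free algebra over the base
  points. The elements over a base point \<open>y\<close> are values of terms that become equal to \<open>y\<close>; such
  terms are idempotent, and the selector picks one of the points that occur in them, necessarily in
  the fibre of \<open>y\<close>. The congruence \<open>sim\<close> identifies an element over \<open>y\<close> with the picked point.
  Because selectors are compatible with substitution, it identifies no two distinct points
  (\<open>sim_over_generator\<close>), so the quotient has the prescribed fibre over \<open>y\<close>. Each of the
  other fibres depends on finitely many base points only and has therefore at most as many elements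
  as there are names (\<open>sim_finite_support\<close>). Hence each of them is isomorphic to one of the
  ternary structures at hand, and counting shows that the quotient is isomorphic to the universal bundle
  (\<open>bundle_presentation\<close>).

  For the meet of two varieties, whose terms are pairs of terms, a selector is decided by its value
  on the pair of the two binary projections: according to that value it depends only on the first or only
  on the second components, and so yields a selector of one of the two varieties
  (\<open>selector_meet\<close>).\<close>

section \<open>Interpretations as translations of terms\<close>

text \<open>The algebra that an interpretation \<open>L\<close> induces on an algebra with operations \<open>I\<close>. With
  \<open>I = App\<close> its operations act on terms, and evaluating there is the translation of terms along
  \<open>L\<close>.\<close>

definition derived :: "('g \<Rightarrow> 'a list \<Rightarrow> 'a) \<Rightarrow> ('f \<Rightarrow> nat \<Rightarrow> 'g trm) \<Rightarrow> 'f \<Rightarrow> 'a list \<Rightarrow> 'a" where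
  "derived I L f xs = eval I ((!) xs) (L f (length xs))"

abbreviation translate :: "('f \<Rightarrow> nat \<Rightarrow> 'g trm) \<Rightarrow> 'f trm \<Rightarrow> 'g trm" where
  "translate L \<equiv> eval (derived App L) Var"

definition is_interpretation :: "'f variety \<Rightarrow> 'g variety \<Rightarrow> ('f \<Rightarrow> nat \<Rightarrow> 'g trm) \<Rightarrow> bool" where
  "is_interpretation V W L \<longleftrightarrow>
     (\<forall>(f, n) \<in> signature V. L f n \<in> terms_over (signature W) \<and> vars_of (L f n) \<subseteq> {..<n}) \<and>
     (\<forall>(s, t) \<in> identities V. (translate L s, translate L t) \<in> free_cong W)"

lemma is_interpretationI:
  assumes "\<And>f n. (f, n) \<in> signature V \<Longrightarrow> L f n \<in> terms_over (signature W)"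
    and "\<And>f n. (f, n) \<in> signature V \<Longrightarrow> vars_of (L f n) \<subseteq> {..<n}"
    and "\<And>s t. (s, t) \<in> identities V \<Longrightarrow> (translate L s, translate L t) \<in> free_cong W"
  shows "is_interpretation V W L"
  using assms by (simp add: is_interpretation_def Ball_def split_paired_All)

lemma terms_over_App [simp]:
  "App f ts \<in> terms_over S \<longleftrightarrow> (f, length ts) \<in> S \<and> (\<forall>t \<in> set ts. t \<in> terms_over S)"
  by (auto simp: terms_over_def)

lemma terms_over_Var [simp]: "Var x \<in> terms_over S"
  by (simp add: terms_over_def)

lemma eval_Var [simp]: "eval App Var t = t"
  by (induction t) (auto intro: map_idI)

lemma vars_of_subst: "vars_of (eval App \<sigma> t) = (\<Union>x \<in> vars_of t. vars_of (\<sigma> x))"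
  by (induction t) auto

lemma finite_vars_of [simp]: "finite (vars_of t)"
  by (induction t) auto

lemma free_cong_subst:
  assumes V: "V \<in> varieties" and st: "(s, t) \<in> free_cong V"
    and \<sigma>: "\<And>x. \<sigma> x \<in> terms_over (signature V)"
  shows "(eval App \<sigma> s, eval App \<sigma> t) \<in> free_cong V"
  using st
proof (induction rule: free_cong.induct)
  case (refl t)
  then show ?case using subst_closed[of t _ \<sigma>] \<sigma> by (auto intro: free_cong.refl)
next
  case (cong f ss ts)
  then have "list_all2 (\<lambda>s t. (s, t) \<in> free_cong V) (map (eval App \<sigma>) ss) (map (eval App \<sigma>) ts)"
    by (auto simp: list_all2_conv_all_nth)
  then show ?case using cong(1) by (auto intro: free_cong.cong)
next
  case (inst s t \<tau>)
  have "(\<lambda>x. eval App \<sigma> (\<tau> x)) \<in> UNIV \<rightarrow> terms_over (signature V)"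
    using inst(2) \<sigma> by (auto intro!: subst_closed)
  then show ?case using inst(1) by (simp add: eval_subst free_cong.inst)
qed (auto intro: free_cong.sym free_cong.trans)

lemma free_cong_subst_args:
  assumes "t \<in> terms_over (signature V)" "\<And>x. x \<in> vars_of t \<Longrightarrow> (\<sigma> x, \<tau> x) \<in> free_cong V"
  shows "(eval App \<sigma> t, eval App \<tau> t) \<in> free_cong V"
  using assms
proof (induction t)
  case (App f ts)
  have "list_all2 (\<lambda>s t. (s, t) \<in> free_cong V) (map (eval App \<sigma>) ts) (map (eval App \<tau>) ts)"
    unfolding list.rel_map by (rule list.rel_refl_strong) (use App in auto)
  then show ?case using App.prems by (auto intro: free_cong.cong)
qed auto

lemma free_cong_identity:
  assumes "(s, t) \<in> identities V"
  shows "(s, t) \<in> free_cong V"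
  using free_cong.inst[OF assms, of Var] by auto

lemma eval_arity_cong:
  assumes "t \<in> terms_over S" "\<And>f xs. (f, length xs) \<in> S \<Longrightarrow> I f xs = J f xs"
  shows "eval I \<rho> t = eval J \<rho> t"
  using assms(1)
proof (induction t)
  case (App f ts)
  then have "map (eval I \<rho>) ts = map (eval J \<rho>) ts" by auto
  then show ?case using App.prems assms(2) by (simp del: map_eq_conv)
qed auto

lemma eval_derived_App:
  "eval (derived I L) \<rho> (App f ts) = eval I ((!) (map (eval (derived I L) \<rho>) ts)) (L f (length ts))"
  by (simp only: eval.simps) (subst derived_def, simp)

lemma eval_derived:
  assumes "t \<in> terms_over S" "\<And>f n. (f, n) \<in> S \<Longrightarrow> vars_of (L f n) \<subseteq> {..<n}"
  shows "eval I \<rho> (translate L t) = eval (derived I L) \<rho> t"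
  using assms(1)
proof (induction t)
  case (App f ts)
  have "eval I \<rho> (translate L (App f ts)) =
      eval I (\<lambda>i. eval I \<rho> (map (translate L) ts ! i)) (L f (length ts))"
    by (simp only: eval_derived_App eval_subst)
  also have "\<dots> = eval I ((!) (map (eval (derived I L) \<rho>) ts)) (L f (length ts))"
  proof (rule eval_cong_vars)
    fix i assume "i \<in> vars_of (L f (length ts))"
    then have "i < length ts" using assms(2)[of f "length ts"] App.prems by auto
    then show "eval I \<rho> (map (translate L) ts ! i) = map (eval (derived I L) \<rho>) ts ! i"
      using App by auto
  qed
  finally show ?case by (simp only: eval_derived_App)
qed auto

lemma translate_subst:
  assumes "t \<in> terms_over S" "\<And>f n. (f, n) \<in> S \<Longrightarrow> vars_of (L f n) \<subseteq> {..<n}"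
  shows "translate L (eval App \<tau> t) = eval App (\<lambda>x. translate L (\<tau> x)) (translate L t)"
  by (simp add: eval_subst eval_derived[OF assms])

lemma translate_closed:
  assumes "t \<in> terms_over S"
    and "\<And>f n. (f, n) \<in> S \<Longrightarrow> L f n \<in> terms_over T \<and> vars_of (L f n) \<subseteq> {..<n}"
  shows "translate L t \<in> terms_over T \<and> vars_of (translate L t) \<subseteq> vars_of t"
  using assms(1)
proof (induction t)
  case (App f ts)
  let ?n = "length ts" and ?u = "map (translate L) ts"
  have L: "L f ?n \<in> terms_over T" "vars_of (L f ?n) \<subseteq> {..<?n}"
    using assms(2)[of f ?n] App.prems by auto
  have eq: "eval App ((!) ?u) (L f ?n) =
      eval App (\<lambda>i. if i < ?n then ?u ! i else Var 0) (L f ?n)"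
    by (rule eval_cong_vars) (use L in auto)
  have u: "?u ! i \<in> terms_over T" if "i < ?n" for i
    using App that by auto
  then have "eval App ((!) ?u) (L f ?n) \<in> terms_over T"
    unfolding eq by (intro subst_closed L) auto
  moreover have "vars_of (eval App ((!) ?u) (L f ?n)) \<subseteq> vars_of (App f ts)"
  proof -
    have "vars_of (?u ! i) \<subseteq> vars_of (App f ts)" if "i < ?n" for i
    proof -
      have "vars_of (?u ! i) \<subseteq> vars_of (ts ! i)" using App that by auto
      also have "\<dots> \<subseteq> vars_of (App f ts)" using that by (auto intro: nth_mem)
      finally show ?thesis .
    qed
    then show ?thesis using L(2) by (fastforce simp: vars_of_subst)
  qed
  ultimately show ?case by (simp only: eval_derived_App)
qed auto

lemma is_interpretationD:
  assumes "is_interpretation V W L" "(f, n) \<in> signature V"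
  shows "L f n \<in> terms_over (signature W)" "vars_of (L f n) \<subseteq> {..<n}"
  using assms by (auto simp: is_interpretation_def)

lemma derived_in_variety:
  assumes V: "V \<in> varieties" and L: "is_interpretation V W L" and A: "in_variety W A I" "A \<noteq> {}"
  shows "in_variety V A (derived I L)"
proof -
  obtain a where a: "a \<in> A" using A by auto
  have "derived I L f xs \<in> A" if f: "(f, n) \<in> signature V" and xs: "xs \<in> tuples A n" for f n xs
  proof -
    note Lf = is_interpretationD[OF L f]
    have n: "length xs = n" using xs by (simp add: tuples_def)
    have "derived I L f xs = eval I (\<lambda>i. if i < n then xs ! i else a) (L f n)"
      unfolding derived_def n by (rule eval_cong_vars) (use Lf in auto)
    also have "\<dots> \<in> A"
      by (rule eval_closed[OF A(1) Lf(1)]) (use xs a in \<open>auto simp: tuples_def\<close>)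
    finally show ?thesis .
  qed
  moreover have "eval (derived I L) \<rho> s = eval (derived I L) \<rho> t"
    if st: "(s, t) \<in> identities V" and \<rho>: "\<rho> \<in> UNIV \<rightarrow> A" for s t \<rho>
  proof -
    have "s \<in> terms_over (signature V)" "t \<in> terms_over (signature V)"
      using V st by (auto simp: varieties_def)
    then have "eval (derived I L) \<rho> s = eval I \<rho> (translate L s)"
      "eval (derived I L) \<rho> t = eval I \<rho> (translate L t)"
      using eval_derived[of _ "signature V" L I \<rho>] is_interpretationD(2)[OF L] by metis+
    moreover have "(translate L s, translate L t) \<in> free_cong W"
      using L st by (auto simp: is_interpretation_def)
    ultimately show ?thesis using free_cong_sound[OF A(1) _ \<rho>] by metis
  qed
  ultimately show ?thesis by (auto simp: in_variety_def)
qed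

definition generators :: "'f variety \<Rightarrow> nat \<Rightarrow> 'f trm set" where
  "generators V x = free_cong V `` {Var x}"

lemma generators_in [simp]: "generators V x \<in> free_carrier V"
  by (auto simp: generators_def free_carrier_def intro!: quotientI)

lemma free_cong_generators:
  assumes V: "V \<in> varieties" and "s \<in> terms_over (signature V)" "t \<in> terms_over (signature V)"
    and "eval (free_interp V) (generators V) s = eval (free_interp V) (generators V) t"
  shows "(s, t) \<in> free_cong V"
proof -
  have "eval (free_interp V) (generators V) u = free_cong V `` {u}"
    if "u \<in> terms_over (signature V)" for u
    using eval_free[OF V that, of Var] unfolding generators_def by simp
  then show ?thesis using assms eq_equiv_class[OF _ equiv_free_cong[OF V]] by metis
qed

lemma free_carrier_nonempty: "free_carrier V \<noteq> {}"
  using generators_in by blast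

text \<open>The free algebra of \<open>W\<close>, with the derived operations, belongs to \<open>V\<close>, and an identity
  that holds for its generators is one of \<open>W\<close>.\<close>

lemma free_cong_translate:
  assumes V: "V \<in> varieties" and W: "W \<in> varieties" and L: "is_interpretation V W L"
    and st: "(s, t) \<in> free_cong V"
  shows "(translate L s, translate L t) \<in> free_cong W"
proof -
  have in_V: "in_variety V (free_carrier W) (derived (free_interp W) L)"
    by (rule derived_in_variety[OF V L free_algebra_in_variety[OF W] free_carrier_nonempty])
  have ts: "s \<in> terms_over (signature V)" "t \<in> terms_over (signature V)"
    using free_cong_terms[OF V st] by auto
  note L' = is_interpretationD[OF L]
  have eq: "eval (free_interp W) (generators W) (translate L u) =
      eval (derived (free_interp W) L) (generators W) u" if "u \<in> terms_over (signature V)" for u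
    by (rule eval_derived[OF that L'(2)])
  have "generators W \<in> UNIV \<rightarrow> free_carrier W" by simp
  then have "eval (free_interp W) (generators W) (translate L s) =
      eval (free_interp W) (generators W) (translate L t)"
    unfolding eq[OF ts(1)] eq[OF ts(2)] by (rule free_cong_sound[OF in_V st])
  then show ?thesis
    by (rule free_cong_generators[OF W, rotated 2])
      (use translate_closed[OF ts(1), of L "signature W"]
        translate_closed[OF ts(2), of L "signature W"] L' in blast)+
qed

definition term_op :: "'f variety \<Rightarrow> nat \<Rightarrow> 'f trm \<Rightarrow> 'f trm set list \<Rightarrow> 'f trm set" where
  "term_op V n t = restrict (\<lambda>xs. eval (free_interp V) ((!) xs) t) (tuples (free_carrier V) n)"

definition nary_terms :: "'f variety \<Rightarrow> nat \<Rightarrow> 'f trm set" where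
  "nary_terms V n = {t \<in> terms_over (signature V). vars_of t \<subseteq> {..<n}}"

lemma variety_clone_eq: "variety_clone V n = term_op V n ` nary_terms V n"
  by (auto simp: variety_clone_def term_op_def nary_terms_def)

lemma term_op_Var: "projection (free_carrier V) n i = term_op V n (Var i)"
  by (simp add: projection_def term_op_def)

lemma Var_nary_terms: "i < n \<Longrightarrow> Var i \<in> nary_terms V n"
  by (simp add: nary_terms_def)

lemma eval_tuple_closed:
  assumes V: "V \<in> varieties" and t: "t \<in> nary_terms V n" and xs: "xs \<in> tuples (free_carrier V) n"
  shows "eval (free_interp V) ((!) xs) t \<in> free_carrier V"
proof -
  have "term_op V n t \<in> operations (free_carrier V) n"
    using is_clone_variety_clone[OF V] t unfolding is_clone_def variety_clone_eq by blast
  then show ?thesis using xs by (auto simp: operations_def term_op_def dest!: PiE_mem)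
qed

text \<open>Two term operations that agree on the generators agree everywhere; this is where the clone of
  the free algebra is as good as the equational theory.\<close>

lemma term_op_eq_iff:
  assumes V: "V \<in> varieties" and s: "s \<in> nary_terms V n" and t: "t \<in> nary_terms V n"
  shows "term_op V n s = term_op V n t \<longleftrightarrow> (s, t) \<in> free_cong V"
proof
  let ?xs = "map (generators V) [0..<n]"
  assume "term_op V n s = term_op V n t"
  then have "term_op V n s ?xs = term_op V n t ?xs" by simp
  moreover have "?xs \<in> tuples (free_carrier V) n" by (auto simp: tuples_def)
  ultimately have "eval (free_interp V) ((!) ?xs) s = eval (free_interp V) ((!) ?xs) t"
    by (simp add: term_op_def)
  moreover have "eval (free_interp V) ((!) ?xs) u = eval (free_interp V) (generators V) u"
    if "u \<in> nary_terms V n" for u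
    by (rule eval_cong_vars) (use that in \<open>auto simp: nary_terms_def\<close>)
  ultimately show "(s, t) \<in> free_cong V"
    using free_cong_generators[OF V] s t by (auto simp: nary_terms_def)
next
  assume st: "(s, t) \<in> free_cong V"
  have "eval (free_interp V) ((!) xs) s = eval (free_interp V) ((!) xs) t"
    if xs: "xs \<in> tuples (free_carrier V) n" for xs
  proof -
    let ?\<rho> = "\<lambda>i. if i < n then xs ! i else generators V 0"
    have eq: "eval (free_interp V) ((!) xs) u = eval (free_interp V) ?\<rho> u"
      if "u \<in> nary_terms V n" for u
      by (rule eval_cong_vars) (use that in \<open>auto simp: nary_terms_def\<close>)
    have "?\<rho> \<in> UNIV \<rightarrow> free_carrier V" using xs by (auto simp: tuples_def)
    then show ?thesis
      unfolding eq[OF s] eq[OF t] by (rule free_cong_sound[OF free_algebra_in_variety[OF V] st])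
  qed
  then show "term_op V n s = term_op V n t" unfolding term_op_def by (rule restrict_ext)
qed

lemma compose_term_ops:
  assumes V: "V \<in> varieties" and t: "t \<in> nary_terms V m" and us: "us \<in> tuples (nary_terms V n) m"
  shows "compose_ops (free_carrier V) n (term_op V m t) (map (term_op V n) us) =
      term_op V n (eval App ((!) us) t)"
proof -
  have "term_op V m t (map (\<lambda>g. g xs) (map (term_op V n) us)) =
      eval (free_interp V) ((!) xs) (eval App ((!) us) t)"
    if xs: "xs \<in> tuples (free_carrier V) n" for xs
  proof -
    let ?ys = "map (\<lambda>u. eval (free_interp V) ((!) xs) u) us"
    have eq: "map (\<lambda>g. g xs) (map (term_op V n) us) = ?ys"
      using xs by (simp add: term_op_def)
    have "?ys \<in> tuples (free_carrier V) m"
      using eval_tuple_closed[OF V _ xs] us by (auto simp: tuples_def)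
    then have "term_op V m t ?ys = eval (free_interp V) ((!) ?ys) t" by (simp add: term_op_def)
    also have "\<dots> = eval (free_interp V) (\<lambda>i. eval (free_interp V) ((!) xs) (us ! i)) t"
      by (rule eval_cong_vars) (use t us in \<open>auto simp: nary_terms_def tuples_def\<close>)
    finally show ?thesis unfolding eq by (simp add: eval_subst)
  qed
  then show ?thesis unfolding compose_ops_def term_op_def[of V n "eval _ _ _"]
    by (rule restrict_ext)
qed

lemma subst_nary_terms:
  assumes t: "t \<in> nary_terms V m" and us: "us \<in> tuples (nary_terms V n) m"
  shows "eval App ((!) us) t \<in> nary_terms V n"
proof -
  have "eval App ((!) us) t = eval App (\<lambda>i. if i < m then us ! i else Var 0) t"
    by (rule eval_cong_vars) (use t in \<open>auto simp: nary_terms_def\<close>)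
  also have "\<dots> \<in> terms_over (signature V)"
    by (rule subst_closed) (use t us in \<open>auto simp: nary_terms_def tuples_def dest: nth_mem\<close>)
  finally show ?thesis
    using t us by (fastforce simp: nary_terms_def tuples_def vars_of_subst dest: nth_mem)
qed

text \<open>A symbol can be translated to any term representing the image of its basic operation;
  compatibility with composition then determines the images of all term operations.\<close>

lemma clone_hom_interpretation:
  assumes V: "V \<in> varieties" and W: "W \<in> varieties"
    and h: "clone_hom (free_carrier V) (variety_clone V) (free_carrier W) (variety_clone W) h"
  shows "\<exists>L. is_interpretation V W L"
proof -
  let ?basic = "\<lambda>f n. App f (map Var [0..<n])"
  have basic: "?basic f n \<in> nary_terms V n" if "(f, n) \<in> signature V" for f n
    using that by (auto simp: nary_terms_def)
  have "\<exists>u. (f, n) \<in> signature V \<longrightarrow> u \<in> nary_terms W n \<and> h n (term_op V n (?basic f n)) = term_op W n u"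
    for f n
  proof (cases "(f, n) \<in> signature V")
    case True
    then have "term_op V n (?basic f n) \<in> variety_clone V n"
      using basic unfolding variety_clone_eq by blast
    then have "h n (term_op V n (?basic f n)) \<in> variety_clone W n"
      using h unfolding clone_hom_def by blast
    then show ?thesis unfolding variety_clone_eq by blast
  qed blast
  then obtain L where L: "\<And>f n. (f, n) \<in> signature V \<Longrightarrow> L f n \<in> nary_terms W n"
    "\<And>f n. (f, n) \<in> signature V \<Longrightarrow> h n (term_op V n (?basic f n)) = term_op W n (L f n)"
    by metis
  have L': "\<And>f n. (f, n) \<in> signature V \<Longrightarrow>
      L f n \<in> terms_over (signature W) \<and> vars_of (L f n) \<subseteq> {..<n}"
    using L by (auto simp: nary_terms_def)
  have tr: "translate L t \<in> nary_terms W m" if "t \<in> nary_terms V m" for t m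
    using translate_closed[of t "signature V" L "signature W", OF _ L'] that
    by (auto simp: nary_terms_def)
  have main: "h m (term_op V m t) = term_op W m (translate L t)" if "t \<in> nary_terms V m" for t m
    using that
  proof (induction t)
    case (Var i)
    then have "i < m" by (simp add: nary_terms_def)
    then show ?case using h by (simp add: clone_hom_def term_op_Var[symmetric])
  next
    case (App f ts)
    let ?n = "length ts"
    have f: "(f, ?n) \<in> signature V" using App.prems by (simp add: nary_terms_def)
    have ts: "t \<in> nary_terms V m" if "t \<in> set ts" for t
      using App.prems that by (auto simp: nary_terms_def)
    then have ts': "ts \<in> tuples (nary_terms V m) ?n" by (auto simp: tuples_def)
    have "eval App ((!) ts) (?basic f ?n) = App f ts"
      by (auto intro: nth_equalityI)
    then have op: "term_op V m (App f ts) =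
        compose_ops (free_carrier V) m (term_op V ?n (?basic f ?n)) (map (term_op V m) ts)"
      using compose_term_ops[OF V basic[OF f] ts'] by simp
    have op_V: "term_op V ?n (?basic f ?n) \<in> variety_clone V ?n"
      using basic[OF f] by (auto simp: variety_clone_eq)
    have ops_V: "map (term_op V m) ts \<in> tuples (variety_clone V m) ?n"
      using ts by (auto simp: variety_clone_eq tuples_def)
    have "h m (term_op V m (App f ts)) = compose_ops (free_carrier W) m
        (h ?n (term_op V ?n (?basic f ?n))) (map (h m) (map (term_op V m) ts))"
      unfolding op using h op_V ops_V unfolding clone_hom_def by blast
    also have "map (h m) (map (term_op V m) ts) = map (term_op W m) (map (translate L) ts)"
      using App.IH ts by simp
    also have "compose_ops (free_carrier W) m (h ?n (term_op V ?n (?basic f ?n))) \<dots> =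
        term_op W m (eval App ((!) (map (translate L) ts)) (L f ?n))"
      unfolding L(2)[OF f]
      by (rule compose_term_ops[OF W L(1)[OF f]]) (use tr ts in \<open>auto simp: tuples_def\<close>)
    finally show ?case by (simp only: eval_derived_App)
  qed
  have "(translate L s, translate L t) \<in> free_cong W" if st: "(s, t) \<in> identities V" for s t
  proof -
    obtain m where "\<forall>x \<in> vars_of s \<union> vars_of t. x < m"
      using finite_nat_set_iff_bounded[of "vars_of s \<union> vars_of t"] by auto
    then have m: "s \<in> nary_terms V m" "t \<in> nary_terms V m"
      using V st by (auto simp: nary_terms_def varieties_def)
    then have "term_op V m s = term_op V m t"
      using term_op_eq_iff[OF V] free_cong_identity[OF st] by blast
    then have "term_op W m (translate L s) = term_op W m (translate L t)"
      using main m by metis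
    then show ?thesis using term_op_eq_iff[OF W] tr m by blast
  qed
  then have "is_interpretation V W L" using L' by (intro is_interpretationI) blast+
  then show ?thesis by blast
qed

text \<open>Translation is well defined on term operations because provably equal terms have provably
  equal translations.\<close>

lemma interpretation_clone_hom:
  assumes V: "V \<in> varieties" and W: "W \<in> varieties" and L: "is_interpretation V W L"
  shows "interprets V W"
proof -
  \<comment> \<open>A term operation may be represented by many terms; any choice will do.\<close>
  define rep where "rep n c = (SOME t. t \<in> nary_terms V n \<and> term_op V n t = c)" for n c
  define h where "h n c = term_op W n (translate L (rep n c))" for n c
  have tr: "translate L t \<in> nary_terms W m" if "t \<in> nary_terms V m" for t m
    using translate_closed[of t "signature V" L "signature W"] is_interpretationD[OF L] that
    by (auto simp: nary_terms_def)
  have h: "h n (term_op V n t) = term_op W n (translate L t)" if t: "t \<in> nary_terms V n" for n t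
  proof -
    have "rep n (term_op V n t) \<in> nary_terms V n \<and> term_op V n (rep n (term_op V n t)) = term_op V n t"
      unfolding rep_def by (rule someI[of _ t]) (use t in auto)
    then have "(rep n (term_op V n t), t) \<in> free_cong V" and r: "rep n (term_op V n t) \<in> nary_terms V n"
      using term_op_eq_iff[OF V _ t] by auto
    then have "(translate L (rep n (term_op V n t)), translate L t) \<in> free_cong W"
      by (intro free_cong_translate[OF V W L])
    then show ?thesis unfolding h_def using term_op_eq_iff[OF W tr[OF r] tr[OF t]] by blast
  qed
  have "h n (compose_ops (free_carrier V) n f gs) = compose_ops (free_carrier W) n (h m f) (map (h n) gs)"
    if f: "f \<in> variety_clone V m" and gs: "gs \<in> tuples (variety_clone V n) m" for f gs m n
  proof -
    obtain t where t: "t \<in> nary_terms V m" "f = term_op V m t"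
      using f by (auto simp: variety_clone_eq)
    have "\<exists>us. gs = map (term_op V n) us \<and> us \<in> lists (nary_terms V n)"
      using gs unfolding tuples_def variety_clone_eq lists_image by auto
    then obtain us where gs_eq: "gs = map (term_op V n) us" and "us \<in> lists (nary_terms V n)"
      by blast
    then have us: "us \<in> tuples (nary_terms V n) m" using gs by (auto simp: tuples_def)
    have us': "map (translate L) us \<in> tuples (nary_terms W n) m"
      using us tr by (auto simp: tuples_def)
    have hgs: "map (h n) gs = map (term_op W n) (map (translate L) us)"
      unfolding gs_eq using us by (auto simp: h tuples_def)
    have "translate L (eval App ((!) us) t) = eval App (\<lambda>i. translate L (us ! i)) (translate L t)"
      using translate_subst[of t "signature V" L] t is_interpretationD[OF L]
      by (auto simp: nary_terms_def)
    also have "\<dots> = eval App ((!) (map (translate L) us)) (translate L t)"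
      by (rule eval_cong_vars) (use tr[OF t(1)] us in \<open>auto simp: nary_terms_def tuples_def\<close>)
    finally show ?thesis
      unfolding hgs unfolding t(2) gs_eq compose_term_ops[OF V t(1) us] h[OF t(1)] h[OF subst_nary_terms[OF t(1) us]]
      using compose_term_ops[OF W tr[OF t(1)] us'] by simp
  qed
  moreover have "h n f \<in> variety_clone W n" if "f \<in> variety_clone V n" for n f
    using that h tr by (auto simp: variety_clone_eq)
  moreover have "h n (projection (free_carrier V) n i) = projection (free_carrier W) n i" if "i < n" for n i
    using h[OF Var_nary_terms[OF that]] by (simp add: term_op_Var)
  ultimately show ?thesis unfolding interprets_def clone_hom_def by blast
qed

lemma interprets_iff:
  assumes "V \<in> varieties" "W \<in> varieties"
  shows "interprets V W \<longleftrightarrow> (\<exists>L. is_interpretation V W L)"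
  using clone_hom_interpretation[OF assms] interpretation_clone_hom[OF assms]
  unfolding interprets_def by blast

lemma interprets_refl: "interprets V V"
  unfolding interprets_def clone_hom_def by (rule exI[of _ "\<lambda>n c. c"]) auto

lemma interprets_trans:
  assumes "interprets U V" "interprets V W"
  shows "interprets U W"
proof -
  obtain h k where h: "clone_hom (free_carrier U) (variety_clone U) (free_carrier V) (variety_clone V) h"
    and k: "clone_hom (free_carrier V) (variety_clone V) (free_carrier W) (variety_clone W) k"
    using assms unfolding interprets_def by blast
  have hgs: "map (h n) gs \<in> tuples (variety_clone V n) m" if "gs \<in> tuples (variety_clone U n) m" for gs m n
    using that h by (auto simp: tuples_def clone_hom_def)
  have "k n (h n (compose_ops (free_carrier U) n f gs)) =
      compose_ops (free_carrier W) n (k m (h m f)) (map (\<lambda>c. k n (h n c)) gs)"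
    if "f \<in> variety_clone U m" "gs \<in> tuples (variety_clone U n) m" for f gs m n
  proof -
    have "h n (compose_ops (free_carrier U) n f gs) =
        compose_ops (free_carrier V) n (h m f) (map (h n) gs)" "h m f \<in> variety_clone V m"
      using h that unfolding clone_hom_def by blast+
    moreover have "k n (compose_ops (free_carrier V) n (h m f) (map (h n) gs)) =
        compose_ops (free_carrier W) n (k m (h m f)) (map (k n) (map (h n) gs))"
      using k hgs[OF that(2)] calculation(2) unfolding clone_hom_def by blast
    ultimately show ?thesis by (simp add: comp_def)
  qed
  then have "clone_hom (free_carrier U) (variety_clone U) (free_carrier W) (variety_clone W) (\<lambda>n c. k n (h n c))"
    using h k unfolding clone_hom_def by simp
  then show ?thesis unfolding interprets_def by blast
qed

section \<open>Triviality and idempotence of Maltsev conditions\<close>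

text \<open>The variable that remains of a term when every symbol \<open>(f, n)\<close> acts as the projection to
  the argument number \<open>\<pi> f n\<close>.\<close>

definition chosen :: "('f \<Rightarrow> nat \<Rightarrow> nat) \<Rightarrow> 'f trm \<Rightarrow> nat" where
  "chosen \<pi> = eval (\<lambda>f xs. xs ! \<pi> f (length xs)) id"

lemma chosen_Var [simp]: "chosen \<pi> (Var x) = x"
  by (simp add: chosen_def)

lemma chosen_App [simp]: "chosen \<pi> (App f ts) = map (chosen \<pi>) ts ! \<pi> f (length ts)"
  by (simp add: chosen_def)

lemma translate_to_variables:
  assumes "t \<in> terms_over S" "\<And>f n. (f, n) \<in> S \<Longrightarrow> \<pi> f n < n \<and> L f n = Var (\<pi> f n)"
  shows "translate L t = Var (chosen \<pi> t)"
  using assms(1)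
proof (induction t)
  case (App f ts)
  have f: "\<pi> f (length ts) < length ts" "L f (length ts) = Var (\<pi> f (length ts))"
    using App.prems assms(2)[of f "length ts"] by auto
  have "translate L (App f ts) = map (translate L) ts ! \<pi> f (length ts)"
    by (subst eval_derived_App) (simp add: f(2))
  then show ?case using f App by simp
qed simp

lemma variety_of_varieties: "variety_of M \<in> varieties"
  by (force simp: variety_of_def varieties_def terms_over_def)

lemma SET_varieties: "SET \<in> varieties"
  by (simp add: SET_def varieties_def)

lemma free_cong_SET: "(Var a, Var b) \<in> free_cong SET \<longleftrightarrow> a = b"
proof
  assume *: "(Var a, Var b) \<in> free_cong SET"
  have "in_variety SET (UNIV :: nat set) I" for I by (simp add: in_variety_def SET_def)
  from free_cong_sound[OF this *, of id] show "a = b" by auto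
qed (auto intro: free_cong.refl)

lemma terms_over_empty: "t \<in> terms_over {} \<Longrightarrow> \<exists>x. t = Var x"
  by (cases t) (auto simp: terms_over_def)

text \<open>The only terms without symbols are the variables, so an interpretation in \<open>SET\<close> is an
  assignment of projections to symbols.\<close>

lemma trivial_condition_iff:
  "trivial_condition M \<longleftrightarrow>
     (\<exists>\<pi>. (\<forall>f n. (f, n) \<in> signature (variety_of M) \<longrightarrow> \<pi> f n < n) \<and>
          (\<forall>s t. (s, t) \<in> M \<longrightarrow> chosen \<pi> s = chosen \<pi> t))"
proof -
  have terms: "s \<in> terms_over (signature (variety_of M)) \<and> t \<in> terms_over (signature (variety_of M))"
    if "(s, t) \<in> M" for s t
    using that variety_of_varieties[of M] by (auto simp: varieties_def variety_of_def)
  have ids: "identities (variety_of M) = M" by (simp add: variety_of_def)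
  have "trivial_condition M \<longleftrightarrow> (\<exists>L. is_interpretation (variety_of M) SET L)"
    unfolding trivial_condition_def admits_def
    by (rule interprets_iff[OF variety_of_varieties SET_varieties])
  also have "\<dots> \<longleftrightarrow> (\<exists>\<pi>. (\<forall>f n. (f, n) \<in> signature (variety_of M) \<longrightarrow> \<pi> f n < n) \<and>
          (\<forall>s t. (s, t) \<in> M \<longrightarrow> chosen \<pi> s = chosen \<pi> t))" (is "_ \<longleftrightarrow> ?R")
  proof
    assume "\<exists>L. is_interpretation (variety_of M) SET L"
    then obtain L where L: "is_interpretation (variety_of M) SET L" by blast
    define \<pi> where "\<pi> f n = (SOME i. L f n = Var i)" for f n
    have \<pi>: "\<pi> f n < n \<and> L f n = Var (\<pi> f n)" if f: "(f, n) \<in> signature (variety_of M)" for f n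
    proof -
      have "\<exists>i. L f n = Var i"
        using is_interpretationD(1)[OF L f] by (auto simp: SET_def dest: terms_over_empty)
      then have "L f n = Var (\<pi> f n)" unfolding \<pi>_def by (rule someI_ex)
      then show ?thesis using is_interpretationD(2)[OF L f] by auto
    qed
    have "chosen \<pi> s = chosen \<pi> t" if st: "(s, t) \<in> M" for s t
    proof -
      have "(translate L s, translate L t) \<in> free_cong SET"
        using L st unfolding is_interpretation_def ids by blast
      then show ?thesis
        using translate_to_variables[of _ "signature (variety_of M)" \<pi> L] \<pi> terms[OF st]
        by (simp add: free_cong_SET)
    qed
    then show ?R using \<pi> by blast
  next
    assume ?R
    then obtain \<pi> where \<pi>: "\<And>f n. (f, n) \<in> signature (variety_of M) \<Longrightarrow> \<pi> f n < n"
      "\<And>s t. (s, t) \<in> M \<Longrightarrow> chosen \<pi> s = chosen \<pi> t" by blast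
    let ?L = "\<lambda>f n. Var (\<pi> f n) :: nat trm"
    have "is_interpretation (variety_of M) SET ?L"
    proof (rule is_interpretationI)
      fix s t assume "(s, t) \<in> identities (variety_of M)"
      then have st: "(s, t) \<in> M" by (simp add: ids)
      have "translate ?L u = Var (chosen \<pi> u)" if "u \<in> terms_over (signature (variety_of M))" for u
        by (rule translate_to_variables[OF that]) (use \<pi>(1) in blast)
      then have "translate ?L s = Var (chosen \<pi> s)" "translate ?L t = Var (chosen \<pi> t)"
        using terms[OF st] by blast+
      then show "(translate ?L s, translate ?L t) \<in> free_cong SET"
        using \<pi>(2)[OF st] by (simp only: free_cong_SET)
    qed (use \<pi> in auto)
    then show "\<exists>L. is_interpretation (variety_of M) SET L" by blast
  qed
  finally show ?thesis .
qed

definition idempotent_terms :: "'f variety \<Rightarrow> 'f trm set" where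
  "idempotent_terms V =
     {t \<in> terms_over (signature V). (eval App (\<lambda>_. Var 0) t, Var 0) \<in> free_cong V}"

lemma idempotent_termsD:
  assumes "t \<in> idempotent_terms V"
  shows "t \<in> terms_over (signature V)" "(eval App (\<lambda>_. Var 0) t, Var 0) \<in> free_cong V"
  using assms by (auto simp: idempotent_terms_def)

lemma Var_idempotent [simp]: "Var x \<in> idempotent_terms V"
  by (auto simp: idempotent_terms_def intro: free_cong.refl)

lemma subst_idempotent:
  assumes t: "t \<in> idempotent_terms V" and \<sigma>: "\<And>x. \<sigma> x \<in> idempotent_terms V"
  shows "eval App \<sigma> t \<in> idempotent_terms V"
proof -
  have "eval App \<sigma> t \<in> terms_over (signature V)"
    using subst_closed[of t _ \<sigma>] idempotent_termsD(1)[OF t] idempotent_termsD(1)[OF \<sigma>] by auto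
  moreover have "(eval App (\<lambda>_. Var 0) (eval App \<sigma> t), eval App (\<lambda>_. Var 0) t) \<in> free_cong V"
    unfolding eval_subst
    by (intro free_cong_subst_args idempotent_termsD(1)[OF t] idempotent_termsD(2)[OF \<sigma>])
  ultimately show ?thesis
    using idempotent_termsD(2)[OF t] by (auto simp: idempotent_terms_def intro: free_cong.trans)
qed

lemma terms_idempotent:
  assumes "\<And>f n. (f, n) \<in> signature V \<Longrightarrow> (App f (replicate n (Var 0)), Var 0) \<in> free_cong V"
    and "t \<in> terms_over (signature V)"
  shows "t \<in> idempotent_terms V"
  using assms(2)
proof (induction t)
  case (App f ts)
  have "list_all2 (\<lambda>s t. (s, t) \<in> free_cong V) (map (eval App (\<lambda>_. Var 0)) ts) (replicate (length ts) (Var 0))"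
    using App by (auto simp: list_all2_conv_all_nth idempotent_terms_def)
  then have "(eval App (\<lambda>_. Var 0) (App f ts), App f (replicate (length ts) (Var 0))) \<in> free_cong V"
    using App.prems by (auto intro: free_cong.cong)
  then show ?case
    using App.prems assms(1) unfolding idempotent_terms_def by (auto intro: free_cong.trans)
qed simp

text \<open>Idempotence is inherited by compositions, so it can be tested on the symbols.\<close>

lemma idempotent_variety_iff:
  assumes V: "V \<in> varieties"
  shows "idempotent_variety V \<longleftrightarrow>
    (\<forall>f n. (f, n) \<in> signature V \<longrightarrow> (App f (replicate n (Var 0)), Var 0) \<in> free_cong V)"
proof (intro iffI allI impI)
  fix f n assume id: "idempotent_variety V" and f: "(f, n) \<in> signature V"
  let ?t = "App f (map Var [0..<n])" and ?a = "generators V 0"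
  have "term_op V n ?t \<in> variety_clone V n"
    using f by (auto simp: variety_clone_eq nary_terms_def)
  then have "term_op V n ?t (replicate n ?a) = ?a"
    using id by (simp add: idempotent_variety_def idempotent_op_def)
  moreover have "replicate n ?a \<in> tuples (free_carrier V) n" by (auto simp: tuples_def)
  ultimately have "eval (free_interp V) ((!) (replicate n ?a)) ?t = ?a"
    by (simp add: term_op_def)
  moreover have "map (eval (free_interp V) ((!) (replicate n ?a))) (map Var [0..<n]) = replicate n ?a"
    by (auto intro: nth_equalityI)
  ultimately have "free_interp V f (replicate n ?a) = ?a" by simp
  then show "(App f (replicate n (Var 0)), Var 0) \<in> free_cong V"
    by (intro free_cong_generators[OF V]) (use f in auto)
next
  assume symbols: "\<forall>f n. (f, n) \<in> signature V \<longrightarrow> (App f (replicate n (Var 0)), Var 0) \<in> free_cong V"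
  have "term_op V n t (replicate n a) = a" if t: "t \<in> nary_terms V n" and a: "a \<in> free_carrier V" for n t a
  proof -
    have "term_op V n t (replicate n a) = eval (free_interp V) ((!) (replicate n a)) t"
      using a by (auto simp: term_op_def tuples_def in_lists_conv_set)
    also have "\<dots> = eval (free_interp V) (\<lambda>_. a) t"
      by (rule eval_cong_vars) (use t in \<open>auto simp: nary_terms_def\<close>)
    also have "\<dots> = eval (free_interp V) (\<lambda>_. a) (eval App (\<lambda>_. Var 0) t)"
      by (simp add: eval_subst)
    also have "\<dots> = eval (free_interp V) (\<lambda>_. a) (Var 0)"
    proof (rule free_cong_sound[OF free_algebra_in_variety[OF V]])
      show "(eval App (\<lambda>_. Var 0) t, Var 0) \<in> free_cong V"
        using terms_idempotent[of V t] symbols t by (auto simp: nary_terms_def idempotent_terms_def)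
    qed (use a in auto)
    finally show ?thesis by simp
  qed
  then show "idempotent_variety V"
    by (auto simp: idempotent_variety_def idempotent_op_def variety_clone_eq)
qed

section \<open>Selectors\<close>

text \<open>A selector is a clone homomorphism from the idempotent terms of \<open>V\<close> to the projections. It
  is encoded without arities, as a choice of a variable in each term; the last clause is compatibility
  with composition.\<close>

definition selector :: "'f variety \<Rightarrow> ('f trm \<Rightarrow> nat) \<Rightarrow> bool" where
  "selector V \<phi> \<longleftrightarrow>
     (\<forall>x. \<phi> (Var x) = x) \<and>
     (\<forall>s \<in> idempotent_terms V. \<forall>t \<in> idempotent_terms V. (s, t) \<in> free_cong V \<longrightarrow> \<phi> s = \<phi> t) \<and>
     (\<forall>t \<in> idempotent_terms V. \<forall>\<sigma>. (\<forall>x. \<sigma> x \<in> idempotent_terms V) \<longrightarrow>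
        \<phi> (eval App \<sigma> t) = \<phi> (\<sigma> (\<phi> t)))"

lemma selector_Var: "selector V \<phi> \<Longrightarrow> \<phi> (Var x) = x"
  by (simp add: selector_def)

lemma selector_cong:
  "selector V \<phi> \<Longrightarrow> s \<in> idempotent_terms V \<Longrightarrow> t \<in> idempotent_terms V \<Longrightarrow> (s, t) \<in> free_cong V \<Longrightarrow> \<phi> s = \<phi> t"
  by (simp add: selector_def)

lemma selector_substD:
  "selector V \<phi> \<Longrightarrow> t \<in> idempotent_terms V \<Longrightarrow> (\<And>x. \<sigma> x \<in> idempotent_terms V) \<Longrightarrow>
    \<phi> (eval App \<sigma> t) = \<phi> (\<sigma> (\<phi> t))"
  by (simp add: selector_def)

text \<open>Otherwise all variables of \<open>t\<close> are preserved while the selected one is replaced by an arbitrary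
  variable \<open>x\<^sub>j\<close>; this does not change \<open>t\<close>, but forces \<open>\<phi> t = j\<close> for every \<open>j\<close>.\<close>

lemma selector_in_vars:
  assumes "selector V \<phi>" and t: "t \<in> idempotent_terms V"
  shows "\<phi> t \<in> vars_of t"
proof (rule ccontr)
  assume *: "\<phi> t \<notin> vars_of t"
  have "\<phi> t = j" for j
  proof -
    let ?\<sigma> = "\<lambda>i. if i \<in> vars_of t then Var i else Var j"
    have "eval App ?\<sigma> t = eval App Var t" by (rule eval_cong_vars) simp
    moreover have "\<phi> (eval App ?\<sigma> t) = \<phi> (?\<sigma> (\<phi> t))"
      by (rule selector_substD[OF assms]) simp
    ultimately show ?thesis using * assms(1) by (simp add: selector_Var)
  qed
  from this[of 0] this[of 1] show False by simp
qed

text \<open>Some arity that makes room for all variables of the term and is positive, so that a closed term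
  still has an argument position to choose.\<close>

definition arity_bound :: "'f trm \<Rightarrow> nat" where
  "arity_bound t = Suc (Max (insert 0 (vars_of t)))"

lemma vars_of_arity_bound: "vars_of t \<subseteq> {..<arity_bound t}"
  by (auto simp: arity_bound_def less_Suc_eq_le)

text \<open>A language that has each idempotent term as a basic symbol. Terms of this language use idempotent
  terms as names, and \<open>flatten\<close> expands them to terms of the variety.\<close>

definition idempotent_language :: "'f variety \<Rightarrow> ('f trm \<times> nat) set" where
  "idempotent_language V = (\<lambda>t. (t, arity_bound t)) ` idempotent_terms V"

abbreviation flatten :: "'f trm trm \<Rightarrow> 'f trm" where
  "flatten \<equiv> translate (\<lambda>t n. t)"

definition valid_idempotent_identities :: "'f variety \<Rightarrow> ('f trm trm \<times> 'f trm trm) set" where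
  "valid_idempotent_identities V =
     {(s, t). s \<in> terms_over (idempotent_language V) \<and> t \<in> terms_over (idempotent_language V) \<and>
        (flatten s, flatten t) \<in> free_cong V}"

lemma symbols_of_map_trm: "symbols_of (map_trm g t) = (\<lambda>(f, n). (g f, n)) ` symbols_of t"
  by (induction t) (auto simp: image_Union)

lemma eval_map_trm: "eval I \<rho> (map_trm g t) = eval (\<lambda>f. I (g f)) \<rho> t"
  by (induction t) (auto simp: comp_def intro!: arg_cong[of _ _ "I _"])

lemma finite_symbols_of [simp]: "finite (symbols_of t)"
  by (induction t) auto

text \<open>Finitely many identities between idempotent terms involve finitely many symbols. Renamed by
  natural numbers and joined with the idempotence of these symbols they form an idempotent strong
  Maltsev condition that \<open>V\<close> admits. If \<open>V\<close> is not Taylor, the condition is trivial, so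
  projections satisfy it.\<close>

lemma finitely_satisfiable:
  assumes V: "V \<in> varieties" and nt: "\<not> taylor_variety V"
    and F: "finite F" "F \<subseteq> valid_idempotent_identities V"
  shows "\<exists>\<phi>. (\<forall>u. \<phi> u < arity_bound u) \<and> (\<forall>(s, t) \<in> F. chosen (\<lambda>u _. \<phi> u) s = chosen (\<lambda>u _. \<phi> u) t)"
proof -
  define \<Sigma> where "\<Sigma> = (\<Union>(s, t) \<in> F. symbols_of s \<union> symbols_of t)"
  define U where "U = fst ` \<Sigma>"
  have "symbols_of s \<union> symbols_of t \<subseteq> idempotent_language V" if "(s, t) \<in> F" for s t
    using F(2) that by (auto simp: valid_idempotent_identities_def terms_over_def)
  then have \<Sigma>: "\<Sigma> \<subseteq> idempotent_language V" unfolding \<Sigma>_def by blast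
  then have \<Sigma>_eq: "\<Sigma> = (\<lambda>u. (u, arity_bound u)) ` U"
    by (force simp: U_def idempotent_language_def)
  have U_id: "u \<in> idempotent_terms V" if "u \<in> U" for u
    using that \<Sigma> by (auto simp: U_def idempotent_language_def)
  have "finite U" using F(1) by (auto simp: U_def \<Sigma>_def case_prod_unfold)
  then obtain g :: "'a trm \<Rightarrow> nat" where g: "inj_on g U"
    using finite_imp_inj_to_nat_seg by metis
  define M where "M = (\<lambda>(s, t). (map_trm g s, map_trm g t)) ` F \<union>
      (\<lambda>u. (App (g u) (replicate (arity_bound u) (Var 0)), Var 0)) ` U"
  let ?N = "variety_of M"
  have over: "s \<in> terms_over \<Sigma> \<and> t \<in> terms_over \<Sigma>" if "(s, t) \<in> F" for s t
    using that by (auto simp: \<Sigma>_def terms_over_def)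
  have sig: "signature ?N = (\<lambda>u. (g u, arity_bound u)) ` U" (is "?l = ?r")
  proof
    have "symbols_of (map_trm g s) \<subseteq> ?r" if "s \<in> terms_over \<Sigma>" for s
      using that unfolding symbols_of_map_trm \<Sigma>_eq terms_over_def by auto
    then show "?l \<subseteq> ?r" using over unfolding variety_of_def M_def by (auto; blast)
    show "?r \<subseteq> ?l" by (auto simp: variety_of_def M_def)
  qed
  define L where "L m n = inv_into U g m" for m :: nat and n :: nat
  have L: "L (g u) n = u" if "u \<in> U" for u n
    using inv_into_f_f[OF g that] by (simp add: L_def)
  have "idempotent_condition M"
    unfolding idempotent_condition_def idempotent_variety_iff[OF variety_of_varieties]
  proof (intro allI impI)
    fix f n assume "(f, n) \<in> signature ?N"
    then obtain u where "u \<in> U" "f = g u" "n = arity_bound u" unfolding sig by blast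
    then have "(App f (replicate n (Var 0)), Var 0) \<in> identities ?N"
      by (auto simp: variety_of_def M_def)
    then show "(App f (replicate n (Var 0)), Var 0) \<in> free_cong ?N" by (rule free_cong_identity)
  qed
  moreover have "is_interpretation ?N V L"
  proof (rule is_interpretationI)
    fix f n assume "(f, n) \<in> signature ?N"
    then obtain u where u: "u \<in> U" "f = g u" "n = arity_bound u" unfolding sig by blast
    then show "L f n \<in> terms_over (signature V)" "vars_of (L f n) \<subseteq> {..<n}"
      using L[OF u(1)] idempotent_termsD(1)[OF U_id[OF u(1)]] vars_of_arity_bound by auto
  next
    fix s t assume "(s, t) \<in> identities ?N"
    then consider (F) s' t' where "(s', t') \<in> F" "s = map_trm g s'" "t = map_trm g t'"
      | (id) u where "u \<in> U" "s = App (g u) (replicate (arity_bound u) (Var 0))" "t = Var 0"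
      by (auto simp: variety_of_def M_def)
    then show "(translate L s, translate L t) \<in> free_cong V"
    proof cases
      case F
      have "translate L (map_trm g w) = flatten w" if "w \<in> terms_over \<Sigma>" for w
        unfolding eval_map_trm
        by (rule eval_arity_cong[OF that]) (auto simp: derived_def L \<Sigma>_eq)
      then show ?thesis
        using F over[OF F(1)] assms(4) by (auto simp: valid_idempotent_identities_def)
    next
      case id
      have "translate L s = eval App ((!) (replicate (arity_bound u) (Var 0))) u"
        unfolding id(2) eval_derived_App by (simp add: L[OF id(1)])
      also have "\<dots> = eval App (\<lambda>_. Var 0) u"
        by (rule eval_cong_vars) (use vars_of_arity_bound[of u] in auto)
      finally show ?thesis using idempotent_termsD(2)[OF U_id[OF id(1)]] id(3) by simp
    qed
  qed
  then have "admits V M"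
    unfolding admits_def by (rule interpretation_clone_hom[OF variety_of_varieties V])
  moreover have "strong_maltsev_condition M"
    using F(1) \<open>finite U\<close> by (simp add: strong_maltsev_condition_def M_def)
  ultimately have "trivial_condition M" using nt by (auto simp: taylor_variety_def)
  then obtain \<pi> where \<pi>: "\<And>f n. (f, n) \<in> signature ?N \<Longrightarrow> \<pi> f n < n"
    "\<And>s t. (s, t) \<in> M \<Longrightarrow> chosen \<pi> s = chosen \<pi> t"
    unfolding trivial_condition_iff by blast
  define \<phi> where "\<phi> u = (if u \<in> U then \<pi> (g u) (arity_bound u) else 0)" for u
  have "chosen \<pi> (map_trm g w) = chosen (\<lambda>u _. \<phi> u) w" if "w \<in> terms_over \<Sigma>" for w
    unfolding chosen_def eval_map_trm
    by (rule eval_arity_cong[OF that]) (auto simp: \<phi>_def \<Sigma>_eq)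
  then have "chosen (\<lambda>u _. \<phi> u) s = chosen (\<lambda>u _. \<phi> u) t" if "(s, t) \<in> F" for s t
    using \<pi>(2)[of "map_trm g s" "map_trm g t"] over[OF that] that by (force simp: M_def)
  moreover have "\<phi> u < arity_bound u" for u
    using \<pi>(1) unfolding sig by (auto simp: \<phi>_def arity_bound_def)
  ultimately show ?thesis by blast
qed

text \<open>Compactness: the assignments of argument positions form a product of finite discrete spaces,
  and each identity defines a closed set because it depends on finitely many coordinates.\<close>

lemma satisfiable:
  assumes V: "V \<in> varieties" and nt: "\<not> taylor_variety V"
  shows "\<exists>\<phi>. (\<forall>u. \<phi> u < arity_bound u) \<and>
    (\<forall>(s, t) \<in> valid_idempotent_identities V. chosen (\<lambda>u _. \<phi> u) s = chosen (\<lambda>u _. \<phi> u) t)"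
proof -
  let ?c = "\<lambda>\<phi>. chosen (\<lambda>u _. \<phi> u)"
  define X where "X = product_topology (\<lambda>u :: 'a trm. discrete_topology {..<arity_bound u}) UNIV"
  have top: "topspace X = {\<phi>. \<forall>u. \<phi> u < arity_bound u}"
    by (auto simp: X_def PiE_UNIV_domain)
  have compact: "compact_space X"
    unfolding X_def compact_space_product_topology by (auto simp: compact_space_discrete_topology)
  have open_coord: "openin X {\<phi> \<in> topspace X. \<phi> u = j}" for u j
  proof -
    have "continuous_map X (discrete_topology {..<arity_bound u}) (\<lambda>\<phi>. \<phi> u)"
      unfolding X_def by (rule continuous_map_product_projection) simp
    then have "openin X {\<phi> \<in> topspace X. \<phi> u \<in> {j} \<inter> {..<arity_bound u}}"
      by (rule openin_continuous_map_preimage) simp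
    moreover have "{\<phi> \<in> topspace X. \<phi> u \<in> {j} \<inter> {..<arity_bound u}} = {\<phi> \<in> topspace X. \<phi> u = j}"
      by (auto simp: top)
    ultimately show ?thesis by simp
  qed
  have open_chosen: "openin X {\<phi> \<in> topspace X. ?c \<phi> t = k}"
    if "t \<in> terms_over (idempotent_language V)" for t k
    using that
  proof (induction t arbitrary: k)
    case (Var x)
    then show ?case by (cases "x = k") auto
  next
    case (App u ts)
    have n: "length ts = arity_bound u" using App.prems by (auto simp: idempotent_language_def)
    have "{\<phi> \<in> topspace X. ?c \<phi> (App u ts) = k} =
        (\<Union>j \<in> {..<length ts}. {\<phi> \<in> topspace X. \<phi> u = j} \<inter> {\<phi> \<in> topspace X. ?c \<phi> (ts ! j) = k})"
      by (auto simp: top n)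
    moreover have "openin X ({\<phi> \<in> topspace X. \<phi> u = j} \<inter> {\<phi> \<in> topspace X. ?c \<phi> (ts ! j) = k})"
      if "j < length ts" for j
      using App that by (intro openin_Int open_coord App.IH) auto
    ultimately show ?case by (auto intro: openin_Union)
  qed
  define C where "C = (\<lambda>(s, t). {\<phi> \<in> topspace X. ?c \<phi> s = ?c \<phi> t})"
  have closed: "closedin X (C p)" if "p \<in> valid_idempotent_identities V" for p
  proof -
    obtain s t where p: "p = (s, t)" "s \<in> terms_over (idempotent_language V)"
      "t \<in> terms_over (idempotent_language V)"
      using \<open>p \<in> _\<close> by (auto simp: valid_idempotent_identities_def)
    have "topspace X - C p = (\<Union>k. \<Union>l \<in> - {k}.
        {\<phi> \<in> topspace X. ?c \<phi> s = k} \<inter> {\<phi> \<in> topspace X. ?c \<phi> t = l})"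
      by (auto simp: C_def p)
    then have "openin X (topspace X - C p)"
      using open_chosen p by (auto intro!: openin_Union openin_Int)
    then show ?thesis by (auto simp: closedin_def C_def p)
  qed
  have "\<Inter> (C ` F) \<noteq> {}"
    if "finite F" "F \<subseteq> valid_idempotent_identities V" for F
  proof -
    obtain \<phi> where "\<forall>u. \<phi> u < arity_bound u" "\<forall>(s, t) \<in> F. ?c \<phi> s = ?c \<phi> t"
      using finitely_satisfiable[OF V nt \<open>finite F\<close> \<open>F \<subseteq> _\<close>] by blast
    then have "\<phi> \<in> \<Inter> (C ` F)" by (auto simp: C_def top)
    then show ?thesis by blast
  qed
  then have fip: "\<Inter> \<F> \<noteq> {}" if "finite \<F>" "\<F> \<subseteq> C ` valid_idempotent_identities V" for \<F>
    using that by (metis finite_subset_image)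
  \<comment> \<open>A trivial identity, which ensures that the intersection below is taken within the space.\<close>
  define y :: "'a trm trm" where "y = Var 0"
  have "\<Inter> (C ` valid_idempotent_identities V) \<noteq> {}"
    using compact closed fip unfolding compact_space_fip by blast
  then obtain \<phi> where \<phi>: "\<phi> \<in> \<Inter> (C ` valid_idempotent_identities V)" by blast
  have "(y, y) \<in> valid_idempotent_identities V"
    by (auto simp: valid_idempotent_identities_def y_def intro: free_cong.refl)
  with \<phi> have "\<phi> \<in> topspace X" by (fastforce simp: C_def)
  then show ?thesis using \<phi> by (fastforce simp: C_def top)
qed

text \<open>Each clause in the definition of a selector is one of the valid identities in the language of
  idempotent terms.\<close>

lemma non_taylor_selector:
  assumes V: "V \<in> varieties" and nt: "\<not> taylor_variety V"
  shows "\<exists>\<phi>. selector V \<phi>"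
proof -
  obtain \<phi> where bound: "\<And>u. \<phi> u < arity_bound u"
    and sat: "\<And>s t. (s, t) \<in> valid_idempotent_identities V \<Longrightarrow>
      chosen (\<lambda>u _. \<phi> u) s = chosen (\<lambda>u _. \<phi> u) t"
    using satisfiable[OF assms] by blast
  \<comment> \<open>The symbol of an idempotent term, applied to variables, stands for the term itself.\<close>
  let ?c = "chosen (\<lambda>u _. \<phi> u)" and ?sym = "\<lambda>u. App u (map Var [0..<arity_bound u])"
  have c_sym: "?c (?sym u) = \<phi> u" for u using bound by simp
  have flat: "flatten (App u us) = eval App ((!) (map flatten us)) u" for u us
    by (rule eval_derived_App)
  have flat_sym: "flatten (?sym u) = u" for u
  proof -
    have "flatten (?sym u) = eval App Var u"
      unfolding flat by (rule eval_cong_vars) (use vars_of_arity_bound in force)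
    then show ?thesis by simp
  qed
  have over: "?sym u \<in> terms_over (idempotent_language V)" if "u \<in> idempotent_terms V" for u
    using that by (auto simp: idempotent_language_def)
  have valid: "?c s = ?c t"
    if "s \<in> terms_over (idempotent_language V)" "t \<in> terms_over (idempotent_language V)"
      "(flatten s, flatten t) \<in> free_cong V" for s t
    by (rule sat) (use that in \<open>simp add: valid_idempotent_identities_def\<close>)
  have "\<phi> (Var x) = x" for x
  proof -
    have "?c (?sym (Var x)) = ?c (Var x)"
    proof (rule valid[OF over])
      show "(flatten (?sym (Var x)), flatten (Var x)) \<in> free_cong V"
        unfolding flat_sym by (simp add: free_cong.refl)
    qed simp_all
    then show ?thesis unfolding c_sym by simp
  qed
  moreover have "\<phi> s = \<phi> t"
    if "s \<in> idempotent_terms V" "t \<in> idempotent_terms V" "(s, t) \<in> free_cong V" for s t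
    using valid[OF over[OF that(1)] over[OF that(2)]] that(3) unfolding flat_sym c_sym by blast
  moreover have "\<phi> (eval App \<sigma> t) = \<phi> (\<sigma> (\<phi> t))"
    if t: "t \<in> idempotent_terms V" and \<sigma>: "\<forall>x. \<sigma> x \<in> idempotent_terms V" for t \<sigma>
  proof -
    let ?u = "App t (map (\<lambda>i. ?sym (\<sigma> i)) [0..<arity_bound t])"
    have "flatten ?u = eval App \<sigma> t"
      unfolding flat by (rule eval_cong_vars) (use vars_of_arity_bound flat_sym in force)
    moreover have "?u \<in> terms_over (idempotent_language V)"
      using over \<sigma> t by (auto simp: idempotent_language_def)
    moreover have st: "eval App \<sigma> t \<in> idempotent_terms V" using subst_idempotent[OF t] \<sigma> by blast
    ultimately have "?c (?sym (eval App \<sigma> t)) = ?c ?u"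
      by (intro valid over) (simp only: flat_sym free_cong.refl[OF idempotent_termsD(1)[OF st]])+
    then have "\<phi> (eval App \<sigma> t) = ?c ?u" unfolding c_sym .
    also have "?c ?u = ?c (?sym (\<sigma> (\<phi> t)))" using bound[of t] by simp
    also have "\<dots> = \<phi> (\<sigma> (\<phi> t))" by (rule c_sym)
    finally show ?thesis .
  qed
  ultimately show ?thesis unfolding selector_def by blast
qed

section \<open>The universal bundle of ternary structures\<close>

text \<open>A base point carries its fibre: a domain and a ternary relation. The additional set provides the
  number of copies that makes the bundle universal.\<close>

type_synonym 'f base_point = "('f set \<times> ('f \<times> 'f \<times> 'f) set) \<times> 'f set"

definition bundle_space :: "('f base_point \<times> 'f) set" where
  "bundle_space = {b. snd b \<in> fst (fst (fst b))}"

definition bundle_rel :: "'f base_point \<times> 'f \<Rightarrow> 'f base_point \<times> 'f \<Rightarrow> 'f base_point \<times> 'f \<Rightarrow> bool" where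
  "bundle_rel a b c \<longleftrightarrow> fst b = fst a \<and> fst c = fst a \<and> (snd a, snd b, snd c) \<in> snd (fst (fst a))"

text \<open>Operations have to be compatible with the equivalence of lying in the same fibre, not to preserve
  each fibre.\<close>

definition acts_on_bundle ::
  "'f variety \<Rightarrow> ('f \<Rightarrow> ('b base_point \<times> 'b) list \<Rightarrow> 'b base_point \<times> 'b) \<Rightarrow> bool" where
  "acts_on_bundle V I \<longleftrightarrow> in_variety V bundle_space I \<and>
     (\<forall>f n xs ys. (f, n) \<in> signature V \<longrightarrow> xs \<in> tuples bundle_space n \<longrightarrow> ys \<in> tuples bundle_space n \<longrightarrow>
        map fst xs = map fst ys \<longrightarrow> fst (I f xs) = fst (I f ys)) \<and>
     (\<forall>f n xs ys zs. (f, n) \<in> signature V \<longrightarrow> xs \<in> tuples bundle_space n \<longrightarrow> ys \<in> tuples bundle_space n \<longrightarrow>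
        zs \<in> tuples bundle_space n \<longrightarrow> (\<forall>i < n. bundle_rel (xs ! i) (ys ! i) (zs ! i)) \<longrightarrow>
        bundle_rel (I f xs) (I f ys) (I f zs))"

lemma acts_in_variety: "acts_on_bundle V I \<Longrightarrow> in_variety V bundle_space I"
  by (simp add: acts_on_bundle_def)

lemma acts_fibres:
  "acts_on_bundle V I \<Longrightarrow> (f, n) \<in> signature V \<Longrightarrow> xs \<in> tuples bundle_space n \<Longrightarrow> ys \<in> tuples bundle_space n \<Longrightarrow>
    map fst xs = map fst ys \<Longrightarrow> fst (I f xs) = fst (I f ys)"
  unfolding acts_on_bundle_def by blast

lemma acts_rel:
  "acts_on_bundle V I \<Longrightarrow> (f, n) \<in> signature V \<Longrightarrow> xs \<in> tuples bundle_space n \<Longrightarrow> ys \<in> tuples bundle_space n \<Longrightarrow>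
    zs \<in> tuples bundle_space n \<Longrightarrow> (\<And>i. i < n \<Longrightarrow> bundle_rel (xs ! i) (ys ! i) (zs ! i)) \<Longrightarrow>
    bundle_rel (I f xs) (I f ys) (I f zs)"
  unfolding acts_on_bundle_def by blast

lemma map_eval_tuple:
  assumes I: "in_variety V A I" and t: "App f ts \<in> terms_over (signature V)" and \<rho>: "\<rho> \<in> UNIV \<rightarrow> A"
  shows "map (eval I \<rho>) ts \<in> tuples A (length ts)"
  using eval_closed[OF I _ \<rho>] t by (auto simp: tuples_def)

lemma acts_term_fibres:
  assumes I: "acts_on_bundle V I" and t: "t \<in> terms_over (signature V)"
    and \<rho>: "\<rho> \<in> UNIV \<rightarrow> bundle_space" "\<rho>' \<in> UNIV \<rightarrow> bundle_space" "\<And>x. fst (\<rho> x) = fst (\<rho>' x)"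
  shows "fst (eval I \<rho> t) = fst (eval I \<rho>' t)"
  using t
proof (induction t)
  case (App f ts)
  have "map fst (map (eval I \<rho>) ts) = map fst (map (eval I \<rho>') ts)" using App by auto
  moreover have "(f, length ts) \<in> signature V" using App.prems by simp
  ultimately show ?case
    using acts_fibres[OF I] map_eval_tuple[OF acts_in_variety[OF I] App.prems] \<rho> by simp
qed (use \<rho> in auto)

lemma acts_term_rel:
  assumes I: "acts_on_bundle V I" and t: "t \<in> terms_over (signature V)"
    and \<rho>: "\<rho> \<in> UNIV \<rightarrow> bundle_space" "\<rho>' \<in> UNIV \<rightarrow> bundle_space" "\<rho>'' \<in> UNIV \<rightarrow> bundle_space"
    "\<And>x. x \<in> vars_of t \<Longrightarrow> bundle_rel (\<rho> x) (\<rho>' x) (\<rho>'' x)"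
  shows "bundle_rel (eval I \<rho> t) (eval I \<rho>' t) (eval I \<rho>'' t)"
  using t \<rho>(4)
proof (induction t)
  case (App f ts)
  note tup = map_eval_tuple[OF acts_in_variety[OF I] App.prems(1)]
  have "bundle_rel (I f (map (eval I \<rho>) ts)) (I f (map (eval I \<rho>') ts)) (I f (map (eval I \<rho>'') ts))"
  proof (rule acts_rel[OF I _ tup[OF \<rho>(1)] tup[OF \<rho>(2)] tup[OF \<rho>(3)]])
    fix i assume i: "i < length ts"
    then have "bundle_rel (eval I \<rho> (ts ! i)) (eval I \<rho>' (ts ! i)) (eval I \<rho>'' (ts ! i))"
      using App.prems by (intro App.IH) (auto intro: nth_mem)
    then show "bundle_rel (map (eval I \<rho>) ts ! i) (map (eval I \<rho>') ts ! i) (map (eval I \<rho>'') ts ! i)"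
      using i by simp
  qed (use App.prems in simp)
  then show ?case by simp
qed (use \<rho> in auto)

lemma bundle_point: "((({a}, R), i), a) \<in> bundle_space"
  by (simp add: bundle_space_def)

lemma acts_derived:
  assumes V: "V \<in> varieties" and L: "is_interpretation V W L" and I: "acts_on_bundle W I"
  shows "acts_on_bundle V (derived I L)"
proof -
  obtain b0 :: "'c base_point \<times> 'c" where b0: "b0 \<in> bundle_space" using bundle_point by (rule that)
  define ext where "ext n xs i = (if i < n then xs ! i else b0)" for n and xs :: "('c base_point \<times> 'c) list" and i
  have ext: "ext n xs \<in> UNIV \<rightarrow> bundle_space" if "xs \<in> tuples bundle_space n" for n xs
    using that b0 by (auto simp: ext_def tuples_def)
  have der: "derived I L f xs = eval I (ext n xs) (L f n)"
    if "(f, n) \<in> signature V" "xs \<in> tuples bundle_space n" for f n xs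
    unfolding derived_def using that is_interpretationD(2)[OF L that(1)]
    by (auto simp: tuples_def ext_def intro!: eval_cong_vars)
  have "fst (derived I L f xs) = fst (derived I L f ys)"
    if f: "(f, n) \<in> signature V" and xs: "xs \<in> tuples bundle_space n" and ys: "ys \<in> tuples bundle_space n"
      and eq: "map fst xs = map fst ys" for f n xs ys
  proof -
    have "fst (ext n xs i) = fst (ext n ys i)" for i
      using xs ys arg_cong[OF eq, of "\<lambda>l. l ! i"] by (auto simp: ext_def tuples_def)
    then show ?thesis
      unfolding der[OF f xs] der[OF f ys]
      by (intro acts_term_fibres[OF I is_interpretationD(1)[OF L f] ext[OF xs] ext[OF ys]])
  qed
  moreover have "bundle_rel (derived I L f xs) (derived I L f ys) (derived I L f zs)"
    if f: "(f, n) \<in> signature V" and xs: "xs \<in> tuples bundle_space n" and ys: "ys \<in> tuples bundle_space n"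
      and zs: "zs \<in> tuples bundle_space n" and rel: "\<forall>i < n. bundle_rel (xs ! i) (ys ! i) (zs ! i)" for f n xs ys zs
  proof -
    have "bundle_rel (ext n xs i) (ext n ys i) (ext n zs i)" if "i \<in> vars_of (L f n)" for i
      using that is_interpretationD(2)[OF L f] rel by (auto simp: ext_def)
    then show ?thesis
      unfolding der[OF f xs] der[OF f ys] der[OF f zs]
      by (intro acts_term_rel[OF I is_interpretationD(1)[OF L f] ext[OF xs] ext[OF ys] ext[OF zs]])
  qed
  moreover have "in_variety V bundle_space (derived I L)"
    by (rule derived_in_variety[OF V L acts_in_variety[OF I]]) (use b0 in blast)
  ultimately show ?thesis unfolding acts_on_bundle_def by blast
qed

text \<open>Partitions into \<open>A\<close>, \<open>B\<close> and the rest show that \<open>U\<close> is additive on disjoint sets. So it is determined by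
  the singletons in it, and there is exactly one of these.\<close>

lemma one_of_three_family:
  fixes U :: "'i set set"
  assumes fin: "finite X"
    and part: "\<And>A B C. A \<union> B \<union> C = X \<Longrightarrow> A \<inter> B = {} \<Longrightarrow> A \<inter> C = {} \<Longrightarrow> B \<inter> C = {} \<Longrightarrow>
      (A \<in> U \<and> B \<notin> U \<and> C \<notin> U) \<or> (A \<notin> U \<and> B \<in> U \<and> C \<notin> U) \<or> (A \<notin> U \<and> B \<notin> U \<and> C \<in> U)"
  shows "\<exists>i \<in> X. \<forall>A \<subseteq> X. A \<in> U \<longleftrightarrow> i \<in> A"
proof -
  have empty: "{} \<notin> U" and full: "X \<in> U" using part[of X "{}" "{}"] by auto
  have compl: "A \<in> U \<longleftrightarrow> X - A \<notin> U" if "A \<subseteq> X" for A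
    using part[of A "X - A" "{}"] that empty by auto
  have union: "(A \<union> B \<in> U \<longleftrightarrow> A \<in> U \<or> B \<in> U) \<and> \<not> (A \<in> U \<and> B \<in> U)"
    if "A \<subseteq> X" "B \<subseteq> X" "A \<inter> B = {}" for A B
    using part[of A B "X - (A \<union> B)"] compl[of "A \<union> B"] that by auto
  have points: "A \<in> U \<longleftrightarrow> (\<exists>i \<in> A. {i} \<in> U)" if "A \<subseteq> X" for A
    using finite_subset[OF that fin] that
  proof (induction A rule: finite_induct)
    case (insert a A)
    then show ?case using union[of "{a}" A] by auto
  qed (use empty in simp)
  obtain i where i: "i \<in> X" "{i} \<in> U" using points[of X] full by auto
  have "A \<in> U \<longleftrightarrow> i \<in> A" if A: "A \<subseteq> X" for A
  proof
    assume "A \<in> U"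
    then obtain j where j: "j \<in> A" "{j} \<in> U" using points[OF A] by auto
    then show "i \<in> A" using union[of "{i}" "{j}"] i A by auto
  next
    assume "i \<in> A"
    then show "A \<in> U" using points[OF A] i by auto
  qed
  then show ?thesis using i by blast
qed

text \<open>Idempotent operations preserve the fibre with domain \<open>{u, w}\<close> and the relation ``exactly one of
  three is \<open>w\<close>'', and are projections there. Since the two elements are distinct, an identity that
  holds on this fibre selects the same variable on both sides.\<close>

lemma acts_idempotent_trivial:
  fixes I :: "nat \<Rightarrow> ('b base_point \<times> 'b) list \<Rightarrow> 'b base_point \<times> 'b"
  assumes u: "u \<noteq> (w :: 'b)" and id: "idempotent_condition M" and I: "acts_on_bundle (variety_of M) I"
  shows "trivial_condition M"
proof -
  let ?N = "variety_of M"
  define x :: "'b base_point" where "x = (({u, w}, {(w, u, u), (u, w, u), (u, u, w)}), {})"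
  define pt where "pt b = (x, if b then w else u)" for b
  have pt_bundle: "pt b \<in> bundle_space" for b by (simp add: pt_def x_def bundle_space_def)
  have pt_inj: "pt b = pt c \<longleftrightarrow> b = c" for b c using u by (auto simp: pt_def)
  have pt_rel: "bundle_rel (pt a) (pt b) (pt c) \<longleftrightarrow>
      (a \<and> \<not> b \<and> \<not> c) \<or> (\<not> a \<and> b \<and> \<not> c) \<or> (\<not> a \<and> \<not> b \<and> c)" for a b c
    using u by (auto simp: pt_def x_def bundle_rel_def)
  have pt_fibre: "\<exists>b. c = pt b" if "c \<in> bundle_space" "fst c = x" for c
    using that by (cases c) (auto simp: bundle_space_def pt_def x_def intro: exI[of _ True] exI[of _ False])
  have pt_tuple: "map pt bs \<in> tuples bundle_space (length bs)" for bs
    using pt_bundle by (auto simp: tuples_def)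
  have "\<exists>i. (f, n) \<in> signature ?N \<longrightarrow> i < n \<and> (\<forall>bs. length bs = n \<longrightarrow> I f (map pt bs) = pt (bs ! i))" for f n
  proof (cases "(f, n) \<in> signature ?N")
    case f: True
    \<comment> \<open>An idempotent operation keeps each fibre, since it fixes a point in it.\<close>
    have const: "I f (replicate n b) = b" if "b \<in> bundle_space" for b
    proof -
      have "(App f (replicate n (Var 0)), Var 0) \<in> free_cong ?N"
        using id f unfolding idempotent_condition_def idempotent_variety_iff[OF variety_of_varieties] by blast
      then have "eval I (\<lambda>_. b) (App f (replicate n (Var 0))) = eval I (\<lambda>_. b) (Var 0)"
        by (rule free_cong_sound[OF acts_in_variety[OF I]]) (use that in simp)
      then show ?thesis by simp
    qed
    define X where "X = {..<n}"
    define ind where "ind A = I f (map (\<lambda>i. pt (i \<in> A)) [0..<n])" for A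
    have tup: "map (\<lambda>i. pt (i \<in> A)) [0..<n] \<in> tuples bundle_space n" for A
      using pt_bundle by (auto simp: tuples_def)
    have "fst (ind A) = x" for A
    proof -
      have "fst (ind A) = fst (I f (replicate n (pt True)))"
        unfolding ind_def
      proof (rule acts_fibres[OF I f tup])
        show "replicate n (pt True) \<in> tuples bundle_space n"
          using pt_bundle[of True] by (auto simp: tuples_def)
        show "map fst (map (\<lambda>i. pt (i \<in> A)) [0..<n]) = map fst (replicate n (pt True))"
          by (auto simp: pt_def intro!: nth_equalityI)
      qed
      then show ?thesis using const[OF pt_bundle[of True]] by (simp add: pt_def)
    qed
    moreover have "ind A \<in> bundle_space" for A
      using acts_in_variety[OF I] f tup[of A] unfolding in_variety_def ind_def by blast
    ultimately have "\<exists>b. ind A = pt b" for A using pt_fibre by blast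
    then obtain val where val: "\<And>A. ind A = pt (val A)" by metis
    define U where "U = {A. val A}"
    have "\<exists>i \<in> X. \<forall>A \<subseteq> X. A \<in> U \<longleftrightarrow> i \<in> A"
    proof (rule one_of_three_family)
      fix A B C assume part: "A \<union> B \<union> C = X" "A \<inter> B = {}" "A \<inter> C = {}" "B \<inter> C = {}"
      have "bundle_rel (ind A) (ind B) (ind C)"
        unfolding ind_def
      proof (rule acts_rel[OF I f tup tup tup])
        fix i assume "i < n"
        then have "i \<in> A \<union> B \<union> C" using part(1) by (simp add: X_def)
        then show "bundle_rel (map (\<lambda>i. pt (i \<in> A)) [0..<n] ! i) (map (\<lambda>i. pt (i \<in> B)) [0..<n] ! i)
            (map (\<lambda>i. pt (i \<in> C)) [0..<n] ! i)"
          using part(2-) \<open>i < n\<close> by (auto simp: pt_rel)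
      qed
      then show "(A \<in> U \<and> B \<notin> U \<and> C \<notin> U) \<or> (A \<notin> U \<and> B \<in> U \<and> C \<notin> U) \<or> (A \<notin> U \<and> B \<notin> U \<and> C \<in> U)"
        unfolding val pt_rel U_def by simp
    qed (simp add: X_def)
    then obtain i where i: "i < n" "\<And>A. A \<subseteq> X \<Longrightarrow> A \<in> U \<longleftrightarrow> i \<in> A" by (auto simp: X_def)
    have "I f (map pt bs) = pt (bs ! i)" if bs: "length bs = n" for bs
    proof -
      let ?A = "{j. j < n \<and> bs ! j}"
      have "map (\<lambda>j. pt (j \<in> ?A)) [0..<n] = map pt bs" using bs by (auto intro!: nth_equalityI)
      then have "I f (map pt bs) = pt (val ?A)" using val[of ?A] by (simp add: ind_def)
      moreover have "val ?A = bs ! i" using i(2)[of ?A] i(1) by (auto simp: U_def X_def)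
      ultimately show ?thesis by simp
    qed
    then show ?thesis using i(1) by blast
  qed blast
  then obtain \<pi> where \<pi>: "\<And>f n. (f, n) \<in> signature ?N \<Longrightarrow> \<pi> f n < n"
    "\<And>f n bs. (f, n) \<in> signature ?N \<Longrightarrow> length bs = n \<Longrightarrow> I f (map pt bs) = pt (bs ! \<pi> f n)"
    by metis
  have eval_pt: "eval I (\<lambda>j. pt (\<beta> j)) t = pt (\<beta> (chosen \<pi> t))" if "t \<in> terms_over (signature ?N)" for t \<beta>
    using that
  proof (induction t)
    case (App f ts)
    have f: "(f, length ts) \<in> signature ?N" using App.prems by simp
    have "map (eval I (\<lambda>j. pt (\<beta> j))) ts = map pt (map (\<lambda>t. \<beta> (chosen \<pi> t)) ts)"
      using App by auto
    then have "eval I (\<lambda>j. pt (\<beta> j)) (App f ts) = pt (map (\<lambda>t. \<beta> (chosen \<pi> t)) ts ! \<pi> f (length ts))"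
      using \<pi>(2)[OF f, of "map (\<lambda>t. \<beta> (chosen \<pi> t)) ts"] by (simp only: eval.simps length_map)
    then show ?case using \<pi>(1)[OF f] by simp
  qed simp
  have "chosen \<pi> s = chosen \<pi> t" if st: "(s, t) \<in> M" for s t
  proof -
    \<comment> \<open>This assignment separates the variable selected on the left from all others.\<close>
    let ?\<beta> = "\<lambda>j. j = chosen \<pi> s"
    have ids: "(s, t) \<in> identities ?N" using st by (simp add: variety_of_def)
    then have "s \<in> terms_over (signature ?N)" "t \<in> terms_over (signature ?N)"
      using variety_of_varieties[of M] by (auto simp: varieties_def)
    moreover have "(\<lambda>j. pt (?\<beta> j)) \<in> UNIV \<rightarrow> bundle_space" using pt_bundle by simp
    then have "eval I (\<lambda>j. pt (?\<beta> j)) s = eval I (\<lambda>j. pt (?\<beta> j)) t"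
      using free_cong_sound[OF acts_in_variety[OF I] free_cong_identity[OF ids]] by blast
    ultimately show ?thesis by (simp add: eval_pt pt_inj)
  qed
  then show ?thesis using \<pi>(1) unfolding trivial_condition_iff by blast
qed

lemma acts_on_bundle_not_taylor:
  fixes I :: "'f \<Rightarrow> ('b base_point \<times> 'b) list \<Rightarrow> 'b base_point \<times> 'b"
  assumes u: "u \<noteq> (w :: 'b)" and V: "V \<in> varieties" and I: "acts_on_bundle V I"
  shows "\<not> taylor_variety V"
proof
  assume "taylor_variety V"
  then obtain M where M: "idempotent_condition M" "\<not> trivial_condition M" "admits V M"
    unfolding taylor_variety_def by blast
  obtain L where "is_interpretation (variety_of M) V L"
    using M(3) unfolding admits_def interprets_iff[OF variety_of_varieties V] by blast
  then show False
    using acts_idempotent_trivial[OF u M(1) acts_derived[OF variety_of_varieties _ I]] M(2) by blast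
qed

section \<open>Trees and their codes\<close>

text \<open>Terms over an arbitrary set of generators; the variables of \<open>trm\<close> would be too few.\<close>

datatype (dead 'f, leaves: 'v) tree = Leaf 'v | Node 'f "('f, 'v) tree list"
  for map: relabel

primrec list_code :: "('c \<times> 'c \<Rightarrow> 'c) \<Rightarrow> 'c \<Rightarrow> 'c \<Rightarrow> 'c list \<Rightarrow> 'c" where
  "list_code p z0 z1 [] = p (z0, z0)"
| "list_code p z0 z1 (x # xs) = p (z1, p (x, list_code p z0 z1 xs))"

primrec tree_code ::
  "('c \<times> 'c \<Rightarrow> 'c) \<Rightarrow> 'c \<Rightarrow> 'c \<Rightarrow> ('f \<Rightarrow> 'c) \<Rightarrow> ('v \<Rightarrow> 'c) \<Rightarrow> ('f, 'v) tree \<Rightarrow> 'c" where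
  "tree_code p z0 z1 jf jv (Leaf v) = p (z0, jv v)"
| "tree_code p z0 z1 jf jv (Node f Ps) =
     p (z1, p (jf f, list_code p z0 z1 (map (tree_code p z0 z1 jf jv) Ps)))"

lemma list_code_inj:
  assumes "inj p" "z0 \<noteq> z1"
  shows "list_code p z0 z1 xs = list_code p z0 z1 ys \<Longrightarrow> xs = ys"
proof (induction xs arbitrary: ys)
  case Nil
  then show ?case using assms by (cases ys) (auto dest: injD)
next
  case (Cons x xs)
  then show ?case using assms by (cases ys) (auto dest!: injD[OF assms(1)])
qed

text \<open>Injectivity of \<open>jv\<close> is only demanded on the leaves that occur, because later the leaves come from
  a union of finitely many fibres.\<close>

lemma tree_code_inj:
  assumes p: "inj p" and z: "z0 \<noteq> z1" and jf: "inj jf" and jv: "inj_on jv Z"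
  shows "inj_on (tree_code p z0 z1 jf jv) {P. leaves P \<subseteq> Z}"
proof (rule inj_onI)
  fix P Q assume "P \<in> {P. leaves P \<subseteq> Z}" "Q \<in> {P. leaves P \<subseteq> Z}"
    "tree_code p z0 z1 jf jv P = tree_code p z0 z1 jf jv Q"
  then show "P = Q"
  proof (induction P arbitrary: Q)
    case (Leaf v)
    then show ?case using z inj_onD[OF jv] by (cases Q) (auto dest!: injD[OF p])
  next
    case (Node f Ps)
    obtain g Qs where Q: "Q = Node g Qs"
      using Node.prems z by (cases Q) (auto dest!: injD[OF p])
    have eq: "f = g" "map (tree_code p z0 z1 jf jv) Ps = map (tree_code p z0 z1 jf jv) Qs"
      using Node.prems Q injD[OF jf] list_code_inj[OF p z] by (auto dest!: injD[OF p])
    have "Ps = Qs"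
      by (rule list.inj_map_strong[OF _ eq(2)]) (rule Node.IH, use Node.prems Q in auto)
    then show ?case using Q eq(1) by simp
  qed
qed

lemma infinite_pairing:
  assumes "infinite (UNIV :: 'c set)"
  shows "\<exists>p :: 'c \<times> 'c \<Rightarrow> 'c. inj p"
proof -
  have "(card_of (UNIV \<times> UNIV :: ('c \<times> 'c) set), card_of (UNIV :: 'c set)) \<in> ordIso"
    by (rule card_of_Times_same_infinite[OF assms])
  then obtain p where "bij_betw p (UNIV \<times> UNIV :: ('c \<times> 'c) set) (UNIV :: 'c set)"
    using card_of_ordIso by blast
  then show ?thesis by (auto simp: bij_betw_def)
qed

lemma ex_tree_code:
  fixes jf :: "'f \<Rightarrow> 'c" and jv :: "'v \<Rightarrow> 'c"
  assumes inf: "infinite (UNIV :: 'c set)" and jf: "inj jf" and jv: "inj_on jv Z"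
  shows "\<exists>code :: ('f, 'v) tree \<Rightarrow> 'c. inj_on code {P. leaves P \<subseteq> Z}"
proof -
  obtain p :: "'c \<times> 'c \<Rightarrow> 'c" where p: "inj p" using infinite_pairing[OF inf] by blast
  obtain z0 z1 :: 'c where "z0 \<noteq> z1"
    using inf by (metis (full_types) UNIV_I ex_new_if_finite finite.emptyI finite_insert insertI1)
  then show ?thesis using tree_code_inj[OF p _ jf jv] by blast
qed

lemma infinite_nat_embedding:
  assumes "infinite (UNIV :: 'c set)"
  shows "\<exists>j :: nat \<Rightarrow> 'c. inj j"
  using infinite_countable_subset[OF assms] by auto

lemma inj_eval_Node: "inj (eval Node Leaf :: 'f trm \<Rightarrow> ('f, nat) tree)"
proof (rule injI)
  fix s t :: "'f trm" assume "(eval Node Leaf s :: ('f, nat) tree) = eval Node Leaf t"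
  then show "s = t"
  proof (induction s arbitrary: t)
    case (Var x)
    then show ?case by (cases t) auto
  next
    case (App f ss)
    then obtain ts where t: "t = App f ts" "map (eval Node Leaf) ss = map (eval Node Leaf) ts"
      by (cases t) auto
    have "ss = ts" by (rule list.inj_map_strong[OF _ t(2)]) (rule App.IH)
    then show ?case using t by simp
  qed
qed

text \<open>These names are the symbols of the meet of two varieties.\<close>

lemma term_pair_encoding:
  assumes "infinite (UNIV :: 'f set)"
  shows "\<exists>enc :: 'f trm \<times> 'f trm \<Rightarrow> 'f. inj enc"
proof -
  obtain j :: "nat \<Rightarrow> 'f" where j: "inj j" using infinite_nat_embedding[OF assms] by blast
  obtain code :: "('f, nat) tree \<Rightarrow> 'f" where code: "inj code"
    using ex_tree_code[OF assms inj_on_id[of UNIV], of j UNIV] j by auto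
  obtain p :: "'f \<times> 'f \<Rightarrow> 'f" where p: "inj p" using infinite_pairing[OF assms] by blast
  have "inj (p \<circ> map_prod (code \<circ> eval Node Leaf) (code \<circ> eval Node Leaf))"
    using p code inj_eval_Node by (intro inj_compose prod.inj_map)
  then show ?thesis by blast
qed

section \<open>Joins and meets of varieties\<close>

lemma symbol_term_translate:
  fixes I :: "'g \<Rightarrow> 'a list \<Rightarrow> 'a"
  assumes "t \<in> terms_over S" "\<And>f n. (f, n) \<in> S \<Longrightarrow> L f n = App (i f n) (map Var [0..<n])"
  shows "eval I \<rho> (translate L t) = eval (\<lambda>f xs. I (i f (length xs)) xs) \<rho> t"
proof -
  have "vars_of (L f n) \<subseteq> {..<n}" if "(f, n) \<in> S" for f n using assms(2)[OF that] by auto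
  then have "eval I \<rho> (translate L t) = eval (derived I L) \<rho> t" by (rule eval_derived[OF assms(1)])
  also have "\<dots> = eval (\<lambda>f xs. I (i f (length xs)) xs) \<rho> t"
  proof (rule eval_arity_cong[OF assms(1)])
    fix f and xs :: "'a list" assume "(f, length xs) \<in> S"
    moreover have "map (eval I ((!) xs)) (map Var [0..<length xs]) = xs"
      by (auto intro: nth_equalityI)
    ultimately show "derived I L f xs = I (i f (length xs)) xs"
      by (simp add: derived_def assms(2) del: map_map)
  qed
  finally show ?thesis .
qed

text \<open>The embeddings \<open>i\<close> and \<open>j\<close> rename the symbols apart.\<close>

definition join_variety :: "('f \<Rightarrow> 'h) \<Rightarrow> ('g \<Rightarrow> 'h) \<Rightarrow> 'f variety \<Rightarrow> 'g variety \<Rightarrow> 'h variety" where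
  "join_variety i j V W =
     \<lparr>signature = (\<lambda>(f, n). (i f, n)) ` signature V \<union> (\<lambda>(f, n). (j f, n)) ` signature W,
      identities = (\<lambda>(s, t). (map_trm i s, map_trm i t)) ` identities V \<union>
        (\<lambda>(s, t). (map_trm j s, map_trm j t)) ` identities W\<rparr>"

lemma map_trm_terms_over:
  assumes "t \<in> terms_over S" "(\<lambda>(f, n). (i f, n)) ` S \<subseteq> T"
  shows "map_trm i t \<in> terms_over T"
  using assms unfolding terms_over_def by (auto simp: symbols_of_map_trm)

lemma join_variety_swap: "join_variety i j V W = join_variety j i W V"
  by (simp add: join_variety_def Un_commute)

lemma join_variety_varieties:
  assumes "V \<in> varieties" "W \<in> varieties"
  shows "join_variety i j V W \<in> varieties"
proof -
  have "map_trm k s \<in> terms_over (signature (join_variety i j V W)) \<and>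
      map_trm k t \<in> terms_over (signature (join_variety i j V W))"
    if "X \<in> varieties" "(s, t) \<in> identities X"
      "(\<lambda>(f, n). (k f, n)) ` signature X \<subseteq> signature (join_variety i j V W)" for k X s t
    using that map_trm_terms_over[of _ "signature X" k] by (auto simp: varieties_def)
  from this[OF assms(1), of _ _ i] this[OF assms(2), of _ _ j] show ?thesis
    unfolding varieties_def by (auto simp: join_variety_def)
qed

lemma join_upper:
  assumes V: "V \<in> varieties" and W: "W \<in> varieties"
  shows "interprets V (join_variety i j V W)"
proof (rule interpretation_clone_hom[OF V join_variety_varieties[OF V W]])
  let ?J = "join_variety i j V W"
  let ?L = "\<lambda>f n. App (i f) (map Var [0..<n])"
  have tr: "translate ?L s = map_trm i s" if s: "s \<in> terms_over (signature V)" for s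
  proof -
    have "translate ?L s = eval App Var (translate ?L s)" by simp
    also have "\<dots> = eval (\<lambda>f. App (i f)) Var s"
      using symbol_term_translate[OF s, of ?L "\<lambda>f n. i f" App Var] by simp
    also have "\<dots> = eval App Var (map_trm i s)" by (simp add: eval_map_trm)
    finally show ?thesis by simp
  qed
  show "is_interpretation V ?J ?L"
  proof (rule is_interpretationI)
    fix s t assume st: "(s, t) \<in> identities V"
    then have "(map_trm i s, map_trm i t) \<in> identities ?J" by (force simp: join_variety_def)
    moreover have "s \<in> terms_over (signature V)" "t \<in> terms_over (signature V)"
      using V st by (auto simp: varieties_def)
    ultimately show "(translate ?L s, translate ?L t) \<in> free_cong ?J"
      using tr free_cong_identity by metis
  qed (force simp: join_variety_def)+
qed

text \<open>A family on the union of two disjoint sets of names, given by its two restrictions.\<close>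

definition copair :: "('f \<Rightarrow> 'h) \<Rightarrow> ('g \<Rightarrow> 'h) \<Rightarrow> ('f \<Rightarrow> 'x) \<Rightarrow> ('g \<Rightarrow> 'x) \<Rightarrow> 'h \<Rightarrow> 'x" where
  "copair i j a b h = (if h \<in> range i then a (inv i h) else b (inv j h))"

lemma copair_left [simp]: "inj i \<Longrightarrow> copair i j a b (i f) = a f"
  by (simp add: copair_def)

lemma copair_right [simp]: "inj j \<Longrightarrow> range i \<inter> range j = {} \<Longrightarrow> copair i j a b (j g) = b g"
  by (auto simp: copair_def)

lemma join_least:
  assumes V: "V \<in> varieties" and W: "W \<in> varieties" and U: "U \<in> varieties"
    and i: "inj i" and j: "inj j" and disj: "range i \<inter> range j = {}"
    and VU: "interprets V U" and WU: "interprets W U"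
  shows "interprets (join_variety i j V W) U"
proof -
  obtain K where K: "is_interpretation V U K" using VU interprets_iff[OF V U] by blast
  obtain L where L: "is_interpretation W U L" using WU interprets_iff[OF W U] by blast
  let ?C = "copair i j K L"
  have tr_left: "translate ?C (map_trm i s) = translate K s" for s
    unfolding eval_map_trm by (rule eval_arity_cong[of _ UNIV]) (auto simp: terms_over_def derived_def i)
  have tr_right: "translate ?C (map_trm j s) = translate L s" for s
    unfolding eval_map_trm
    by (rule eval_arity_cong[of _ UNIV]) (auto simp: terms_over_def derived_def j disj)
  have "is_interpretation (join_variety i j V W) U ?C"
  proof (rule is_interpretationI)
    fix f n assume "(f, n) \<in> signature (join_variety i j V W)"
    then consider g where "f = i g" "(g, n) \<in> signature V" | g where "f = j g" "(g, n) \<in> signature W"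
      by (auto simp: join_variety_def)
    then have "?C f n \<in> terms_over (signature U) \<and> vars_of (?C f n) \<subseteq> {..<n}"
    proof cases
      case 1
      then show ?thesis using is_interpretationD[OF K 1(2)] i by simp
    next
      case 2
      then show ?thesis using is_interpretationD[OF L 2(2)] j disj by simp
    qed
    then show "?C f n \<in> terms_over (signature U)" "vars_of (?C f n) \<subseteq> {..<n}" by auto
  next
    fix s t assume "(s, t) \<in> identities (join_variety i j V W)"
    then consider s' t' where "s = map_trm i s'" "t = map_trm i t'" "(s', t') \<in> identities V"
      | s' t' where "s = map_trm j s'" "t = map_trm j t'" "(s', t') \<in> identities W"
      by (auto simp: join_variety_def)
    then show "(translate ?C s, translate ?C t) \<in> free_cong U"
    proof cases
      case 1
      then show ?thesis
        unfolding 1 tr_left using free_cong_translate[OF V U K free_cong_identity] by blast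
    next
      case 2
      then show ?thesis
        unfolding 2 tr_right using free_cong_translate[OF W U L free_cong_identity] by blast
    qed
  qed
  then show ?thesis by (rule interpretation_clone_hom[OF join_variety_varieties[OF V W] U])
qed

abbreviation first_component :: "('f trm \<times> 'g trm \<Rightarrow> 'h) \<Rightarrow> 'h trm \<Rightarrow> 'f trm" where
  "first_component enc \<equiv> translate (\<lambda>h n. fst (inv enc h))"

abbreviation second_component :: "('f trm \<times> 'g trm \<Rightarrow> 'h) \<Rightarrow> 'h trm \<Rightarrow> 'g trm" where
  "second_component enc \<equiv> translate (\<lambda>h n. snd (inv enc h))"

definition meet_signature ::
  "('f trm \<times> 'g trm \<Rightarrow> 'h) \<Rightarrow> 'f variety \<Rightarrow> 'g variety \<Rightarrow> ('h \<times> nat) set" where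
  "meet_signature enc V W = {(enc (s, t), n) |s t n. s \<in> nary_terms V n \<and> t \<in> nary_terms W n}"

text \<open>A term of the meet is a pair of terms of the same arity, and it obeys the identities that
  both components obey. The inverse of \<open>enc\<close> recovers the components from the name of a symbol.\<close>

definition meet_variety ::
  "('f trm \<times> 'g trm \<Rightarrow> 'h) \<Rightarrow> 'f variety \<Rightarrow> 'g variety \<Rightarrow> 'h variety" where
  "meet_variety enc V W =
     \<lparr>signature = meet_signature enc V W,
      identities = {(p, q). p \<in> terms_over (meet_signature enc V W) \<and> q \<in> terms_over (meet_signature enc V W) \<and>
        (first_component enc p, first_component enc q) \<in> free_cong V \<and>
        (second_component enc p, second_component enc q) \<in> free_cong W}\<rparr>"

lemma meet_variety_varieties: "meet_variety enc V W \<in> varieties"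
  by (auto simp: varieties_def meet_variety_def)

lemma meet_cong:
  assumes "p \<in> terms_over (signature (meet_variety enc V W))" "q \<in> terms_over (signature (meet_variety enc V W))"
    and "(first_component enc p, first_component enc q) \<in> free_cong V"
    and "(second_component enc p, second_component enc q) \<in> free_cong W"
  shows "(p, q) \<in> free_cong (meet_variety enc V W)"
  by (rule free_cong_identity) (use assms in \<open>simp add: meet_variety_def\<close>)

lemma meet_first:
  assumes "inj enc"
  shows "is_interpretation (meet_variety enc V W) V (\<lambda>h n. fst (inv enc h))"
  by (rule is_interpretationI)
    (use assms in \<open>auto simp: meet_variety_def meet_signature_def nary_terms_def\<close>)

lemma meet_second:
  assumes "inj enc"
  shows "is_interpretation (meet_variety enc V W) W (\<lambda>h n. snd (inv enc h))"
  by (rule is_interpretationI)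
    (use assms in \<open>auto simp: meet_variety_def meet_signature_def nary_terms_def\<close>)

lemma meet_greatest:
  assumes V: "V \<in> varieties" and W: "W \<in> varieties" and U: "U \<in> varieties" and enc: "inj enc"
    and UV: "interprets U V" and UW: "interprets U W"
  shows "interprets U (meet_variety enc V W)"
proof -
  obtain K where K: "is_interpretation U V K" using UV interprets_iff[OF U V] by blast
  obtain L where L: "is_interpretation U W L" using UW interprets_iff[OF U W] by blast
  let ?M = "meet_variety enc V W"
  let ?C = "\<lambda>f n. App (enc (K f n, L f n)) (map Var [0..<n])"
  have sym: "(enc (K f n, L f n), n) \<in> signature ?M" if "(f, n) \<in> signature U" for f n
    using is_interpretationD[OF K that] is_interpretationD[OF L that]
    by (auto simp: meet_variety_def meet_signature_def nary_terms_def)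
  have C: "?C f n \<in> terms_over (signature ?M) \<and> vars_of (?C f n) \<subseteq> {..<n}" if "(f, n) \<in> signature U" for f n
    using sym[OF that] by auto
  have derived_eq: "(\<lambda>f xs. eval App ((!) xs) (N f (length xs))) = derived App N" for N
    by (auto simp: derived_def fun_eq_iff)
  have first: "first_component enc (translate ?C s) = translate K s"
    if s: "s \<in> terms_over (signature U)" for s
    using symbol_term_translate[OF s, of ?C "\<lambda>f n. enc (K f n, L f n)" "derived App (\<lambda>h n. fst (inv enc h))" Var]
    by (simp add: derived_def[of _ _ "enc _"] enc derived_eq)
  have second: "second_component enc (translate ?C s) = translate L s"
    if s: "s \<in> terms_over (signature U)" for s
    using symbol_term_translate[OF s, of ?C "\<lambda>f n. enc (K f n, L f n)" "derived App (\<lambda>h n. snd (inv enc h))" Var]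
    by (simp add: derived_def[of _ _ "enc _"] enc derived_eq)
  have "is_interpretation U ?M ?C"
  proof (rule is_interpretationI)
    fix s t assume st: "(s, t) \<in> identities U"
    then have ts: "s \<in> terms_over (signature U)" "t \<in> terms_over (signature U)"
      using U by (auto simp: varieties_def)
    show "(translate ?C s, translate ?C t) \<in> free_cong ?M"
    proof (rule meet_cong)
      show "translate ?C s \<in> terms_over (signature ?M)" "translate ?C t \<in> terms_over (signature ?M)"
        using translate_closed[of _ "signature U" ?C] ts C by blast+
      show "(first_component enc (translate ?C s), first_component enc (translate ?C t)) \<in> free_cong V"
        unfolding first[OF ts(1)] first[OF ts(2)]
        by (rule free_cong_translate[OF U V K free_cong_identity[OF st]])
      show "(second_component enc (translate ?C s), second_component enc (translate ?C t)) \<in> free_cong W"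
        unfolding second[OF ts(1)] second[OF ts(2)]
        by (rule free_cong_translate[OF U W L free_cong_identity[OF st]])
    qed
  qed (use C in blast)+
  then show ?thesis by (rule interpretation_clone_hom[OF U meet_variety_varieties])
qed

text \<open>If a selector of \<open>U\<close> depends only on the interpretation in \<open>V\<close>, and each idempotent term of
  \<open>V\<close> lifts to \<open>U\<close>, then it factors through \<open>V\<close>.\<close>

lemma selector_pullback:
  fixes U :: "'g variety" and V :: "'f variety"
  assumes U: "U \<in> varieties" and V: "V \<in> varieties" and sel: "selector U \<phi>" and D: "is_interpretation U V D"
    and C: "\<And>t. t \<in> idempotent_terms V \<Longrightarrow> C t \<in> idempotent_terms U \<and> (translate D (C t), t) \<in> free_cong V"
    and dep: "\<And>X Y. X \<in> idempotent_terms U \<Longrightarrow> Y \<in> idempotent_terms U \<Longrightarrow>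
      (translate D X, translate D Y) \<in> free_cong V \<Longrightarrow> \<phi> X = \<phi> Y"
  shows "selector V (\<lambda>t. \<phi> (C t))"
  unfolding selector_def
proof (intro conjI allI ballI impI)
  fix x
  have "\<phi> (C (Var x)) = \<phi> (Var x)" by (rule dep) (use C[of "Var x"] in auto)
  then show "\<phi> (C (Var x)) = x" using selector_Var[OF sel] by simp
next
  fix s t assume st: "s \<in> idempotent_terms V" "t \<in> idempotent_terms V" "(s, t) \<in> free_cong V"
  have "(translate D (C s), t) \<in> free_cong V"
    using C[OF st(1)] st(3) by (blast intro: free_cong.trans)
  moreover have "(t, translate D (C t)) \<in> free_cong V" using C[OF st(2)] by (blast intro: free_cong.sym)
  ultimately show "\<phi> (C s) = \<phi> (C t)" using C st by (blast intro: dep free_cong.trans)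
next
  fix t and \<sigma> :: "nat \<Rightarrow> 'f trm" assume t: "t \<in> idempotent_terms V" and \<sigma>: "\<forall>x. \<sigma> x \<in> idempotent_terms V"
  let ?X = "eval App (\<lambda>i. C (\<sigma> i)) (C t)"
  have C\<sigma>: "C (\<sigma> x) \<in> idempotent_terms U" "(translate D (C (\<sigma> x)), \<sigma> x) \<in> free_cong V" for x
    using C[of "\<sigma> x"] \<sigma> by blast+
  have X: "?X \<in> idempotent_terms U" by (rule subst_idempotent) (use C[OF t] C\<sigma> in blast)+
  have "translate D ?X = eval App (\<lambda>i. translate D (C (\<sigma> i))) (translate D (C t))"
    by (rule translate_subst[OF idempotent_termsD(1)[of "C t" U] is_interpretationD(2)[OF D]])
      (use C[OF t] in blast)+
  moreover have "(\<dots>, eval App (\<lambda>i. translate D (C (\<sigma> i))) t) \<in> free_cong V"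
  proof (rule free_cong_subst[OF V])
    show "(translate D (C t), t) \<in> free_cong V" using C[OF t] by blast
    show "translate D (C (\<sigma> x)) \<in> terms_over (signature V)" for x
      using C\<sigma>(2)[of x] free_cong_terms[OF V] by blast
  qed
  moreover have "(eval App (\<lambda>i. translate D (C (\<sigma> i))) t, eval App \<sigma> t) \<in> free_cong V"
    by (rule free_cong_subst_args[OF idempotent_termsD(1)[OF t] C\<sigma>(2)])
  ultimately have tr: "(translate D ?X, eval App \<sigma> t) \<in> free_cong V"
    by (auto intro: free_cong.trans)
  have st: "eval App \<sigma> t \<in> idempotent_terms V" by (rule subst_idempotent[OF t]) (use \<sigma> in blast)
  have "\<phi> (C (eval App \<sigma> t)) = \<phi> ?X"
  proof (rule dep[OF _ X])
    show "C (eval App \<sigma> t) \<in> idempotent_terms U" using C[OF st] by blast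
    show "(translate D (C (eval App \<sigma> t)), translate D ?X) \<in> free_cong V"
      using C[OF st] free_cong.sym[OF tr] by (auto intro: free_cong.trans)
  qed
  also have "\<dots> = \<phi> (C (\<sigma> (\<phi> (C t))))"
    by (rule selector_substD[OF sel]) (use C[OF t] C\<sigma> in blast)+
  finally show "\<phi> (C (eval App \<sigma> t)) = \<phi> (C (\<sigma> (\<phi> (C t))))" .
qed

lemma meet_idempotent:
  assumes enc: "inj enc" and X: "X \<in> terms_over (signature (meet_variety enc V W))"
    and "first_component enc X \<in> idempotent_terms V" "second_component enc X \<in> idempotent_terms W"
  shows "X \<in> idempotent_terms (meet_variety enc V W)"
proof -
  note D1 = is_interpretationD(2)[OF meet_first[OF enc]] and D2 = is_interpretationD(2)[OF meet_second[OF enc]]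
  have "(eval App (\<lambda>_. Var 0) X, Var 0) \<in> free_cong (meet_variety enc V W)"
  proof (rule meet_cong)
    show "(first_component enc (eval App (\<lambda>_. Var 0) X), first_component enc (Var 0)) \<in> free_cong V"
      using translate_subst[OF X D1, where \<tau> = "\<lambda>_. Var 0"] idempotent_termsD(2)[OF assms(3)] by simp
    show "(second_component enc (eval App (\<lambda>_. Var 0) X), second_component enc (Var 0)) \<in> free_cong W"
      using translate_subst[OF X D2, where \<tau> = "\<lambda>_. Var 0"] idempotent_termsD(2)[OF assms(4)] by simp
  qed (use X in \<open>auto intro!: subst_closed\<close>)
  then show ?thesis using X by (simp add: idempotent_terms_def)
qed

lemma subst_symbol_vars:
  assumes "vars_of t \<subseteq> {..<n}"
  shows "eval App ((!) (map Var [0..<n])) t = t"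
proof -
  have "eval App ((!) (map Var [0..<n])) t = eval App Var t"
    by (rule eval_cong_vars) (use assms in auto)
  then show ?thesis by simp
qed

text \<open>Let \<open>b\<close> be the binary symbol with components \<open>x\<^sub>0\<close> and \<open>x\<^sub>1\<close>. The components of \<open>b(X, Y)\<close>
  are the first one of \<open>X\<close> and the second one of \<open>Y\<close>. Suppose that the selector picks \<open>x\<^sub>0\<close> in \<open>b\<close>;
  then it has the same value on \<open>X\<close> and on \<open>b(X, Y)\<close>, and the latter equals \<open>Y\<close> if \<open>X\<close> and \<open>Y\<close> have
  the same first component. So it depends on first components only.\<close>

lemma selector_meet:
  assumes V: "V \<in> varieties" and W: "W \<in> varieties" and enc: "inj enc"
    and sel: "selector (meet_variety enc V W) \<phi>"
  shows "(\<exists>\<psi>. selector V \<psi>) \<or> (\<exists>\<psi>. selector W \<psi>)"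
proof -
  let ?U = "meet_variety enc V W"
  let ?tr1 = "first_component enc" and ?tr2 = "second_component enc"
  \<comment> \<open>The name of the pair of the two binary projections.\<close>
  define b where "b = enc (Var 0, Var 1)"
  have tr_b: "?tr1 (App b [X, Y]) = ?tr1 X" "?tr2 (App b [X, Y]) = ?tr2 Y" for X Y
    unfolding eval_derived_App using enc by (auto simp: b_def)
  have b_sig: "(b, 2) \<in> signature ?U"
    by (force simp: meet_variety_def meet_signature_def b_def nary_terms_def)
  have b_id: "App b [Var 0, Var 1] \<in> idempotent_terms ?U"
  proof (rule meet_idempotent[OF enc])
    show "App b [Var 0, Var 1] \<in> terms_over (signature ?U)" using b_sig by (simp add: numeral_2_eq_2)
  qed (unfold tr_b, simp_all)
  have b_XY: "App b [X, Y] \<in> idempotent_terms ?U \<and>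
      \<phi> (App b [X, Y]) = \<phi> (if \<phi> (App b [Var 0, Var 1]) = 0 then X else Y)"
    if XY: "X \<in> idempotent_terms ?U" "Y \<in> idempotent_terms ?U" for X Y
  proof -
    let ?\<sigma> = "\<lambda>i :: nat. if i = 0 then X else Y"
    have "App b [X, Y] = eval App ?\<sigma> (App b [Var 0, Var 1])" by simp
    moreover have "eval App ?\<sigma> (App b [Var 0, Var 1]) \<in> idempotent_terms ?U"
      by (rule subst_idempotent[OF b_id]) (use XY in simp)
    moreover have "\<phi> (eval App ?\<sigma> (App b [Var 0, Var 1])) = \<phi> (?\<sigma> (\<phi> (App b [Var 0, Var 1])))"
      by (rule selector_substD[OF sel b_id]) (use XY in simp)
    ultimately show ?thesis by simp
  qed
  have refl: "(?tr1 X, ?tr1 X) \<in> free_cong V" "(?tr2 X, ?tr2 X) \<in> free_cong W"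
    if "X \<in> idempotent_terms ?U" for X
    using free_cong_translate[OF meet_variety_varieties V meet_first[OF enc] free_cong.refl]
      free_cong_translate[OF meet_variety_varieties W meet_second[OF enc] free_cong.refl]
      idempotent_termsD(1)[OF that] by blast+
  show ?thesis
  proof (cases "\<phi> (App b [Var 0, Var 1]) = 0")
    case True
    define C where "C t = App (enc (t, Var 0)) (map Var [0..<arity_bound t])" for t
    have "selector V (\<lambda>t. \<phi> (C t))"
    proof (rule selector_pullback[OF meet_variety_varieties V sel meet_first[OF enc]])
      fix t assume t: "t \<in> idempotent_terms V"
      have tr: "?tr1 (C t) = t" "?tr2 (C t) = Var 0"
        unfolding C_def eval_derived_App using enc subst_symbol_vars[OF vars_of_arity_bound[of t]]
        by (auto simp: comp_def arity_bound_def simp del: upt_Suc)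
      have "C t \<in> terms_over (signature ?U)"
        using idempotent_termsD(1)[OF t] vars_of_arity_bound[of t]
        by (force simp: C_def meet_variety_def meet_signature_def nary_terms_def arity_bound_def)
      then show "C t \<in> idempotent_terms ?U \<and> (?tr1 (C t), t) \<in> free_cong V"
        using t idempotent_termsD(1)[OF t] by (auto simp: tr intro: meet_idempotent[OF enc] free_cong.refl)
    next
      fix X Y assume XY: "X \<in> idempotent_terms ?U" "Y \<in> idempotent_terms ?U" "(?tr1 X, ?tr1 Y) \<in> free_cong V"
      have "(App b [X, Y], Y) \<in> free_cong ?U"
        using XY(3) refl(2)[OF XY(2)] conjunct1[OF b_XY[OF XY(1,2)]] XY(1,2)
        by (intro meet_cong idempotent_termsD(1)) (simp_all only: tr_b)
      then have "\<phi> (App b [X, Y]) = \<phi> Y" using selector_cong[OF sel] b_XY XY by blast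
      then show "\<phi> X = \<phi> Y" using b_XY[OF XY(1,2)] True by simp
    qed
    then show ?thesis by blast
  next
    case False
    define C where "C t = App (enc (Var 0, t)) (map Var [0..<arity_bound t])" for t
    have "selector W (\<lambda>t. \<phi> (C t))"
    proof (rule selector_pullback[OF meet_variety_varieties W sel meet_second[OF enc]])
      fix t assume t: "t \<in> idempotent_terms W"
      have tr: "?tr2 (C t) = t" "?tr1 (C t) = Var 0"
        unfolding C_def eval_derived_App using enc subst_symbol_vars[OF vars_of_arity_bound[of t]]
        by (auto simp: comp_def arity_bound_def simp del: upt_Suc)
      have "C t \<in> terms_over (signature ?U)"
        using idempotent_termsD(1)[OF t] vars_of_arity_bound[of t]
        by (force simp: C_def meet_variety_def meet_signature_def nary_terms_def arity_bound_def)
      then show "C t \<in> idempotent_terms ?U \<and> (?tr2 (C t), t) \<in> free_cong W"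
        using t idempotent_termsD(1)[OF t] by (auto simp: tr intro: meet_idempotent[OF enc] free_cong.refl)
    next
      fix X Y assume XY: "X \<in> idempotent_terms ?U" "Y \<in> idempotent_terms ?U" "(?tr2 X, ?tr2 Y) \<in> free_cong W"
      have "(App b [X, Y], X) \<in> free_cong ?U"
        using free_cong.sym[OF XY(3)] refl(1)[OF XY(1)] conjunct1[OF b_XY[OF XY(1,2)]] XY(1,2)
        by (intro meet_cong idempotent_termsD(1)) (simp_all only: tr_b)
      then have "\<phi> (App b [X, Y]) = \<phi> X" using selector_cong[OF sel] b_XY XY by blast
      then show "\<phi> X = \<phi> Y" using b_XY[OF XY(1,2)] False by simp
    qed
    then show ?thesis by blast
  qed
qed

section \<open>Trees modulo a variety\<close>

primrec tval :: "('f \<Rightarrow> 'a list \<Rightarrow> 'a) \<Rightarrow> ('v \<Rightarrow> 'a) \<Rightarrow> ('f, 'v) tree \<Rightarrow> 'a" where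
  "tval I \<rho> (Leaf v) = \<rho> v"
| "tval I \<rho> (Node f Ps) = I f (map (tval I \<rho>) Ps)"

abbreviation graft :: "('v \<Rightarrow> ('f, 'w) tree) \<Rightarrow> ('f, 'v) tree \<Rightarrow> ('f, 'w) tree" where
  "graft \<equiv> tval Node"

definition name_leaves :: "('v \<Rightarrow> nat) \<Rightarrow> ('f, 'v) tree \<Rightarrow> 'f trm" where
  "name_leaves k = tval App (\<lambda>v. Var (k v))"

primrec tree_over :: "('f \<times> nat) set \<Rightarrow> ('f, 'v) tree \<Rightarrow> bool" where
  "tree_over S (Leaf v) = True"
| "tree_over S (Node f Ps) = ((f, length Ps) \<in> S \<and> list_all (\<lambda>b. b) (map (tree_over S) Ps))"

lemma tree_over_Node [simp]:
  "tree_over S (Node f Ps) \<longleftrightarrow> (f, length Ps) \<in> S \<and> (\<forall>P \<in> set Ps. tree_over S P)"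
  by (auto simp: list_all_iff)

declare tree_over.simps(2) [simp del]

lemma tval_cong: "(\<And>v. v \<in> leaves P \<Longrightarrow> \<rho> v = \<rho>' v) \<Longrightarrow> tval I \<rho> P = tval I \<rho>' P"
proof (induction P)
  case (Node f Ps)
  then have "tval I \<rho> P = tval I \<rho>' P" if "P \<in> set Ps" for P using that by fastforce
  then show ?case by (simp cong: map_cong)
qed auto

lemma tval_graft: "tval I \<rho> (graft \<sigma> P) = tval I (\<lambda>v. tval I \<rho> (\<sigma> v)) P"
  by (induction P) (auto simp: comp_def intro!: arg_cong[of _ _ "I _"])

lemma tval_relabel: "tval I \<rho> (relabel g P) = tval I (\<lambda>v. \<rho> (g v)) P"
  by (induction P) (auto simp: comp_def intro!: arg_cong[of _ _ "I _"])

lemma relabel_graft: "relabel g P = graft (\<lambda>v. Leaf (g v)) P"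
  by (induction P) auto

lemma tval_eval: "tval I \<rho> (eval Node \<sigma> t) = eval I (\<lambda>x. tval I \<rho> (\<sigma> x)) t"
  by (induction t) (auto simp: comp_def intro!: arg_cong[of _ _ "I _"])

lemma eval_tval: "eval I \<rho> (tval App \<tau> P) = tval I (\<lambda>v. eval I \<rho> (\<tau> v)) P"
  by (induction P) (auto simp: comp_def intro!: arg_cong[of _ _ "I _"])

lemma graft_Leaf [simp]: "graft Leaf P = P"
  by (induction P) (auto intro: map_idI)

lemma finite_leaves [simp]: "finite (leaves P)"
  by (induction P) auto

lemma leaves_relabel [simp]: "leaves (relabel g P) = g ` leaves P"
  by (rule tree.set_map)

lemma tree_over_graft:
  "tree_over S P \<Longrightarrow> (\<And>v. v \<in> leaves P \<Longrightarrow> tree_over S (\<sigma> v)) \<Longrightarrow> tree_over S (graft \<sigma> P)"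
  by (induction P) auto

lemma tree_over_relabel [simp]: "tree_over S (relabel g P) \<longleftrightarrow> tree_over S P"
  by (induction P) auto

lemma name_leaves_simps [simp]:
  "name_leaves k (Leaf v) = Var (k v)"
  "name_leaves k (Node f Ps) = App f (map (name_leaves k) Ps)"
  by (auto simp: name_leaves_def)

lemma name_leaves_over: "tree_over S P \<Longrightarrow> name_leaves k P \<in> terms_over S"
  by (induction P) auto

lemma vars_of_name_leaves: "vars_of (name_leaves k P) = k ` leaves P"
  by (induction P) auto

lemma name_leaves_relabel: "name_leaves k (relabel g P) = name_leaves (\<lambda>v. k (g v)) P"
  by (simp add: name_leaves_def tval_relabel)

lemma name_leaves_graft: "name_leaves k (graft \<sigma> P) = tval App (\<lambda>v. name_leaves k (\<sigma> v)) P"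
  by (simp add: name_leaves_def tval_graft)

lemma subst_name_leaves: "eval App \<sigma> (name_leaves k P) = tval App (\<lambda>v. \<sigma> (k v)) P"
  by (simp add: name_leaves_def eval_tval)

lemma name_leaves_eval: "name_leaves k (eval Node \<sigma> t) = eval App (\<lambda>x. name_leaves k (\<sigma> x)) t"
  by (simp add: name_leaves_def tval_eval)

lemma tval_free_cong:
  assumes "tree_over (signature V) P" "\<And>v. v \<in> leaves P \<Longrightarrow> (\<rho> v, \<rho>' v) \<in> free_cong V"
  shows "(tval App \<rho> P, tval App \<rho>' P) \<in> free_cong V"
  using assms
proof (induction P)
  case (Node f Ps)
  have "list_all2 (\<lambda>s t. (s, t) \<in> free_cong V) (map (tval App \<rho>) Ps) (map (tval App \<rho>') Ps)"
    unfolding list.rel_map by (rule list.rel_refl_strong) (use Node in auto)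
  then show ?case using Node.prems by (auto intro: free_cong.cong)
qed auto

text \<open>Equality in the free algebra of \<open>V\<close> generated by the leaves. A tree has finitely many leaves, so some
  naming \<open>k\<close> of the leaves by variables is injective on them; the other namings are substitution
  instances. Quantifying over all namings avoids the choice of one and makes congruence properties
  immediate.\<close>

definition tree_eqv :: "'f variety \<Rightarrow> ('f, 'v) tree \<Rightarrow> ('f, 'v) tree \<Rightarrow> bool" where
  "tree_eqv V P Q \<longleftrightarrow> (\<forall>k. (name_leaves k P, name_leaves k Q) \<in> free_cong V)"

lemma tree_eqv_refl: "tree_over (signature V) P \<Longrightarrow> tree_eqv V P P"
  by (auto simp: tree_eqv_def intro: free_cong.refl name_leaves_over)

lemma tree_eqv_sym: "tree_eqv V P Q \<Longrightarrow> tree_eqv V Q P"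
  by (auto simp: tree_eqv_def intro: free_cong.sym)

lemma tree_eqv_trans: "tree_eqv V P Q \<Longrightarrow> tree_eqv V Q R \<Longrightarrow> tree_eqv V P R"
  unfolding tree_eqv_def by (blast intro: free_cong.trans)

lemma tree_eqv_Node:
  assumes "(f, length Ps) \<in> signature V" "list_all2 (tree_eqv V) Ps Qs"
  shows "tree_eqv V (Node f Ps) (Node f Qs)"
  unfolding tree_eqv_def
proof
  fix k
  have "list_all2 (\<lambda>s t. (s, t) \<in> free_cong V) (map (name_leaves k) Ps) (map (name_leaves k) Qs)"
    using assms(2) by (auto simp: list_all2_conv_all_nth tree_eqv_def)
  then show "(name_leaves k (Node f Ps), name_leaves k (Node f Qs)) \<in> free_cong V"
    using assms(1) by (auto intro: free_cong.cong)
qed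

lemma tree_eqv_relabel: "tree_eqv V P Q \<Longrightarrow> tree_eqv V (relabel g P) (relabel g Q)"
  by (simp add: tree_eqv_def name_leaves_relabel)

lemma tree_eqv_graft:
  assumes "tree_over (signature V) P" "\<And>v. v \<in> leaves P \<Longrightarrow> tree_eqv V (\<sigma> v) (\<tau> v)"
  shows "tree_eqv V (graft \<sigma> P) (graft \<tau> P)"
  using assms unfolding tree_eqv_def name_leaves_graft by (blast intro: tval_free_cong)

lemma tree_eqv_identity:
  assumes "(s, t) \<in> identities V" "\<And>x. tree_over (signature V) (\<sigma> x)"
  shows "tree_eqv V (eval Node \<sigma> s) (eval Node \<sigma> t)"
  unfolding tree_eqv_def name_leaves_eval
  using assms by (auto intro!: free_cong.inst name_leaves_over)

section \<open>Picking a leaf\<close>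

locale variety_with_selector =
  fixes V :: "'f variety" and \<phi> :: "'f trm \<Rightarrow> nat"
  assumes V: "V \<in> varieties" and sel: "selector V \<phi>"
begin

abbreviation good :: "('f, 'v) tree \<Rightarrow> bool" where
  "good \<equiv> tree_over (signature V)"

abbreviation eqv :: "('f, 'v) tree \<Rightarrow> ('f, 'v) tree \<Rightarrow> bool" where
  "eqv \<equiv> tree_eqv V"

definition idem :: "('f, 'v) tree \<Rightarrow> bool" where
  "idem P \<longleftrightarrow> good P \<and> (name_leaves (\<lambda>_. 0) P, Var 0) \<in> free_cong V"

text \<open>The selector transferred from variables to arbitrary leaves: the leaf whose name is selected under
  every naming.\<close>

definition pick :: "('f, 'v) tree \<Rightarrow> 'v" where
  "pick P = (SOME v. \<forall>k. \<phi> (name_leaves k P) = k v)"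

lemma name_leaves_idem:
  assumes "idem P"
  shows "name_leaves k P \<in> idempotent_terms V"
proof -
  have "eval App (\<lambda>_. Var 0) (name_leaves k P) = name_leaves (\<lambda>_. 0) P"
    unfolding subst_name_leaves by (simp add: name_leaves_def)
  then show ?thesis using assms by (simp add: idem_def idempotent_terms_def name_leaves_over)
qed

text \<open>A naming that is injective on the leaves determines the leaf, and each other naming is obtained
  from it by a substitution, with which the selector is compatible.\<close>

lemma pick_name:
  assumes P: "idem P"
  shows "\<phi> (name_leaves k P) = k (pick P)"
proof -
  obtain c where c: "inj_on (c :: _ \<Rightarrow> nat) (leaves P)"
    using finite_imp_inj_to_nat_seg[of "leaves P"] by auto
  have "\<phi> (name_leaves c P) \<in> c ` leaves P"
    using selector_in_vars[OF sel name_leaves_idem[OF P]] by (simp add: vars_of_name_leaves)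
  then obtain v where v: "v \<in> leaves P" "\<phi> (name_leaves c P) = c v" by auto
  have "\<phi> (name_leaves k P) = k v" for k
  proof -
    let ?\<sigma> = "\<lambda>i. Var (k (inv_into (leaves P) c i)) :: 'f trm"
    have "name_leaves k P = eval App ?\<sigma> (name_leaves c P)"
      unfolding subst_name_leaves unfolding name_leaves_def
      by (rule tval_cong) (simp add: inv_into_f_f[OF c])
    also have "\<phi> \<dots> = \<phi> (?\<sigma> (\<phi> (name_leaves c P)))"
      by (rule selector_substD[OF sel name_leaves_idem[OF P]]) simp
    also have "\<dots> = k v" using v selector_Var[OF sel] by (simp add: inv_into_f_f[OF c])
    finally show ?thesis .
  qed
  then have "\<exists>v. \<forall>k. \<phi> (name_leaves k P) = k v" by blast
  then show ?thesis unfolding pick_def by (rule someI2_ex) blast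
qed

lemma pick_eqI:
  assumes "idem P" "\<And>k. \<phi> (name_leaves k P) = k v"
  shows "pick P = v"
proof -
  have "(if pick P = v then 0 else 1 :: nat) = (if v = v then 0 else 1)"
    using pick_name[OF assms(1), of "\<lambda>u. if u = v then 0 else 1"] assms(2)[of "\<lambda>u. if u = v then 0 else 1"]
    by simp
  then show ?thesis by (simp split: if_splits)
qed

lemma pick_in_leaves:
  assumes "idem P"
  shows "pick P \<in> leaves P"
proof -
  let ?k = "\<lambda>v. if v \<in> leaves P then 0 else 1 :: nat"
  have "?k (pick P) \<in> vars_of (name_leaves ?k P)"
    using selector_in_vars[OF sel name_leaves_idem[OF assms], of ?k] pick_name[OF assms, of ?k] by simp
  then show ?thesis by (auto simp: vars_of_name_leaves split: if_splits)
qed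

lemma idem_Leaf [simp]: "idem (Leaf v)"
  by (auto simp: idem_def intro: free_cong.refl)

lemma pick_Leaf [simp]: "pick (Leaf v) = v"
  by (rule pick_eqI) (auto simp: selector_Var[OF sel])

lemma idem_relabel [simp]: "idem (relabel g P) \<longleftrightarrow> idem P"
  by (simp add: idem_def name_leaves_relabel)

lemma pick_relabel: "idem P \<Longrightarrow> pick (relabel g P) = g (pick P)"
  by (rule pick_eqI) (auto simp: name_leaves_relabel pick_name)

lemma pick_eqv:
  assumes P: "idem P" and Q: "idem Q" and "eqv P Q"
  shows "pick P = pick Q"
proof (rule pick_eqI[OF P])
  fix k
  have "(name_leaves k P, name_leaves k Q) \<in> free_cong V"
    using assms(3) by (simp add: tree_eqv_def)
  then have "\<phi> (name_leaves k P) = \<phi> (name_leaves k Q)"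
    by (rule selector_cong[OF sel name_leaves_idem[OF P] name_leaves_idem[OF Q]])
  then show "\<phi> (name_leaves k P) = k (pick Q)" using pick_name[OF Q] by simp
qed

lemma idem_graft:
  assumes P: "good P" and \<sigma>: "\<And>v. idem (\<sigma> v)"
  shows "idem (graft \<sigma> P) \<longleftrightarrow> idem P"
proof -
  have "(name_leaves (\<lambda>_. 0) (graft \<sigma> P), name_leaves (\<lambda>_. 0) P) \<in> free_cong V"
  proof -
    have "name_leaves (\<lambda>_. 0) P = tval App (\<lambda>_. Var 0) P" by (simp add: name_leaves_def)
    then show ?thesis
      unfolding name_leaves_graft using tval_free_cong[OF P] \<sigma> by (simp add: idem_def)
  qed
  moreover have "good (graft \<sigma> P)"
    using P \<sigma> by (auto simp: idem_def intro: tree_over_graft)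
  ultimately show ?thesis
    using P unfolding idem_def by (blast intro: free_cong.trans free_cong.sym)
qed

lemma pick_graft:
  assumes P: "idem P" and \<sigma>: "\<And>v. idem (\<sigma> v)"
  shows "pick (graft \<sigma> P) = pick (\<sigma> (pick P))"
proof (rule pick_eqI)
  show "idem (graft \<sigma> P)" using idem_graft[of P \<sigma>] assms by (simp add: idem_def)
  fix k
  obtain c where c: "inj_on (c :: _ \<Rightarrow> nat) (leaves P)"
    using finite_imp_inj_to_nat_seg[of "leaves P"] by auto
  let ?\<sigma> = "\<lambda>i. name_leaves k (\<sigma> (inv_into (leaves P) c i))"
  have "name_leaves k (graft \<sigma> P) = eval App ?\<sigma> (name_leaves c P)"
    unfolding subst_name_leaves name_leaves_graft
    by (rule tval_cong) (simp add: inv_into_f_f[OF c])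
  also have "\<phi> \<dots> = \<phi> (?\<sigma> (\<phi> (name_leaves c P)))"
    by (rule selector_substD[OF sel name_leaves_idem[OF P]]) (rule name_leaves_idem[OF \<sigma>])
  also have "\<dots> = \<phi> (name_leaves k (\<sigma> (pick P)))"
    using pick_name[OF P, of c] pick_in_leaves[OF P] by (simp add: inv_into_f_f[OF c])
  also have "\<dots> = k (pick (\<sigma> (pick P)))" by (rule pick_name[OF \<sigma>])
  finally show "\<phi> (name_leaves k (graft \<sigma> P)) = k (pick (\<sigma> (pick P)))" .
qed

section \<open>A congruence that keeps the fibres over the generators\<close>

abbreviation base :: "('f, 'y \<times> 'e) tree \<Rightarrow> ('f, 'y) tree" where
  "base \<equiv> relabel fst"

text \<open>A context is a tree with an additional leaf \<open>None\<close>, the hole, which may occur any number of times.\<close>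

definition plug :: "('f, 'v option) tree \<Rightarrow> ('f, 'v) tree \<Rightarrow> ('f, 'v) tree" where
  "plug C P = graft (case_option P Leaf) C"

text \<open>Leaves are pairs of a base point \<open>y\<close> and an element of the fibre over \<open>y\<close>. Two trees are
  identified if they have the same image over the base points and if no context can distinguish them: as
  soon as a context moves them over a generator, the same leaf is picked. Quantifying over contexts makes
  this a congruence; the empty context shows that distinct leaves are not identified.\<close>

definition sim :: "('f, 'y \<times> 'e) tree \<Rightarrow> ('f, 'y \<times> 'e) tree \<Rightarrow> bool" where
  "sim P Q \<longleftrightarrow> eqv (base P) (base Q) \<and>
     (\<forall>C b. good C \<longrightarrow> eqv (base (plug C P)) (Leaf b) \<longrightarrow> pick (plug C P) = pick (plug C Q))"

lemma good_plug: "good C \<Longrightarrow> good P \<Longrightarrow> good (plug C P)"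
  unfolding plug_def by (rule tree_over_graft) (auto split: option.split)

lemma base_plug: "base (plug C P) = graft (case_option (base P) (\<lambda>e. Leaf (fst e))) C"
  unfolding plug_def relabel_graft tval_graft
  by (rule tval_cong) (auto split: option.split)

lemma base_plug_eqv:
  assumes "good C" "eqv (base P) (base Q)"
  shows "eqv (base (plug C P)) (base (plug C Q))"
  unfolding base_plug
  by (rule tree_eqv_graft[OF assms(1)]) (use assms(2) in \<open>auto split: option.split intro: tree_eqv_refl\<close>)

lemma sim_base: "sim P Q \<Longrightarrow> eqv (base P) (base Q)"
  by (simp add: sim_def)

lemma sim_refl: "good P \<Longrightarrow> sim P P"
  by (simp add: sim_def tree_eqv_refl)

lemma sim_sym:
  assumes "sim P Q"
  shows "sim Q P"
proof -
  have "pick (plug C Q) = pick (plug C P)" if C: "good C" and b: "eqv (base (plug C Q)) (Leaf b)" for C b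
  proof -
    have "eqv (base (plug C P)) (Leaf b)"
      by (rule tree_eqv_trans[OF base_plug_eqv[OF C sim_base[OF assms]] b])
    then have "pick (plug C P) = pick (plug C Q)" using assms C unfolding sim_def by blast
    then show ?thesis ..
  qed
  then show ?thesis using tree_eqv_sym[OF sim_base[OF assms]] unfolding sim_def by blast
qed

lemma sim_trans:
  assumes PQ: "sim P Q" and QR: "sim Q R"
  shows "sim P R"
proof -
  have "pick (plug C P) = pick (plug C R)" if C: "good C" and b: "eqv (base (plug C P)) (Leaf b)" for C b
  proof -
    have "eqv (base (plug C Q)) (Leaf b)"
      by (rule tree_eqv_trans[OF base_plug_eqv[OF C tree_eqv_sym[OF sim_base[OF PQ]]] b])
    then have "pick (plug C Q) = pick (plug C R)" using QR C unfolding sim_def by blast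
    moreover have "pick (plug C P) = pick (plug C Q)" using PQ C b unfolding sim_def by blast
    ultimately show ?thesis by simp
  qed
  then show ?thesis
    using tree_eqv_trans[OF sim_base[OF PQ] sim_base[OF QR]] unfolding sim_def by blast
qed

text \<open>A tree whose image is a generator is idempotent, since collapsing all leaves also collapses
  the generator. The picked leaf lies over \<open>b\<close> because picking commutes with the map to base points.\<close>

lemma over_generator:
  assumes P: "good P" and b: "eqv (base P) (Leaf b)"
  shows "idem P" "fst (pick P) = b"
proof -
  have "(name_leaves (\<lambda>_. 0) (base P), name_leaves (\<lambda>_. 0) (Leaf b)) \<in> free_cong V"
    using b unfolding tree_eqv_def by blast
  then show id: "idem P" using P by (simp add: idem_def name_leaves_relabel)
  have "pick (base P) = pick (Leaf b)" by (rule pick_eqv) (use id b in auto)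
  then show "fst (pick P) = b" using pick_relabel[OF id, of fst] by simp
qed

lemma plug_plug: "plug C (plug D P) = plug (graft (case_option D (\<lambda>e. Leaf (Some e))) C) P"
  unfolding plug_def tval_graft by (rule tval_cong) (auto split: option.split)

lemma sim_plug:
  assumes PQ: "sim P Q" and D: "good D"
  shows "sim (plug D P) (plug D Q)"
proof -
  have "pick (plug C (plug D P)) = pick (plug C (plug D Q))"
    if C: "good C" and b: "eqv (base (plug C (plug D P))) (Leaf b)" for C b
  proof -
    have "good (graft (case_option D (\<lambda>e. Leaf (Some e))) C)"
      by (rule tree_over_graft[OF C]) (use D in \<open>auto split: option.split\<close>)
    then show ?thesis using PQ b unfolding sim_def plug_plug by blast
  qed
  then show ?thesis using base_plug_eqv[OF D sim_base[OF PQ]] unfolding sim_def by blast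
qed

lemma plug_Some [simp]: "plug (relabel Some Q) P = Q"
  unfolding plug_def tval_relabel by simp

lemma sim_Node_arg:
  assumes "sim P Q" "(f, Suc (length Xs + length Ys)) \<in> signature V"
    "\<forall>X \<in> set Xs. good X" "\<forall>Y \<in> set Ys. good Y"
  shows "sim (Node f (Xs @ P # Ys)) (Node f (Xs @ Q # Ys))"
proof -
  let ?D = "Node f (map (relabel Some) Xs @ Leaf None # map (relabel Some) Ys)"
  have plug: "plug ?D X = Node f (Xs @ X # Ys)" for X
  proof -
    have "graft (case_option X Leaf) (relabel Some Z) = Z" for Z
      using plug_Some[of Z X] unfolding plug_def .
    then show ?thesis by (simp add: plug_def comp_def)
  qed
  have "sim (plug ?D P) (plug ?D Q)" by (rule sim_plug[OF assms(1)]) (use assms in auto)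
  then show ?thesis unfolding plug .
qed

lemma sim_Node:
  assumes f: "(f, length Ps) \<in> signature V" and PQ: "list_all2 sim Ps Qs"
    and good: "\<forall>P \<in> set Ps. good P" "\<forall>Q \<in> set Qs. good Q"
  shows "sim (Node f Ps) (Node f Qs)"
proof -
  have "sim (Node f (Xs @ Ps)) (Node f (Xs @ Qs))"
    if "(f, length Xs + length Ps) \<in> signature V" "\<forall>X \<in> set Xs. good X" for Xs
    using PQ that good
  proof (induction Ps Qs arbitrary: Xs rule: list_all2_induct)
    case Nil
    then show ?case by (auto intro: sim_refl)
  next
    case (Cons P Ps Q Qs)
    have "sim (Node f (Xs @ P # Ps)) (Node f (Xs @ Q # Ps))"
      by (rule sim_Node_arg[OF Cons.hyps(1)]) (use Cons.prems in auto)
    moreover have "sim (Node f ((Xs @ [Q]) @ Ps)) (Node f ((Xs @ [Q]) @ Qs))"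
      by (rule Cons.IH) (use Cons.prems in auto)
    ultimately show ?case by (auto intro: sim_trans)
  qed
  from this[of "[]"] f show ?thesis by simp
qed

lemma sim_of_eqv:
  assumes P: "good P" and Q: "good Q" and PQ: "eqv P Q"
  shows "sim P Q"
proof -
  have base: "eqv (base P) (base Q)" by (rule tree_eqv_relabel[OF PQ])
  have "pick (plug C P) = pick (plug C Q)" if C: "good C" and b: "eqv (base (plug C P)) (Leaf b)" for C b
  proof (rule pick_eqv)
    show "idem (plug C P)" by (rule over_generator[OF good_plug[OF C P] b])
    show "idem (plug C Q)"
      by (rule over_generator[OF good_plug[OF C Q]
            tree_eqv_trans[OF base_plug_eqv[OF C tree_eqv_sym[OF base]] b]])
    show "eqv (plug C P) (plug C Q)"
      unfolding plug_def
      by (rule tree_eqv_graft[OF C]) (use PQ in \<open>auto split: option.split intro: tree_eqv_refl\<close>)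
  qed
  then show ?thesis using base unfolding sim_def by blast
qed

text \<open>In a context \<open>C\<close>, the leaf picked is either one of \<open>C\<close> itself, whatever fills the hole, or the one picked
  in the tree that fills it. The latter is the same for \<open>P\<close> and for the leaf picked in \<open>P\<close>.\<close>

lemma sim_pick:
  assumes P: "good P" and b: "eqv (base P) (Leaf b)"
  shows "sim P (Leaf (pick P))"
proof -
  note id = over_generator[OF P b]
  have base: "eqv (base P) (base (Leaf (pick P)))" using b id(2) by simp
  have "pick (plug C P) = pick (plug C (Leaf (pick P)))"
    if C: "good C" and b': "eqv (base (plug C P)) (Leaf b')" for C b'
  proof -
    have idem: "idem (case_option X Leaf v)" if "idem X" for X :: "('f, 'a \<times> 'b) tree" and v
      using that by (simp split: option.split)
    have "idem (plug C P)" by (rule over_generator[OF good_plug[OF C P] b'])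
    then have "idem C" unfolding plug_def using idem_graft[OF C idem[OF id(1)]] by simp
    then have "pick (plug C X) = pick (case_option X Leaf (pick C))"
      if "idem X" for X :: "('f, 'a \<times> 'b) tree"
      unfolding plug_def by (rule pick_graft[OF _ idem[OF that]])
    from this[OF id(1)] this[OF idem_Leaf] show ?thesis by (simp split: option.split)
  qed
  then show ?thesis using base unfolding sim_def by blast
qed

text \<open>By this lemma and \<open>sim_pick\<close> the fibre over a generator \<open>b\<close> consists precisely of the leaves
  over \<open>b\<close>.\<close>

lemma sim_over_generator:
  assumes P: "good P" and Q: "good Q" and b: "eqv (base P) (Leaf b)" "eqv (base Q) (Leaf b)"
  shows "sim P Q \<longleftrightarrow> pick P = pick Q"
proof
  assume "sim P Q"
  moreover have "plug (Leaf None) X = X" for X :: "('f, 'a \<times> 'b) tree" by (simp add: plug_def)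
  moreover have "good (Leaf None :: ('f, ('a \<times> 'b) option) tree)" by simp
  ultimately show "pick P = pick Q" using b(1) unfolding sim_def by metis
next
  assume "pick P = pick Q"
  then show "sim P Q" using sim_pick[OF P b(1)] sim_pick[OF Q b(2)] by (auto intro: sim_trans sim_sym)
qed

text \<open>Leaves of \<open>Q\<close> over base points that do not occur in the representation \<open>P\<close> of the same image
  can be replaced by a fixed leaf. For if
  a context sends the image to a generator \<open>b\<close>, then one and the same position is picked before and after
  the replacement, and the leaf in that position lies over \<open>b\<close> both times. A leaf that is moved to another
  base point is therefore never picked.\<close>

lemma sim_finite_support:
  assumes Q: "good Q" and QP: "eqv (base Q) (base P)" and S: "fst ` leaves P \<subseteq> S" "fst e0 \<in> S"
  shows "sim Q (relabel (\<lambda>v. if fst v \<in> S then v else e0) Q)"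
proof -
  let ?\<rho> = "\<lambda>v. if fst v \<in> S then v else e0"
  let ?r = "\<lambda>y. if y \<in> S then y else fst e0"
  have "base (relabel ?\<rho> Q) = relabel ?r (base Q)"
    unfolding tree.map_comp by (rule tree.map_cong0) auto
  moreover have "relabel ?r (base P) = base P"
  proof -
    have "relabel ?r (base P) = relabel (\<lambda>y. y) (base P)"
      by (rule tree.map_cong0) (use S in auto)
    then show ?thesis by (simp add: tree.map_ident)
  qed
  ultimately have "eqv (base (relabel ?\<rho> Q)) (base P)"
    using tree_eqv_relabel[OF QP, of ?r] by simp
  then have base: "eqv (base Q) (base (relabel ?\<rho> Q))"
    using QP by (blast intro: tree_eqv_trans tree_eqv_sym)
  have "pick (plug C Q) = pick (plug C (relabel ?\<rho> Q))"
    if C: "good C" and b: "eqv (base (plug C Q)) (Leaf b)" for C b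
  proof -
    \<comment> \<open>The leaves of the context and those of \<open>Q\<close> are kept apart, so that one tree describes both situations.\<close>
    define W where "W = graft (case_option (relabel Inr Q) (\<lambda>e. Leaf (Inl e))) C"
    have W: "plug C (relabel \<tau> Q) = relabel (case_sum id \<tau>) W" for \<tau> :: "'a \<times> 'b \<Rightarrow> 'a \<times> 'b"
      unfolding plug_def W_def relabel_graft tval_graft
      by (rule tval_cong) (auto simp: tval_graft split: option.split)
    have W0: "plug C Q = relabel (case_sum id id) W" using W[of id] by (simp add: tree.map_id0)
    have idW: "idem W" using over_generator(1)[OF good_plug[OF C Q] b] unfolding W0 by simp
    have "fst (pick (plug C Q)) = b" by (rule over_generator(2)[OF good_plug[OF C Q] b])
    moreover have "fst (pick (plug C (relabel ?\<rho> Q))) = b"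
    proof (rule over_generator(2))
      show "eqv (base (plug C (relabel ?\<rho> Q))) (Leaf b)"
        by (rule tree_eqv_trans[OF base_plug_eqv[OF C tree_eqv_sym[OF base]] b])
    qed (use good_plug[OF C] Q in simp)
    ultimately show ?thesis
      unfolding W W0 pick_relabel[OF idW] using S(2) by (auto split: sum.splits if_splits)
  qed
  then show ?thesis using base unfolding sim_def by blast
qed

end

section \<open>Transport to the universal bundle\<close>

lemma infinite_UNIV_set:
  assumes "infinite (UNIV :: 'a set)"
  shows "infinite (UNIV :: 'a set set)"
proof
  assume "finite (UNIV :: 'a set set)"
  then have "finite (range (\<lambda>x :: 'a. {x}))" by (rule rev_finite_subset) simp
  then have "finite (UNIV :: 'a set)" by (rule finite_imageD) (simp add: inj_on_def)
  then show False using assms by simp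
qed

lemma base_point_embedding:
  assumes inf: "infinite (UNIV :: 'f set)"
  shows "\<exists>j :: 'f base_point \<Rightarrow> 'f set. inj j"
proof -
  obtain p :: "'f \<times> 'f \<Rightarrow> 'f" where p: "inj p" using infinite_pairing[OF inf] by blast
  obtain q :: "'f set \<times> 'f set \<Rightarrow> 'f set" where q: "inj q"
    using infinite_pairing[OF infinite_UNIV_set[OF inf]] by blast
  have "inj (p \<circ> map_prod id p)" using p by (intro inj_compose prod.inj_map) auto
  then have "inj ((`) (p \<circ> map_prod id p))" by (intro injI) (simp only: inj_image_eq_iff)
  then have "inj (q \<circ> map_prod (q \<circ> map_prod id ((`) (p \<circ> map_prod id p))) id)"
    using q by (intro inj_compose prod.inj_map) auto
  then show ?thesis by blast
qed

context variety_with_selector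
begin

definition bundle_trees :: "('f, 'f base_point \<times> 'f) tree set" where
  "bundle_trees = {P. good P \<and> leaves P \<subseteq> bundle_space}"

text \<open>The subalgebra generated by the triples of the fibres over the generators: a tree of such triples \<open>W\<close>
  gives a triple of trees, which is then closed under \<open>sim\<close>.\<close>

definition tree_rel ::
  "('f, 'b base_point \<times> 'b) tree \<Rightarrow> ('f, 'b base_point \<times> 'b) tree \<Rightarrow> ('f, 'b base_point \<times> 'b) tree \<Rightarrow> bool"
  where
  "tree_rel P1 P2 P3 \<longleftrightarrow> (\<exists>W. good W \<and> (\<forall>(y, t) \<in> leaves W. t \<in> snd (fst y)) \<and>
     sim P1 (relabel (\<lambda>(y, a, b, c). (y, a)) W) \<and> sim P2 (relabel (\<lambda>(y, a, b, c). (y, b)) W) \<and>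
     sim P3 (relabel (\<lambda>(y, a, b, c). (y, c)) W))"

lemma tree_rel_sim:
  assumes "tree_rel P1 P2 P3" "sim P1 Q1" "sim P2 Q2" "sim P3 Q3"
  shows "tree_rel Q1 Q2 Q3"
  using assms unfolding tree_rel_def by (blast intro: sim_trans sim_sym)

lemma tree_rel_base:
  assumes "tree_rel P1 P2 P3"
  shows "eqv (base P2) (base P1)" "eqv (base P3) (base P1)"
proof -
  obtain W where W: "sim P1 (relabel (\<lambda>(y, a, b, c). (y, a)) W)"
    "sim P2 (relabel (\<lambda>(y, a, b, c). (y, b)) W)" "sim P3 (relabel (\<lambda>(y, a, b, c). (y, c)) W)"
    using assms unfolding tree_rel_def by blast
  have "base (relabel (\<lambda>(y, a, b, c). (y, a)) W) = relabel fst W"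
    "base (relabel (\<lambda>(y, a, b, c). (y, b)) W) = relabel fst W"
    "base (relabel (\<lambda>(y, a, b, c). (y, c)) W) = relabel fst W"
    unfolding tree.map_comp by (rule tree.map_cong0, auto)+
  with W[THEN sim_base] show "eqv (base P2) (base P1)" "eqv (base P3) (base P1)"
    by (auto intro: tree_eqv_trans tree_eqv_sym)
qed

lemma tree_rel_Node:
  assumes f: "(f, n) \<in> signature V" and len: "length Ps = n" "length Qs = n" "length Rs = n"
    and good: "\<forall>P \<in> set Ps \<union> set Qs \<union> set Rs. good P"
    and rel: "\<And>i. i < n \<Longrightarrow> tree_rel (Ps ! i) (Qs ! i) (Rs ! i)"
  shows "tree_rel (Node f Ps) (Node f Qs) (Node f Rs)"
proof -
  define wit where "wit i W \<longleftrightarrow> good W \<and> (\<forall>(y, t) \<in> leaves W. t \<in> snd (fst y)) \<and>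
     sim (Ps ! i) (relabel (\<lambda>(y, a, b, c). (y, a)) W) \<and> sim (Qs ! i) (relabel (\<lambda>(y, a, b, c). (y, b)) W) \<and>
     sim (Rs ! i) (relabel (\<lambda>(y, a, b, c). (y, c)) W)" for i W
  have "\<forall>i. \<exists>W. i < n \<longrightarrow> wit i W" using rel unfolding tree_rel_def wit_def by blast
  then obtain w where w: "\<And>i. i < n \<Longrightarrow> wit i (w i)" by metis
  let ?W = "Node f (map w [0..<n])"
  have good_w: "good (w i)" if "i < n" for i using w[OF that] by (simp add: wit_def)
  have sim: "sim (Node f Xs) (relabel g ?W)"
    if "length Xs = n" "\<forall>X \<in> set Xs. good X" "\<And>i. i < n \<Longrightarrow> sim (Xs ! i) (relabel g (w i))" for Xs g
    unfolding tree.map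
    by (rule sim_Node) (use that f good_w in \<open>auto simp: list_all2_conv_all_nth\<close>)
  show ?thesis
    unfolding tree_rel_def
  proof (intro exI[of _ ?W] conjI sim)
    show "good ?W" using f good_w by simp
    show "\<forall>(y, t) \<in> leaves ?W. t \<in> snd (fst y)" using w by (fastforce simp: wit_def)
  qed (use len good w in \<open>auto simp: wit_def\<close>)
qed

text \<open>No triples are added over a generator: a tree of triples over \<open>y\<close> picks one of the
  generating triples.\<close>

lemma tree_rel_generator:
  assumes good: "good P1" "good P2" "good P3"
    and y: "eqv (base P1) (Leaf y)" "eqv (base P2) (Leaf y)" "eqv (base P3) (Leaf y)"
  shows "tree_rel P1 P2 P3 \<longleftrightarrow> (snd (pick P1), snd (pick P2), snd (pick P3)) \<in> snd (fst y)"
proof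
  assume "tree_rel P1 P2 P3"
  then obtain W where W: "good W" "\<forall>(y, t) \<in> leaves W. t \<in> snd (fst y)"
    "sim P1 (relabel (\<lambda>(y, a, b, c). (y, a)) W)"
    "sim P2 (relabel (\<lambda>(y, a, b, c). (y, b)) W)" "sim P3 (relabel (\<lambda>(y, a, b, c). (y, c)) W)"
    unfolding tree_rel_def by blast
  have over: "idem W \<and> pick P = g (pick W)"
    if "good P" "eqv (base P) (Leaf y)" "sim P (relabel g W)" for P g
  proof -
    have gW: "good (relabel g W)" using W(1) by simp
    have "eqv (base (relabel g W)) (Leaf y)"
      using sim_base[OF that(3)] that(2) by (blast intro: tree_eqv_trans tree_eqv_sym)
    then have "idem (relabel g W)" "pick P = pick (relabel g W)"
      using over_generator(1)[OF gW] sim_over_generator[OF that(1) gW that(2)] that(3) by blast+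
    then show ?thesis by (simp add: pick_relabel)
  qed
  obtain y' a b c where pW: "pick W = (y', a, b, c)" by (cases "pick W") auto
  have p: "pick P1 = (y', a)" "pick P2 = (y', b)" "pick P3 = (y', c)"
    using over[OF good(1) y(1) W(3)] over[OF good(2) y(2) W(4)] over[OF good(3) y(3) W(5)] pW by auto
  have "y' = y" using over_generator(2)[OF good(1) y(1)] p by simp
  moreover have "pick W \<in> leaves W" using over[OF good(1) y(1) W(3)] pick_in_leaves by blast
  ultimately show "(snd (pick P1), snd (pick P2), snd (pick P3)) \<in> snd (fst y)"
    using W(2) p pW by auto
next
  assume R: "(snd (pick P1), snd (pick P2), snd (pick P3)) \<in> snd (fst y)"
  have leaf: "sim P (Leaf (y, snd (pick P)))" if "good P" "eqv (base P) (Leaf y)" for P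
    using sim_pick[OF that] over_generator(2)[OF that] by (metis prod.collapse)
  show "tree_rel P1 P2 P3"
    unfolding tree_rel_def
    by (rule exI[of _ "Leaf (y, snd (pick P1), snd (pick P2), snd (pick P3))"])
      (use R leaf[OF good(1) y(1)] leaf[OF good(2) y(2)] leaf[OF good(3) y(3)] in simp)
qed

definition fibre :: "('f, 'f base_point) tree \<Rightarrow> ('f, 'f base_point \<times> 'f) tree set" where
  "fibre p = {P \<in> bundle_trees. eqv (base P) p}"

text \<open>An isomorphism \<open>g\<close> from the fibre over \<open>p\<close>, modulo \<open>sim\<close>, to the ternary structure \<open>\<tau>\<close>.\<close>

definition fibre_coordinates ::
  "('f, 'f base_point) tree \<Rightarrow> 'f set \<times> ('f \<times> 'f \<times> 'f) set \<Rightarrow> (('f, 'f base_point \<times> 'f) tree \<Rightarrow> 'f) \<Rightarrow> bool"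
  where
  "fibre_coordinates p \<tau> g \<longleftrightarrow>
     (\<forall>P \<in> fibre p. \<forall>Q \<in> fibre p. g P = g Q \<longleftrightarrow> sim P Q) \<and> g ` fibre p = fst \<tau> \<and>
     (\<forall>P1 \<in> fibre p. \<forall>P2 \<in> fibre p. \<forall>P3 \<in> fibre p.
        tree_rel P1 P2 P3 \<longleftrightarrow> (g P1, g P2, g P3) \<in> snd \<tau>)"

lemma generator_coordinates:
  assumes p: "good p" "eqv p (Leaf y)"
  shows "fibre_coordinates p (fst y) (\<lambda>P. snd (pick P))"
proof -
  have over: "good P" "eqv (base P) (Leaf y)" "leaves P \<subseteq> bundle_space" if "P \<in> fibre p" for P
    using that p(2) by (auto simp: fibre_def bundle_trees_def intro: tree_eqv_trans)
  have fst: "fst (pick P) = y" if "P \<in> fibre p" for P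
    using over_generator(2)[OF over(1,2)[OF that]] .
  have "(snd (pick P) = snd (pick Q)) \<longleftrightarrow> sim P Q" if "P \<in> fibre p" "Q \<in> fibre p" for P Q
    using sim_over_generator[OF over(1)[OF that(1)] over(1)[OF that(2)] over(2)[OF that(1)] over(2)[OF that(2)]]
      fst that by (auto simp: prod_eq_iff)
  moreover have "(\<lambda>P. snd (pick P)) ` fibre p = fst (fst y)"
  proof (intro equalityI subsetI)
    fix e assume "e \<in> (\<lambda>P. snd (pick P)) ` fibre p"
    then obtain P where P: "P \<in> fibre p" "e = snd (pick P)" by blast
    have "pick P \<in> leaves P"
      using pick_in_leaves[OF over_generator(1)[OF over(1,2)[OF P(1)]]] .
    then have "pick P \<in> bundle_space" using over(3)[OF P(1)] by blast
    then show "e \<in> fst (fst y)" using fst[OF P(1)] P(2) by (simp add: bundle_space_def)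
  next
    fix e assume "e \<in> fst (fst y)"
    then have "Leaf (y, e) \<in> fibre p"
      using tree_eqv_sym[OF p(2)] by (simp add: fibre_def bundle_trees_def bundle_space_def)
    then show "e \<in> (\<lambda>P. snd (pick P)) ` fibre p" by force
  qed
  moreover have "tree_rel P1 P2 P3 \<longleftrightarrow> (snd (pick P1), snd (pick P2), snd (pick P3)) \<in> snd (fst y)"
    if "P1 \<in> fibre p" "P2 \<in> fibre p" "P3 \<in> fibre p" for P1 P2 P3
    using that over by (intro tree_rel_generator) auto
  ultimately show ?thesis unfolding fibre_coordinates_def by blast
qed

text \<open>By finite support, each element of the fibre is represented by a tree with leaves over a fixed finite
  set of base points, and there are at most as many such trees as names.\<close>

lemma fibre_embedding:
  assumes inf: "infinite (UNIV :: 'f set)"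
  shows "\<exists>g :: ('f, 'f base_point \<times> 'f) tree \<Rightarrow> 'f. \<forall>P \<in> fibre p. \<forall>Q \<in> fibre p. g P = g Q \<longleftrightarrow> sim P Q"
proof (cases "fibre p = {}")
  case False
  then obtain P0 where P0: "P0 \<in> fibre p" by blast
  \<comment> \<open>An arbitrary replacement leaf, with its base point among those allowed.\<close>
  fix e0 :: "'f base_point \<times> 'f"
  define S where "S = insert (fst e0) (fst ` leaves P0)"
  have "finite S" by (simp add: S_def)
  then obtain c where c: "inj_on (c :: _ \<Rightarrow> nat) S" using finite_imp_inj_to_nat_seg by metis
  obtain j :: "nat \<Rightarrow> 'f" where j: "inj j" using infinite_nat_embedding[OF inf] by blast
  obtain q :: "'f \<times> 'f \<Rightarrow> 'f" where q: "inj q" using infinite_pairing[OF inf] by blast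
  have "inj_on (\<lambda>(y, e). q (j (c y), e)) (S \<times> UNIV)"
    using c by (auto simp: inj_on_def dest!: injD[OF q] injD[OF j])
  then obtain code :: "('f, 'f base_point \<times> 'f) tree \<Rightarrow> 'f"
    where code: "inj_on code {P. leaves P \<subseteq> S \<times> UNIV}"
    using ex_tree_code[OF inf inj_on_id] by blast
  define small where "small Q Q' \<longleftrightarrow> sim Q Q' \<and> leaves Q' \<subseteq> S \<times> UNIV" for Q Q' :: "('f, 'f base_point \<times> 'f) tree"
  have "\<exists>Q'. small Q Q'" if "Q \<in> fibre p" for Q
  proof -
    let ?\<rho> = "\<lambda>v. if fst v \<in> S then v else e0"
    have "good Q" "eqv (base Q) (base P0)"
      using that P0 by (auto simp: fibre_def bundle_trees_def intro: tree_eqv_trans tree_eqv_sym)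
    then have "sim Q (relabel ?\<rho> Q)" by (rule sim_finite_support) (auto simp: S_def)
    moreover have "fst e0 \<in> S" by (simp add: S_def)
    then have "leaves (relabel ?\<rho> Q) \<subseteq> S \<times> UNIV" by (auto simp: subset_iff mem_Times_iff simp del: split_paired_All)
    ultimately show ?thesis unfolding small_def by blast
  qed
  then have small: "small Q (SOME Q'. small Q Q')" if "Q \<in> fibre p" for Q
    using that by (auto intro: someI_ex)
  have "code (SOME Q'. small P Q') = code (SOME Q'. small Q Q') \<longleftrightarrow> sim P Q"
    if P: "P \<in> fibre p" and Q: "Q \<in> fibre p" for P Q
  proof
    assume "code (SOME Q'. small P Q') = code (SOME Q'. small Q Q')"
    then have eq: "(SOME Q'. small P Q') = (SOME Q'. small Q Q')"
      by (rule inj_onD[OF code]) (use small[OF P] small[OF Q] in \<open>auto simp: small_def\<close>)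
    have "sim P (SOME Q'. small Q Q')" using small[OF P, unfolded eq] unfolding small_def[of P] by blast
    moreover have "sim Q (SOME Q'. small Q Q')" using small[OF Q] unfolding small_def[of Q "Eps _"] by blast
    ultimately show "sim P Q" by (blast intro: sim_trans sim_sym)
  next
    assume "sim P Q"
    then have "small P Q' \<longleftrightarrow> small Q Q'" for Q'
      unfolding small_def by (blast intro: sim_trans sim_sym)
    then show "code (SOME Q'. small P Q') = code (SOME Q'. small Q Q')" by simp
  qed
  then show ?thesis by (intro exI[of _ "\<lambda>P. code (SOME Q'. small P Q')"]) blast
qed simp

text \<open>The fibre over a generator is already a ternary structure by construction; any other fibre can be
  given names as elements.\<close>

lemma coordinates_exist:
  assumes inf: "infinite (UNIV :: 'f set)" and p: "good p"
  shows "\<exists>\<tau> g. fibre_coordinates p \<tau> g \<and> (\<forall>y. eqv p (Leaf y) \<longrightarrow> \<tau> = fst y)"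
proof (cases "\<exists>y. eqv p (Leaf y)")
  case True
  then obtain y where y: "eqv p (Leaf y)" by blast
  have "y' = y" if "eqv p (Leaf y')" for y'
  proof -
    have "eqv (Leaf y) (Leaf y')" using y that by (blast intro: tree_eqv_trans tree_eqv_sym)
    then have "pick (Leaf y :: ('f, 'f base_point) tree) = pick (Leaf y')"
      by (intro pick_eqv) auto
    then show ?thesis by simp
  qed
  then show ?thesis using generator_coordinates[OF p y] by blast
next
  case False
  obtain g :: "('f, 'f base_point \<times> 'f) tree \<Rightarrow> 'f"
    where g: "\<And>P Q. P \<in> fibre p \<Longrightarrow> Q \<in> fibre p \<Longrightarrow> g P = g Q \<longleftrightarrow> sim P Q"
    using fibre_embedding[OF inf, of p] by blast
  let ?R = "{(g P1, g P2, g P3) |P1 P2 P3. P1 \<in> fibre p \<and> P2 \<in> fibre p \<and> P3 \<in> fibre p \<and> tree_rel P1 P2 P3}"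
  have "tree_rel P1 P2 P3 \<longleftrightarrow> (g P1, g P2, g P3) \<in> ?R"
    if P: "P1 \<in> fibre p" "P2 \<in> fibre p" "P3 \<in> fibre p" for P1 P2 P3
  proof
    assume "(g P1, g P2, g P3) \<in> ?R"
    then obtain Q1 Q2 Q3 where Q: "Q1 \<in> fibre p" "Q2 \<in> fibre p" "Q3 \<in> fibre p" "tree_rel Q1 Q2 Q3"
      "g P1 = g Q1" "g P2 = g Q2" "g P3 = g Q3" by blast
    then have "sim Q1 P1" "sim Q2 P2" "sim Q3 P3" using g P by metis+
    then show "tree_rel P1 P2 P3" by (rule tree_rel_sim[OF Q(4)])
  qed (use P in blast)
  then have "fibre_coordinates p (g ` fibre p, ?R) g"
    unfolding fibre_coordinates_def using g by simp
  then show ?thesis using False by blast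
qed

definition base_class :: "('f, 'f base_point) tree \<Rightarrow> ('f, 'f base_point) tree set" where
  "base_class p = {q. good q \<and> eqv p q}"

lemma base_class_eq_iff:
  assumes "good p" "good q"
  shows "base_class p = base_class q \<longleftrightarrow> eqv p q"
proof
  assume eq: "base_class p = base_class q"
  have "q \<in> base_class q" using assms by (simp add: base_class_def tree_eqv_refl)
  then have "q \<in> base_class p" unfolding eq .
  then show "eqv p q" by (simp add: base_class_def)
qed (auto simp: base_class_def intro: tree_eqv_trans tree_eqv_sym)

text \<open>The generators alone show that each label occurs at least as often as there are sets of names, and
  there are no more base trees than that.\<close>

lemma label_classes_bijection:
  fixes label :: "('f, 'f base_point) tree set \<Rightarrow> 'f set \<times> ('f \<times> 'f \<times> 'f) set"
  assumes inf: "infinite (UNIV :: 'f set)"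
    and label: "\<And>\<tau> i. label (base_class (Leaf (\<tau>, i))) = \<tau>"
  shows "\<exists>h. bij_betw h {\<alpha> \<in> base_class ` Collect good. label \<alpha> = \<tau>} (UNIV :: 'f set set)"
proof -
  let ?A = "{\<alpha> \<in> base_class ` Collect good. label \<alpha> = \<tau>}"
  obtain j :: "'f base_point \<Rightarrow> 'f set" where j: "inj j" using base_point_embedding[OF inf] by blast
  have "inj (\<lambda>f :: 'f. {f})" by (simp add: inj_on_def)
  then obtain code :: "('f, 'f base_point) tree \<Rightarrow> 'f set" where code: "inj code"
    using ex_tree_code[OF infinite_UNIV_set[OF inf], of "\<lambda>f. {f}" j UNIV] j by auto
  define f where "f \<alpha> = code (SOME p. p \<in> \<alpha>)" for \<alpha>
  have "inj_on f ?A"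
  proof (rule inj_onI)
    fix \<alpha> \<beta> assume \<alpha>: "\<alpha> \<in> ?A" and \<beta>: "\<beta> \<in> ?A" and eq: "f \<alpha> = f \<beta>"
    obtain p q where pq: "good p" "\<alpha> = base_class p" "good q" "\<beta> = base_class q" using \<alpha> \<beta> by auto
    have some: "(SOME r. r \<in> base_class r') \<in> base_class r'" if "good r'" for r'
      by (rule someI[of _ r']) (use that in \<open>simp add: base_class_def tree_eqv_refl\<close>)
    define r where "r = (SOME r. r \<in> \<alpha>)"
    have "r = (SOME r. r \<in> \<beta>)" using eq injD[OF code] by (simp add: f_def r_def)
    then have "r \<in> \<alpha>" "r \<in> \<beta>" using some pq unfolding r_def by metis+
    then have "eqv p q" unfolding pq base_class_def by (auto intro: tree_eqv_trans tree_eqv_sym)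
    then show "\<alpha> = \<beta>" using pq base_class_eq_iff by blast
  qed
  moreover have "inj (\<lambda>i. base_class (Leaf (\<tau>, i)))"
  proof (rule injI)
    fix i i' :: "'f set" assume "base_class (Leaf (\<tau>, i)) = base_class (Leaf (\<tau>, i'))"
    then have "eqv (Leaf (\<tau>, i)) (Leaf (\<tau>, i'))" by (subst (asm) base_class_eq_iff) auto
    then have "pick (Leaf (\<tau>, i) :: ('f, 'f base_point) tree) = pick (Leaf (\<tau>, i'))"
      by (intro pick_eqv) auto
    then show "i = i'" by simp
  qed
  moreover have "range (\<lambda>i. base_class (Leaf (\<tau>, i))) \<subseteq> ?A"
  proof (rule image_subsetI)
    fix i show "base_class (Leaf (\<tau>, i)) \<in> ?A" using label[of \<tau> i] by simp
  qed
  ultimately show ?thesis by (intro Schroeder_Bernstein[of f]) auto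
qed

text \<open>The quotient of the trees by \<open>sim\<close> is isomorphic to the universal bundle via \<open>q\<close>.\<close>

definition presents_bundle :: "(('f, 'f base_point \<times> 'f) tree \<Rightarrow> 'f base_point \<times> 'f) \<Rightarrow> bool" where
  "presents_bundle q \<longleftrightarrow> q ` bundle_trees = bundle_space \<and>
     (\<forall>P \<in> bundle_trees. \<forall>Q \<in> bundle_trees. q P = q Q \<longleftrightarrow> sim P Q) \<and>
     (\<forall>P \<in> bundle_trees. \<forall>Q \<in> bundle_trees. fst (q P) = fst (q Q) \<longleftrightarrow> eqv (base P) (base Q)) \<and>
     (\<forall>P1 \<in> bundle_trees. \<forall>P2 \<in> bundle_trees. \<forall>P3 \<in> bundle_trees.
        tree_rel P1 P2 P3 \<longleftrightarrow> bundle_rel (q P1) (q P2) (q P3))"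

text \<open>The classes of base trees with a given label are matched with the base points with that label;
  this is possible since both are equally many. The fibres are then matched by their coordinates.\<close>

lemma bundle_presentation:
  assumes inf: "infinite (UNIV :: 'f set)"
  shows "\<exists>q. presents_bundle q"
proof -
  let ?A = "base_class ` Collect good"
  \<comment> \<open>Labels and coordinates must depend on the class of a base tree only.\<close>
  define rep where "rep \<alpha> = (SOME p. p \<in> \<alpha>)" for \<alpha> :: "('f, 'f base_point) tree set"
  have rep: "rep (base_class p) \<in> base_class p" if "good p" for p
    unfolding rep_def by (rule someI[of _ p]) (use that in \<open>simp add: base_class_def tree_eqv_refl\<close>)
  have "\<forall>p. \<exists>\<tau> g. good p \<longrightarrow> fibre_coordinates p \<tau> g \<and> (\<forall>y. eqv p (Leaf y) \<longrightarrow> \<tau> = fst y)"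
    using coordinates_exist[OF inf] by blast
  then obtain \<tau> g where \<tau>g: "\<And>p. good p \<Longrightarrow> fibre_coordinates p (\<tau> p) (g p)"
    "\<And>p y. good p \<Longrightarrow> eqv p (Leaf y) \<Longrightarrow> \<tau> p = fst y"
    by metis
  define label where "label \<alpha> = \<tau> (rep \<alpha>)" for \<alpha>
  define coord where "coord \<alpha> = g (rep \<alpha>)" for \<alpha>
  have coords: "fibre_coordinates p (label (base_class p)) (coord (base_class p))" if p: "good p" for p
  proof -
    have r: "good (rep (base_class p))" "eqv p (rep (base_class p))"
      using rep[OF p] by (auto simp: base_class_def)
    have "fibre (rep (base_class p)) = fibre p"
      using r(2) by (auto simp: fibre_def intro: tree_eqv_trans tree_eqv_sym)
    then show ?thesis using \<tau>g(1)[OF r(1)] unfolding label_def coord_def fibre_coordinates_def by simp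
  qed
  have "label (base_class (Leaf (\<sigma>, i))) = \<sigma>" for \<sigma> i
  proof -
    have "rep (base_class (Leaf (\<sigma>, i))) \<in> base_class (Leaf (\<sigma>, i))" by (rule rep) simp
    then show ?thesis
      using \<tau>g(2)[of "rep (base_class (Leaf (\<sigma>, i)))" "(\<sigma>, i)"]
      by (simp add: base_class_def label_def tree_eqv_sym)
  qed
  then have "\<forall>\<sigma>. \<exists>h. bij_betw h {\<alpha> \<in> ?A. label \<alpha> = \<sigma>} (UNIV :: 'f set set)"
    using label_classes_bijection[OF inf] by blast
  then have "\<exists>h. \<forall>\<sigma>. bij_betw (h \<sigma>) {\<alpha> \<in> ?A. label \<alpha> = \<sigma>} (UNIV :: 'f set set)"
    by (rule choice)
  then obtain h where h: "\<And>\<sigma>. bij_betw (h \<sigma>) {\<alpha> \<in> ?A. label \<alpha> = \<sigma>} (UNIV :: 'f set set)"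
    by blast
  define adr where "adr \<alpha> = (label \<alpha>, h (label \<alpha>) \<alpha>)" for \<alpha>
  have adr_inj: "\<alpha> = \<beta>" if "\<alpha> \<in> ?A" "\<beta> \<in> ?A" "adr \<alpha> = adr \<beta>" for \<alpha> \<beta>
  proof -
    have eq: "label \<beta> = label \<alpha>" "h (label \<alpha>) \<alpha> = h (label \<beta>) \<beta>"
      using that(3) unfolding adr_def prod.inject by (elim conjE, simp only:)+
    have "inj_on (h (label \<alpha>)) {\<gamma> \<in> ?A. label \<gamma> = label \<alpha>}"
      by (rule bij_betw_imp_inj_on[OF h])
    moreover have "\<alpha> \<in> {\<gamma> \<in> ?A. label \<gamma> = label \<alpha>}" "\<beta> \<in> {\<gamma> \<in> ?A. label \<gamma> = label \<alpha>}"
      using that(1,2) eq(1) by blast+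
    ultimately show ?thesis using eq(2)[unfolded eq(1)] unfolding inj_on_def by blast
  qed
  have adr_surj: "\<exists>p. good p \<and> adr (base_class p) = y" for y
  proof -
    obtain \<sigma> i where y: "y = (\<sigma>, i)" by (cases y)
    have "i \<in> h \<sigma> ` {\<alpha> \<in> ?A. label \<alpha> = \<sigma>}" using h[of \<sigma>] by (simp add: bij_betw_def)
    then show ?thesis by (auto simp: adr_def y)
  qed
  define q where "q P = (adr (base_class (base P)), coord (base_class (base P)) P)" for P
  have good: "good (base P)" if "P \<in> bundle_trees" for P using that by (simp add: bundle_trees_def)
  have self: "P \<in> fibre (base P)" if "P \<in> bundle_trees" for P
    using that good[OF that] by (simp add: fibre_def tree_eqv_refl)
  have fst_q: "fst (q P) = fst (q Q) \<longleftrightarrow> eqv (base P) (base Q)"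
    if "P \<in> bundle_trees" "Q \<in> bundle_trees" for P Q
  proof -
    have in_A: "base_class (base P) \<in> ?A" "base_class (base Q) \<in> ?A" using good that by blast+
    have "fst (q P) = fst (q Q) \<longleftrightarrow> base_class (base P) = base_class (base Q)"
    proof
      assume "fst (q P) = fst (q Q)"
      then show "base_class (base P) = base_class (base Q)"
        unfolding q_def fst_conv by (rule adr_inj[OF in_A])
    qed (simp only: q_def fst_conv)
    then show ?thesis using base_class_eq_iff[OF good[OF that(1)] good[OF that(2)]] by simp
  qed
  have same: "Q \<in> fibre (base P)" "q Q = (adr (base_class (base P)), coord (base_class (base P)) Q)"
    if "P \<in> bundle_trees" "Q \<in> bundle_trees" "eqv (base Q) (base P)" for P Q
  proof -
    have "base_class (base Q) = base_class (base P)"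
      using base_class_eq_iff[OF good[OF that(2)] good[OF that(1)]] that(3) by blast
    then show "q Q = (adr (base_class (base P)), coord (base_class (base P)) Q)" by (simp only: q_def)
    show "Q \<in> fibre (base P)" using that(2,3) by (simp add: fibre_def)
  qed
  have "q P = q Q \<longleftrightarrow> sim P Q" if PQ: "P \<in> bundle_trees" "Q \<in> bundle_trees" for P Q
  proof (cases "eqv (base Q) (base P)")
    case True
    have "coord (base_class (base P)) P = coord (base_class (base P)) Q \<longleftrightarrow> sim P Q"
      using coords[OF good[OF PQ(1)]] self[OF PQ(1)] same(1)[OF PQ True]
      unfolding fibre_coordinates_def by blast
    then show ?thesis unfolding same(2)[OF PQ True] by (simp add: q_def)
  next
    case False
    then have "q P \<noteq> q Q" using fst_q[OF PQ] by (metis tree_eqv_sym)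
    then show ?thesis using False sim_base tree_eqv_sym by blast
  qed
  moreover have "tree_rel P1 P2 P3 \<longleftrightarrow> bundle_rel (q P1) (q P2) (q P3)"
    if P: "P1 \<in> bundle_trees" "P2 \<in> bundle_trees" "P3 \<in> bundle_trees" for P1 P2 P3
  proof (cases "eqv (base P2) (base P1) \<and> eqv (base P3) (base P1)")
    case True
    then have e: "eqv (base P2) (base P1)" "eqv (base P3) (base P1)" by auto
    let ?c = "coord (base_class (base P1))"
    have "tree_rel P1 P2 P3 \<longleftrightarrow> (?c P1, ?c P2, ?c P3) \<in> snd (label (base_class (base P1)))"
      using coords[OF good[OF P(1)]] self[OF P(1)] same(1)[OF P(1,2) e(1)] same(1)[OF P(1,3) e(2)]
      unfolding fibre_coordinates_def by blast
    then show ?thesis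
      unfolding same(2)[OF P(1,2) e(1)] same(2)[OF P(1,3) e(2)]
      by (simp add: q_def bundle_rel_def adr_def)
  next
    case False
    then have "\<not> tree_rel P1 P2 P3" using tree_rel_base by blast
    moreover have "\<not> bundle_rel (q P1) (q P2) (q P3)"
      using False fst_q[OF P(2,1)] fst_q[OF P(3,1)] unfolding bundle_rel_def by blast
    ultimately show ?thesis by simp
  qed
  moreover have "q ` bundle_trees = bundle_space"
  proof (intro equalityI subsetI)
    fix b assume "b \<in> q ` bundle_trees"
    then obtain P where P: "P \<in> bundle_trees" "b = q P" by blast
    have "coord (base_class (base P)) ` fibre (base P) = fst (label (base_class (base P)))"
      using coords[OF good[OF P(1)]] unfolding fibre_coordinates_def by blast
    then show "b \<in> bundle_space"
      using self[OF P(1)] by (auto simp: P(2) q_def bundle_space_def adr_def)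
  next
    fix b :: "'f base_point \<times> 'f" assume b: "b \<in> bundle_space"
    obtain p where p: "good p" "adr (base_class p) = fst b" using adr_surj by blast
    then have "snd b \<in> fst (label (base_class p))"
      using b by (simp add: bundle_space_def adr_def flip: p(2))
    then have "snd b \<in> coord (base_class p) ` fibre p"
      using coords[OF p(1)] unfolding fibre_coordinates_def by blast
    then obtain P where P: "P \<in> fibre p" "snd b = coord (base_class p) P" by blast
    have PB: "P \<in> bundle_trees" "eqv (base P) p" using P(1) by (auto simp: fibre_def)
    then have "base_class (base P) = base_class p" using base_class_eq_iff[OF good[OF PB(1)] p(1)] by blast
    then have "q P = b" using P(2) p(2) by (simp add: q_def prod_eq_iff)
    then show "b \<in> q ` bundle_trees" using PB(1) by blast
  qed
  ultimately have "presents_bundle q" unfolding presents_bundle_def using fst_q by blast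
  then show ?thesis by blast
qed

text \<open>The operations on trees are transported along the presentation of the bundle, using any section of
  it.\<close>

lemma acts_on_bundle_exists:
  assumes inf: "infinite (UNIV :: 'f set)"
  shows "\<exists>I :: 'f \<Rightarrow> ('f base_point \<times> 'f) list \<Rightarrow> 'f base_point \<times> 'f. acts_on_bundle V I"
proof -
  obtain q where q: "presents_bundle q" using bundle_presentation[OF inf] by blast
  have q_sim: "q P = q Q \<longleftrightarrow> sim P Q" and q_fst: "fst (q P) = fst (q Q) \<longleftrightarrow> eqv (base P) (base Q)"
    if "P \<in> bundle_trees" "Q \<in> bundle_trees" for P Q
    using q that unfolding presents_bundle_def by blast+
  have q_rel: "tree_rel P1 P2 P3 \<longleftrightarrow> bundle_rel (q P1) (q P2) (q P3)"
    if "P1 \<in> bundle_trees" "P2 \<in> bundle_trees" "P3 \<in> bundle_trees" for P1 P2 P3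
    using q that unfolding presents_bundle_def by blast
  have q_img: "q ` bundle_trees = bundle_space" using q unfolding presents_bundle_def by blast
  define sec where "sec = inv_into bundle_trees q"
  have sec: "sec b \<in> bundle_trees" "q (sec b) = b" if "b \<in> bundle_space" for b
    using inv_into_into[of b q bundle_trees] f_inv_into_f[of b q bundle_trees] that
    unfolding q_img sec_def by auto
  have good: "good P" if "P \<in> bundle_trees" for P using that by (simp add: bundle_trees_def)
  have Node: "Node f Ps \<in> bundle_trees"
    if "(f, length Ps) \<in> signature V" "set Ps \<subseteq> bundle_trees" for f Ps
    using that by (auto simp: bundle_trees_def)
  define I where "I f bs = q (Node f (map sec bs))" for f bs
  have secs: "set (map sec bs) \<subseteq> bundle_trees" "length (map sec bs) = n" if "bs \<in> tuples bundle_space n" for bs n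
    using that sec(1) by (auto simp: tuples_def)
  have Node_sec: "Node f (map sec bs) \<in> bundle_trees"
    if "(f, n) \<in> signature V" "bs \<in> tuples bundle_space n" for f bs n
    by (rule Node) (use secs[OF that(2)] that(1) in simp_all)
  have I_q: "I f (map q Ps) = q (Node f Ps)"
    if f: "(f, length Ps) \<in> signature V" and Ps: "set Ps \<subseteq> bundle_trees" for f Ps
  proof -
    have qP: "q P \<in> bundle_space" if "P \<in> set Ps" for P using that Ps q_img by blast
    have "sec (q P) \<in> bundle_trees" if "P \<in> set Ps" for P using sec(1)[OF qP[OF that]] .
    then have s: "set (map sec (map q Ps)) \<subseteq> bundle_trees" by auto
    have "list_all2 sim (map sec (map q Ps)) Ps"
      unfolding list_all2_map1
      by (rule list.rel_refl_strong) (use Ps qP sec q_sim in blast)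
    then have "sim (Node f (map sec (map q Ps))) (Node f Ps)"
      by (intro sim_Node) (use f s Ps good in auto)
    then show ?thesis
      unfolding I_def by (subst q_sim) (use f s Ps in \<open>auto intro!: Node\<close>)
  qed
  have eval_q: "eval I (\<lambda>x. q (\<sigma> x)) t = q (eval Node \<sigma> t) \<and> eval Node \<sigma> t \<in> bundle_trees"
    if \<sigma>: "\<And>x. \<sigma> x \<in> bundle_trees" and t: "t \<in> terms_over (signature V)" for \<sigma> t
    using t
  proof (induction t)
    case (App f ts)
    then have IH: "set (map (eval Node \<sigma>) ts) \<subseteq> bundle_trees"
      "map (eval I (\<lambda>x. q (\<sigma> x))) ts = map q (map (eval Node \<sigma>) ts)" by auto
    have f: "(f, length (map (eval Node \<sigma>) ts)) \<in> signature V" using App.prems by simp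
    show ?case unfolding eval.simps IH(2) I_q[OF f IH(1)] using Node[OF f IH(1)] by simp
  qed (use \<sigma> in auto)
  have "in_variety V bundle_space I"
  proof -
    have "I f xs \<in> bundle_space" if "(f, n) \<in> signature V" "xs \<in> tuples bundle_space n" for f n xs
      using Node_sec[OF that] q_img unfolding I_def by blast
    moreover have "eval I \<rho> s = eval I \<rho> t"
      if st: "(s, t) \<in> identities V" and \<rho>: "\<rho> \<in> UNIV \<rightarrow> bundle_space" for s t \<rho>
    proof -
      have \<sigma>: "sec (\<rho> x) \<in> bundle_trees" "q (sec (\<rho> x)) = \<rho> x" for x
        using sec[OF funcset_mem[OF \<rho> UNIV_I]] by blast+
      have over: "s \<in> terms_over (signature V)" "t \<in> terms_over (signature V)"
        using V st by (auto simp: varieties_def)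
      note ev = eval_q[of "\<lambda>x. sec (\<rho> x)", OF \<sigma>(1), unfolded \<sigma>(2)]
      have "eqv (eval Node (\<lambda>x. sec (\<rho> x)) s) (eval Node (\<lambda>x. sec (\<rho> x)) t)"
        by (rule tree_eqv_identity[OF st]) (rule good[OF \<sigma>(1)])
      then have "sim (eval Node (\<lambda>x. sec (\<rho> x)) s) (eval Node (\<lambda>x. sec (\<rho> x)) t)"
        using ev[OF over(1)] ev[OF over(2)] good by (intro sim_of_eqv) auto
      then show ?thesis using ev[OF over(1)] ev[OF over(2)] q_sim by auto
    qed
    ultimately show ?thesis unfolding in_variety_def by blast
  qed
  moreover have "fst (I f xs) = fst (I f ys)"
    if f: "(f, n) \<in> signature V" and xs: "xs \<in> tuples bundle_space n" and ys: "ys \<in> tuples bundle_space n"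
      and eq: "map fst xs = map fst ys" for f n xs ys
  proof -
    have "eqv (base (sec (xs ! i))) (base (sec (ys ! i)))" if "i < n" for i
    proof -
      have b: "xs ! i \<in> bundle_space" "ys ! i \<in> bundle_space"
        using xs ys that by (auto simp: tuples_def in_lists_conv_set)
      have "fst (xs ! i) = fst (ys ! i)"
        using arg_cong[OF eq, of "\<lambda>l. l ! i"] xs ys that by (simp add: tuples_def)
      then show ?thesis
        using q_fst[OF sec(1)[OF b(1)] sec(1)[OF b(2)]] sec(2)[OF b(1)] sec(2)[OF b(2)] by simp
    qed
    then have "list_all2 eqv (map base (map sec xs)) (map base (map sec ys))"
      using xs ys by (simp add: list_all2_conv_all_nth tuples_def)
    then have "eqv (base (Node f (map sec xs))) (base (Node f (map sec ys)))"
      unfolding tree.map by (rule tree_eqv_Node[rotated]) (use f xs in \<open>simp add: tuples_def\<close>)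
    then show ?thesis unfolding I_def using q_fst[OF Node_sec[OF f xs] Node_sec[OF f ys]] by blast
  qed
  moreover have "bundle_rel (I f xs) (I f ys) (I f zs)"
    if f: "(f, n) \<in> signature V" and xs: "xs \<in> tuples bundle_space n" and ys: "ys \<in> tuples bundle_space n"
      and zs: "zs \<in> tuples bundle_space n" and rel: "\<forall>i < n. bundle_rel (xs ! i) (ys ! i) (zs ! i)"
    for f n xs ys zs
  proof -
    have "tree_rel (Node f (map sec xs)) (Node f (map sec ys)) (Node f (map sec zs))"
    proof (rule tree_rel_Node[OF f])
      fix i assume i: "i < n"
      have b: "xs ! i \<in> bundle_space" "ys ! i \<in> bundle_space" "zs ! i \<in> bundle_space"
        using xs ys zs i by (auto simp: tuples_def in_lists_conv_set)
      show "tree_rel (map sec xs ! i) (map sec ys ! i) (map sec zs ! i)"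
        using q_rel[OF sec(1)[OF b(1)] sec(1)[OF b(2)] sec(1)[OF b(3)]] rel i b xs ys zs
        by (simp add: sec(2) tuples_def)
    qed (use xs ys zs secs(1)[OF xs] secs(1)[OF ys] secs(1)[OF zs] good in \<open>auto simp: tuples_def\<close>)
    then show ?thesis
      unfolding I_def using q_rel[OF Node_sec[OF f xs] Node_sec[OF f ys] Node_sec[OF f zs]] by blast
  qed
  ultimately have "acts_on_bundle V I" unfolding acts_on_bundle_def by blast
  then show ?thesis by blast
qed

end

section \<open>The Taylor types form a prime filter\<close>

lemma not_taylor_iff_acts:
  fixes V :: "'f variety"
  assumes inf: "infinite (UNIV :: 'f set)" and V: "V \<in> varieties"
  shows "\<not> taylor_variety V \<longleftrightarrow>
    (\<exists>I :: 'f \<Rightarrow> ('f base_point \<times> 'f) list \<Rightarrow> 'f base_point \<times> 'f. acts_on_bundle V I)"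
proof
  assume "\<not> taylor_variety V"
  then obtain \<phi> where "selector V \<phi>" using non_taylor_selector[OF V] by blast
  then interpret variety_with_selector V \<phi> by unfold_locales (rule V)
  show "\<exists>I :: 'f \<Rightarrow> ('f base_point \<times> 'f) list \<Rightarrow> 'f base_point \<times> 'f. acts_on_bundle V I"
    by (rule acts_on_bundle_exists[OF inf])
next
  obtain j :: "nat \<Rightarrow> 'f" where j: "inj j" using infinite_nat_embedding[OF inf] by blast
  have "j 0 \<noteq> j 1" using injD[OF j, of 0 1] by auto
  assume "\<exists>I :: 'f \<Rightarrow> ('f base_point \<times> 'f) list \<Rightarrow> 'f base_point \<times> 'f. acts_on_bundle V I"
  then obtain I :: "'f \<Rightarrow> ('f base_point \<times> 'f) list \<Rightarrow> 'f base_point \<times> 'f"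
    where "acts_on_bundle V I" by (rule exE)
  then show "\<not> taylor_variety V" by (rule acts_on_bundle_not_taylor[OF \<open>j 0 \<noteq> j 1\<close> V])
qed

lemma selector_not_taylor:
  fixes V :: "'f variety"
  assumes inf: "infinite (UNIV :: 'f set)" and V: "V \<in> varieties" and sel: "selector V \<phi>"
  shows "\<not> taylor_variety V"
proof -
  interpret variety_with_selector V \<phi> by unfold_locales (rule V, rule sel)
  show ?thesis unfolding not_taylor_iff_acts[OF inf V] by (rule acts_on_bundle_exists[OF inf])
qed

text \<open>Two actions on the same bundle, one for each set of symbols, are together an action of the
  join.\<close>

lemma join_not_taylor:
  fixes V W :: "'f variety"
  assumes inf: "infinite (UNIV :: 'f set)" and V: "V \<in> varieties" and W: "W \<in> varieties"
    and i: "inj i" and j: "inj j" and disj: "range i \<inter> range j = {}"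
    and nV: "\<not> taylor_variety V" and nW: "\<not> taylor_variety W"
  shows "\<not> taylor_variety (join_variety i j V W :: 'f variety)"
proof -
  obtain I K :: "'f \<Rightarrow> ('f base_point \<times> 'f) list \<Rightarrow> 'f base_point \<times> 'f"
    where I: "acts_on_bundle V I" and K: "acts_on_bundle W K"
    using nV[unfolded not_taylor_iff_acts[OF inf V]] nW[unfolded not_taylor_iff_acts[OF inf W]]
    by (elim exE)
  let ?J = "join_variety i j V W" and ?C = "copair i j I K"
  have symbol: "(\<exists>g. f = i g \<and> (g, n) \<in> signature V \<and> ?C f = I g) \<or>
      (\<exists>g. f = j g \<and> (g, n) \<in> signature W \<and> ?C f = K g)" if "(f, n) \<in> signature ?J" for f n
    using that i j disj by (auto simp: join_variety_def)
  have left: "eval ?C \<rho> (map_trm i s) = eval I \<rho> s" and right: "eval ?C \<rho> (map_trm j s) = eval K \<rho> s" for \<rho> s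
    using i j disj by (simp_all add: eval_map_trm)
  have "in_variety ?J bundle_space ?C"
  proof -
    have "?C f xs \<in> bundle_space" if f: "(f, n) \<in> signature ?J" and xs: "xs \<in> tuples bundle_space n" for f n xs
      using symbol[OF f] xs acts_in_variety[OF I] acts_in_variety[OF K]
      unfolding in_variety_def by fastforce
    moreover have "eval ?C \<rho> s = eval ?C \<rho> t"
      if st: "(s, t) \<in> identities ?J" and \<rho>: "\<rho> \<in> UNIV \<rightarrow> bundle_space" for s t \<rho>
      using st \<rho> free_cong_sound[OF acts_in_variety[OF I] free_cong_identity \<rho>]
        free_cong_sound[OF acts_in_variety[OF K] free_cong_identity \<rho>]
      by (auto simp: join_variety_def left right)
    ultimately show ?thesis unfolding in_variety_def by blast
  qed
  moreover have "fst (?C f xs) = fst (?C f ys)"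
    if f: "(f, n) \<in> signature ?J" and xs: "xs \<in> tuples bundle_space n" "ys \<in> tuples bundle_space n"
      "map fst xs = map fst ys" for f n xs ys
    using symbol[OF f] acts_fibres[OF I _ xs] acts_fibres[OF K _ xs] by auto
  moreover have "bundle_rel (?C f xs) (?C f ys) (?C f zs)"
    if f: "(f, n) \<in> signature ?J" and xs: "xs \<in> tuples bundle_space n" "ys \<in> tuples bundle_space n"
      "zs \<in> tuples bundle_space n" and rel: "\<forall>i < n. bundle_rel (xs ! i) (ys ! i) (zs ! i)" for f n xs ys zs
    using symbol[OF f] acts_rel[OF I _ xs] acts_rel[OF K _ xs] rel by auto
  ultimately have "acts_on_bundle ?J ?C" unfolding acts_on_bundle_def by blast
  then show ?thesis unfolding not_taylor_iff_acts[OF inf join_variety_varieties[OF V W]] by (intro exI[of _ ?C])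
qed

text \<open>Otherwise the meet has a selector, and so has one of the two varieties, which then is not
  Taylor.\<close>

lemma meet_taylor:
  fixes V W :: "'f variety"
  assumes inf: "infinite (UNIV :: 'f set)" and V: "V \<in> varieties" and W: "W \<in> varieties"
    and enc: "inj enc" and tV: "taylor_variety V" and tW: "taylor_variety W"
  shows "taylor_variety (meet_variety enc V W :: 'f variety)"
proof (rule ccontr)
  assume "\<not> ?thesis"
  then obtain \<phi> where "selector (meet_variety enc V W) \<phi>"
    using non_taylor_selector[OF meet_variety_varieties] by blast
  then show False
    using selector_meet[OF V W enc] selector_not_taylor[OF inf V] selector_not_taylor[OF inf W] tV tW by blast
qed

lemma taylor_mono: "taylor_variety V \<Longrightarrow> interprets V W \<Longrightarrow> taylor_variety W"
  unfolding taylor_variety_def admits_def by (blast intro: interprets_trans)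

lemma equiv_equi_interpretable: "equiv varieties equi_interpretable"
  by (intro equivI refl_onI symI transI)
    (auto simp: equi_interpretable_def intro: interprets_refl interprets_trans)

lemma type_in_carrier: "V \<in> varieties \<Longrightarrow> interpretability_type V \<in> carrier interp_lattice"
  by (auto simp: interpretability_type_def interp_lattice_def intro: quotientI)

lemma carrier_type:
  assumes "X \<in> carrier interp_lattice"
  obtains V where "V \<in> varieties" "X = interpretability_type V"
  using assms by (auto simp: interp_lattice_def interpretability_type_def elim!: quotientE)

lemma type_le_iff:
  assumes "V \<in> varieties" "W \<in> varieties"
  shows "interpretability_type V \<sqsubseteq>\<^bsub>interp_lattice\<^esub> interpretability_type W \<longleftrightarrow> interprets V W"
  using assms interprets_refl
  by (auto simp: interp_lattice_def interpretability_type_def equi_interpretable_def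
      intro: interprets_trans)

lemma type_eq_iff:
  assumes "V \<in> varieties" "W \<in> varieties"
  shows "interpretability_type V = interpretability_type W \<longleftrightarrow> interprets V W \<and> interprets W V"
  unfolding interpretability_type_def eq_equiv_class_iff[OF equiv_equi_interpretable assms]
  using assms by (simp add: equi_interpretable_def)

lemma taylor_type_iff:
  assumes "V \<in> varieties"
  shows "interpretability_type V \<in> taylor_types \<longleftrightarrow> taylor_variety V"
  using assms type_eq_iff taylor_mono unfolding taylor_types_def by blast

lemma partial_order_interp: "partial_order (interp_lattice :: 'f variety set gorder)"
proof
  show "X \<sqsubseteq>\<^bsub>interp_lattice\<^esub> X" if "X \<in> carrier interp_lattice" for X :: "'f variety set"
    using that by (elim carrier_type) (simp add: type_le_iff interprets_refl)
  show "X .=\<^bsub>interp_lattice\<^esub> Y"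
    if le: "X \<sqsubseteq>\<^bsub>interp_lattice\<^esub> Y" "Y \<sqsubseteq>\<^bsub>interp_lattice\<^esub> X"
      and XY: "X \<in> carrier interp_lattice" "Y \<in> carrier interp_lattice"
    for X Y :: "'f variety set"
  proof -
    obtain V W where VW: "V \<in> varieties" "X = interpretability_type V" "W \<in> varieties" "Y = interpretability_type W"
      using XY by (elim carrier_type)
    then have "X = Y" using le by (simp add: type_le_iff type_eq_iff)
    then show ?thesis by (simp add: interp_lattice_def)
  qed
  show "X \<sqsubseteq>\<^bsub>interp_lattice\<^esub> Z"
    if le: "X \<sqsubseteq>\<^bsub>interp_lattice\<^esub> Y" "Y \<sqsubseteq>\<^bsub>interp_lattice\<^esub> Z"
      and XYZ: "X \<in> carrier interp_lattice" "Y \<in> carrier interp_lattice" "Z \<in> carrier interp_lattice"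
    for X Y Z :: "'f variety set"
  proof -
    obtain U V W where "U \<in> varieties" "X = interpretability_type U" "V \<in> varieties" "Y = interpretability_type V"
      "W \<in> varieties" "Z = interpretability_type W"
      using XYZ by (elim carrier_type)
    then show ?thesis using le by (simp add: type_le_iff) (blast intro: interprets_trans)
  qed
qed (auto simp: interp_lattice_def)

lemma least_type:
  fixes V W J :: "'f variety"
  assumes V: "V \<in> varieties" and W: "W \<in> varieties" and J: "J \<in> varieties"
    and ub: "interprets V J" "interprets W J"
    and least: "\<And>U :: 'f variety. U \<in> varieties \<Longrightarrow> interprets V U \<Longrightarrow> interprets W U \<Longrightarrow> interprets J U"
  shows "least interp_lattice (interpretability_type J)
    (Upper interp_lattice {interpretability_type V, interpretability_type W})"
  unfolding least_def
proof (intro conjI ballI)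
  show "interpretability_type J \<in> Upper interp_lattice {interpretability_type V, interpretability_type W}"
    using assms by (auto simp: Upper_def type_le_iff type_in_carrier)
  fix X assume X: "X \<in> Upper interp_lattice {interpretability_type V, interpretability_type W}"
  then have "X \<in> carrier interp_lattice" by (auto simp: Upper_def)
  then obtain U where U: "U \<in> varieties" "X = interpretability_type U" by (rule carrier_type)
  then have "interprets V U" "interprets W U"
    using X V W type_in_carrier[OF V] type_in_carrier[OF W] by (auto simp: Upper_def type_le_iff)
  then show "interpretability_type J \<sqsubseteq>\<^bsub>interp_lattice\<^esub> X"
    using least[OF U(1)] U J by (simp add: type_le_iff)
qed (auto simp: Upper_def)

lemma greatest_type:
  fixes V W M :: "'f variety"
  assumes V: "V \<in> varieties" and W: "W \<in> varieties" and M: "M \<in> varieties"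
    and lb: "interprets M V" "interprets M W"
    and greatest: "\<And>U :: 'f variety. U \<in> varieties \<Longrightarrow> interprets U V \<Longrightarrow> interprets U W \<Longrightarrow> interprets U M"
  shows "greatest interp_lattice (interpretability_type M)
    (Lower interp_lattice {interpretability_type V, interpretability_type W})"
  unfolding greatest_def
proof (intro conjI ballI)
  show "interpretability_type M \<in> Lower interp_lattice {interpretability_type V, interpretability_type W}"
    using assms by (auto simp: Lower_def type_le_iff type_in_carrier)
  fix X assume X: "X \<in> Lower interp_lattice {interpretability_type V, interpretability_type W}"
  then have "X \<in> carrier interp_lattice" by (auto simp: Lower_def)
  then obtain U where U: "U \<in> varieties" "X = interpretability_type U" by (rule carrier_type)
  then have "interprets U V" "interprets U W"
    using X V W type_in_carrier[OF V] type_in_carrier[OF W] by (auto simp: Lower_def type_le_iff)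
  then show "X \<sqsubseteq>\<^bsub>interp_lattice\<^esub> interpretability_type M"
    using greatest[OF U(1)] U M by (simp add: type_le_iff)
qed (auto simp: Lower_def)

lemma join_type_least:
  fixes V W :: "'f variety"
  assumes V: "V \<in> varieties" and W: "W \<in> varieties"
    and i: "inj i" and j: "inj j" and disj: "range i \<inter> range j = {}"
  shows "least interp_lattice (interpretability_type (join_variety i j V W :: 'f variety))
    (Upper interp_lattice {interpretability_type V, interpretability_type W})"
proof (rule least_type[OF V W join_variety_varieties[OF V W] join_upper[OF V W]])
  show "interprets W (join_variety i j V W)"
    by (subst join_variety_swap) (rule join_upper[OF W V])
qed (rule join_least[OF V W _ i j disj])

lemma meet_type_greatest:
  fixes V W :: "'f variety"
  assumes V: "V \<in> varieties" and W: "W \<in> varieties" and enc: "inj enc"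
  shows "greatest interp_lattice (interpretability_type (meet_variety enc V W :: 'f variety))
    (Lower interp_lattice {interpretability_type V, interpretability_type W})"
  using interpretation_clone_hom[OF meet_variety_varieties V meet_first[OF enc]]
    interpretation_clone_hom[OF meet_variety_varieties W meet_second[OF enc]]
  by (rule greatest_type[OF V W meet_variety_varieties]) (rule meet_greatest[OF V W _ enc])

lemma disjoint_embeddings:
  assumes "infinite (UNIV :: 'f set)"
  shows "\<exists>(i :: 'f \<Rightarrow> 'f) (j :: 'f \<Rightarrow> 'f). inj i \<and> inj j \<and> range i \<inter> range j = {}"
proof -
  obtain p :: "'f \<times> 'f \<Rightarrow> 'f" where p: "inj p" using infinite_pairing[OF assms] by blast
  obtain k :: "nat \<Rightarrow> 'f" where k: "inj k" using infinite_nat_embedding[OF assms] by blast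
  have "k 0 \<noteq> k 1" using injD[OF k, of 0 1] by auto
  then have "inj (\<lambda>x. p (k 0, x)) \<and> inj (\<lambda>x. p (k 1, x)) \<and>
      range (\<lambda>x. p (k 0, x)) \<inter> range (\<lambda>x. p (k 1, x)) = {}"
    by (auto simp: inj_def dest!: injD[OF p])
  then show ?thesis by blast
qed

lemma lattice_interp:
  assumes inf: "infinite (UNIV :: 'f set)"
  shows "lattice (interp_lattice :: 'f variety set gorder)"
proof -
  interpret partial_order "interp_lattice :: 'f variety set gorder" by (rule partial_order_interp)
  obtain i j :: "'f \<Rightarrow> 'f" where ij: "inj i" "inj j" "range i \<inter> range j = {}"
    using disjoint_embeddings[OF inf] by blast
  obtain enc :: "'f trm \<times> 'f trm \<Rightarrow> 'f" where enc: "inj enc" using term_pair_encoding[OF inf] by blast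
  show ?thesis
  proof
    fix X Y :: "'f variety set"
    assume "X \<in> carrier interp_lattice" "Y \<in> carrier interp_lattice"
    then obtain V W where VW: "V \<in> varieties" "X = interpretability_type V" "W \<in> varieties" "Y = interpretability_type W"
      by (elim carrier_type)
    show "\<exists>s. least interp_lattice s (Upper interp_lattice {X, Y})"
      using join_type_least[OF VW(1,3) ij] VW by blast
    show "\<exists>s. greatest interp_lattice s (Lower interp_lattice {X, Y})"
      using meet_type_greatest[OF VW(1,3) enc] VW by blast
  qed
qed

theorem theorem4p4:
  assumes "infinite (UNIV :: 'f set)"
  shows "prime_filter (interp_lattice :: 'f variety set gorder) taylor_types"
proof -
  let ?L = "interp_lattice :: 'f variety set gorder"
  interpret lattice ?L by (rule lattice_interp[OF assms])
  obtain i j :: "'f \<Rightarrow> 'f" where ij: "inj i" "inj j" "range i \<inter> range j = {}"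
    using disjoint_embeddings[OF assms] by blast
  obtain enc :: "'f trm \<times> 'f trm \<Rightarrow> 'f" where enc: "inj enc" using term_pair_encoding[OF assms] by blast
  have join: "interpretability_type V \<squnion>\<^bsub>?L\<^esub> interpretability_type W = interpretability_type (join_variety i j V W)"
    if VW: "V \<in> varieties" "W \<in> varieties" for V W :: "'f variety"
    using least_unique[OF _ join_type_least[OF VW ij]]
    by (rule joinI) (use VW type_in_carrier in blast)+
  have meet: "interpretability_type V \<sqinter>\<^bsub>?L\<^esub> interpretability_type W = interpretability_type (meet_variety enc V W)"
    if VW: "V \<in> varieties" "W \<in> varieties" for V W :: "'f variety"
    using greatest_unique[OF _ meet_type_greatest[OF VW enc]]
    by (rule meetI) (use VW type_in_carrier in blast)+
  \<comment> \<open>The variety that identifies all elements is Taylor, and the variety of sets is not.\<close>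
  let ?One = "\<lparr>signature = {}, identities = {(Var 0, Var 1)}\<rparr> :: 'f variety"
  let ?Zero = "\<lparr>signature = {}, identities = {}\<rparr> :: 'f variety"
  have One: "?One \<in> varieties" and Zero: "?Zero \<in> varieties" by (simp_all add: varieties_def)
  have "taylor_variety ?One"
  proof -
    let ?M = "{(Var 0, Var 1)} :: identity_set"
    have "is_interpretation (variety_of ?M) ?One (\<lambda>f n. Var 0)"
      by (rule is_interpretationI) (auto simp: variety_of_def intro!: free_cong_identity)
    then have "admits ?One ?M"
      unfolding admits_def by (rule interpretation_clone_hom[OF variety_of_varieties One])
    moreover have "idempotent_condition ?M"
      unfolding idempotent_condition_def idempotent_variety_iff[OF variety_of_varieties]
      by (simp add: variety_of_def)
    moreover have "\<not> trivial_condition ?M" unfolding trivial_condition_iff by simp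
    ultimately show ?thesis unfolding taylor_variety_def strong_maltsev_condition_def by blast
  qed
  then have nonempty: "taylor_types \<noteq> ({} :: 'f variety set set)"
    using taylor_type_iff[OF One] by blast
  have "\<not> taylor_variety ?Zero"
  proof
    assume "taylor_variety ?Zero"
    then obtain M where M: "\<not> trivial_condition M" "admits ?Zero M" unfolding taylor_variety_def by blast
    have "is_interpretation ?Zero SET (\<lambda>f n. Var 0)" by (rule is_interpretationI) auto
    then have "interprets ?Zero SET" by (rule interpretation_clone_hom[OF Zero SET_varieties])
    then show False
      using M interprets_trans unfolding trivial_condition_def admits_def by blast
  qed
  then have proper: "taylor_types \<noteq> carrier ?L"
    using taylor_type_iff[OF Zero] type_in_carrier[OF Zero] by blast
  have sub: "taylor_types \<subseteq> carrier ?L" using type_in_carrier by (auto simp: taylor_types_def)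
  have join_closed: "X \<squnion>\<^bsub>?L\<^esub> Y \<in> taylor_types" if XY: "X \<in> taylor_types" "Y \<in> taylor_types" for X Y
  proof -
    obtain V W where VW: "V \<in> varieties" "taylor_variety V" "X = interpretability_type V"
      "W \<in> varieties" "Y = interpretability_type W"
      using XY by (auto simp: taylor_types_def)
    have "taylor_variety (join_variety i j V W :: 'f variety)"
      by (rule taylor_mono[OF VW(2) join_upper[OF VW(1,4)]])
    then show ?thesis
      using VW by (simp add: join taylor_type_iff join_variety_varieties)
  qed
  have meet_closed: "X \<sqinter>\<^bsub>?L\<^esub> Y \<in> taylor_types" if XY: "X \<in> taylor_types" "Y \<in> taylor_types" for X Y
  proof -
    obtain V W where VW: "V \<in> varieties" "taylor_variety V" "X = interpretability_type V"
      "W \<in> varieties" "taylor_variety W" "Y = interpretability_type W"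
      using XY by (auto simp: taylor_types_def)
    then show ?thesis
      using meet_taylor[OF assms VW(1,4) enc VW(2,5)]
      by (simp add: meet taylor_type_iff meet_variety_varieties)
  qed
  have up: "Y \<in> taylor_types" if X: "X \<in> taylor_types" and Y: "Y \<in> carrier ?L" and le: "X \<sqsubseteq>\<^bsub>?L\<^esub> Y" for X Y
  proof -
    obtain V where V: "V \<in> varieties" "taylor_variety V" "X = interpretability_type V"
      using X by (auto simp: taylor_types_def)
    obtain W where W: "W \<in> varieties" "Y = interpretability_type W" using Y by (rule carrier_type)
    show ?thesis using le V W taylor_mono by (auto simp: type_le_iff taylor_type_iff)
  qed
  have prime: "X \<squnion>\<^bsub>?L\<^esub> Y \<notin> taylor_types"
    if XY: "X \<in> carrier ?L" "Y \<in> carrier ?L" "X \<notin> taylor_types" "Y \<notin> taylor_types" for X Y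
  proof -
    obtain V W where VW: "V \<in> varieties" "X = interpretability_type V" "W \<in> varieties" "Y = interpretability_type W"
      using XY(1,2) by (elim carrier_type)
    then have "\<not> taylor_variety V" "\<not> taylor_variety W" using XY(3,4) by (simp_all add: taylor_type_iff)
    then have "\<not> taylor_variety (join_variety i j V W :: 'f variety)"
      by (rule join_not_taylor[OF assms VW(1,3) ij])
    then show ?thesis using VW by (simp add: join taylor_type_iff join_variety_varieties)
  qed
  show ?thesis
    unfolding prime_filter_def lattice_filter_def
    by (intro conjI ballI impI psubsetI lattice_interp[OF assms] nonempty proper sub)
      (fact join_closed meet_closed prime | erule (2) up)+
qed

end
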